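(* For $A=\begin{pmatrix}a&b\\c&d\end{pmatrix}\in SL(2,\mathbb{R})$ and $f\in L^2(\mathbb{R})$ let $$(F_Af)(x):=\frac1{-cx+a}\,f(A^{-1}\cdot x).$$ Then $F$ is a unitary representation of $SL(2,\mathbb{R})$ in $L^2(\mathbb{R})$ commuting with the Hilbert transformation $H$. Let $F'$ denote the subrepresentation of $\mathcal{F}F\mathcal{F}^{-1}$ on $L^2(\mathbb{R}_+)$ given by $F'_A:=P_+\mathcal{F}F_A\mathcal{F}^{-1}P_+^*$. Then for every $A\in SL(2,\mathbb{R})$ and $\kappa\in L^\infty(\mathbb{R})$ one has the covariance $$W(A\cdot\kappa)=F'_A\,W_\kappa\,F_A'^{-1},$$ where $(A\cdot\kappa)(x):=\kappa(A^{-1}\cdot x)$.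
   Context: For $A=\begin{pmatrix}a&b\\c&d\end{pmatrix}\in SL(2,\mathbb{R})$, $A\cdot x=\frac{ax+b}{cx+d}$ for almost all $x\in\mathbb{R}$. $\mathbb{R}_+=\{x>0\}$. $\mathcal{F}$ is the unitary Fourier transformation on $L^2(\mathbb{R})$ with $\mathcal{F}f(x)=(2\pi)^{-1/2}\int e^{-ixy}f(y)\,dy$ for $f\in L^1\cap L^2$. $P_+:L^2(\mathbb{R})\to L^2(\mathbb{R}_+)$ is restriction and its adjoint $P_+^*$ is extension by zero. For $\kappa\in L^\infty(\mathbb{R})$, $M(\kappa)$ is multiplication by $\kappa$ on $L^2(\mathbb{R})$ and $W_\kappa=W(\kappa):=P_+\mathcal{F}M(\kappa)\mathcal{F}^{-1}P_+^*$ is the Wiener-Hopf operator on $L^2(\mathbb{R}_+)$ with symbol $\kappa$. The Hilbert transformation on $L^2(\mathbb{R})$ is $(Hg)(x)=\frac1{i\pi}\int_{-\infty}^\infty\frac{g(y)}{y-x}\,dy$ (principal value), equivalently $H=\mathcal{F}^{-1}M(\operatorname{sgn})\mathcal{F}$. *)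

theory Defs
  imports "HOL-Analysis.Analysis"
begin

section \<open>Complex \<open>L\<^sup>2\<close> spaces of functions on the line\<close>

text \<open>
  The index type \<open>'d\<close> only selects a measure, so that \<open>L\<^sup>2(\<real>)\<close> and \<open>L\<^sup>2(\<real>\<^sub>+)\<close> are two
  instances, \<open>line L2\<close> and \<open>half_line L2\<close>, of one construction.
\<close>

class line_measure =
  fixes line_measure :: "'a itself \<Rightarrow> real measure"

datatype line = Line

datatype half_line = Half_Line

instantiation line :: line_measure
begin
definition line_measure_line :: "line itself \<Rightarrow> real measure" where
  "line_measure_line _ = lborel"
instance ..
end

instantiation half_line :: line_measure
begin
definition line_measure_half_line :: "half_line itself \<Rightarrow> real measure" where
  "line_measure_half_line _ = restrict_space lborel {0<..}"
instance ..
end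

definition square_integrable :: "real measure \<Rightarrow> (real \<Rightarrow> complex) \<Rightarrow> bool" where
  "square_integrable M f \<longleftrightarrow>
     f \<in> borel_measurable M \<and> integrable M (\<lambda>x. (norm (f x))\<^sup>2)"

lemma square_integrable_zero: "square_integrable M (\<lambda>x. 0)"
  by (simp add: square_integrable_def)

lemma square_integrable_cmult:
  assumes "square_integrable M f" shows "square_integrable M (\<lambda>x. c * f x)"
  using assms by (auto simp: square_integrable_def norm_mult power_mult_distrib)

lemma square_integrable_add:
  assumes "square_integrable M f" "square_integrable M g"
  shows "square_integrable M (\<lambda>x. f x + g x)"
proof -
  have [measurable]: "f \<in> borel_measurable M" "g \<in> borel_measurable M"
    using assms by (auto simp: square_integrable_def)
  have "integrable M (\<lambda>x. 2 * (norm (f x))\<^sup>2 + 2 * (norm (g x))\<^sup>2)"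
    using assms by (auto simp: square_integrable_def)
  then have "integrable M (\<lambda>x. (norm (f x + g x))\<^sup>2)"
  proof (rule Bochner_Integration.integrable_bound)
    have "(norm (f x + g x))\<^sup>2 \<le> 2 * (norm (f x))\<^sup>2 + 2 * (norm (g x))\<^sup>2" for x
    proof -
      have "(norm (f x + g x))\<^sup>2 \<le> (norm (f x) + norm (g x))\<^sup>2"
        by (intro power_mono norm_triangle_ineq norm_ge_zero)
      also have "\<dots> \<le> 2 * (norm (f x))\<^sup>2 + 2 * (norm (g x))\<^sup>2"
        using sum_squares_bound[of "norm (f x)" "norm (g x)"] by (simp add: power2_sum)
      finally show ?thesis .
    qed
    then show "AE x in M. norm ((norm (f x + g x))\<^sup>2)
        \<le> norm (2 * (norm (f x))\<^sup>2 + 2 * (norm (g x))\<^sup>2)"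
      by simp
  qed measurable
  then show ?thesis by (simp add: square_integrable_def)
qed

lemma borel_measurable_cnj [measurable]: "cnj \<in> borel_measurable borel"
  by (intro borel_measurable_continuous_onI continuous_intros)

lemma integrable_square_integrable_mult:
  assumes "square_integrable M f" "square_integrable M g"
  shows "integrable M (\<lambda>x. f x * cnj (g x))"
proof -
  have [measurable]: "f \<in> borel_measurable M" "g \<in> borel_measurable M"
    using assms by (auto simp: square_integrable_def)
  have "integrable M (\<lambda>x. (norm (f x))\<^sup>2 + (norm (g x))\<^sup>2)"
    using assms by (auto simp: square_integrable_def)
  then show ?thesis
  proof (rule Bochner_Integration.integrable_bound)
    have "norm (f x) * norm (g x) \<le> (norm (f x))\<^sup>2 + (norm (g x))\<^sup>2" for x
      using sum_squares_bound[of "norm (f x)" "norm (g x)"]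
        mult_nonneg_nonneg[OF norm_ge_zero[of "f x"] norm_ge_zero[of "g x"]] by linarith
    then show "AE x in M. norm (f x * cnj (g x)) \<le> norm ((norm (f x))\<^sup>2 + (norm (g x))\<^sup>2)"
      by (simp add: norm_mult)
  qed measurable
qed

definition L2_rel :: "'d::line_measure itself \<Rightarrow> (real \<Rightarrow> complex) \<Rightarrow> (real \<Rightarrow> complex) \<Rightarrow> bool" where
  "L2_rel T f g \<longleftrightarrow>
     square_integrable (line_measure T) f \<and> square_integrable (line_measure T) g \<and>
     (AE x in line_measure T. f x = g x)"

typedef (overloaded) 'd L2 =
  "{{g. L2_rel TYPE('d::line_measure) f g} | f. square_integrable (line_measure TYPE('d)) f}"
  using square_integrable_zero by blast

text \<open>A representative, chosen arbitrarily.\<close>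

definition L2_fun :: "'d::line_measure L2 \<Rightarrow> real \<Rightarrow> complex" where
  "L2_fun u = (SOME f. f \<in> Rep_L2 u)"

text \<open>The class of \<open>f\<close>, with the dummy value \<open>0\<close> if \<open>f\<close> is not square integrable.\<close>

definition L2_class :: "(real \<Rightarrow> complex) \<Rightarrow> 'd::line_measure L2" where
  "L2_class f = Abs_L2 {g. L2_rel TYPE('d)
     (if square_integrable (line_measure TYPE('d)) f then f else (\<lambda>_. 0)) g}"

lemma L2_fun_in_Rep: "L2_fun u \<in> Rep_L2 (u :: 'd::line_measure L2)"
proof -
  obtain f where "Rep_L2 u = {g. L2_rel TYPE('d) f g}"
      "square_integrable (line_measure TYPE('d)) f"
    using Rep_L2[of u] by blast
  then have "f \<in> Rep_L2 u" by (simp add: L2_rel_def)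
  then show ?thesis unfolding L2_fun_def by (rule someI[where P = "\<lambda>f. f \<in> Rep_L2 u"])
qed

lemma square_integrable_L2_fun:
  "square_integrable (line_measure TYPE('d)) (L2_fun (u :: 'd::line_measure L2))"
proof -
  obtain f where "Rep_L2 u = {g. L2_rel TYPE('d) f g}"
    using Rep_L2[of u] by blast
  then show ?thesis using L2_fun_in_Rep[of u] by (simp add: L2_rel_def)
qed

lemma L2_fun_L2_class:
  assumes "square_integrable (line_measure TYPE('d)) f"
  shows "AE x in line_measure TYPE('d). L2_fun (L2_class f :: 'd::line_measure L2) x = f x"
proof -
  have "Rep_L2 (L2_class f :: 'd L2) = {g. L2_rel TYPE('d) f g}"
    using assms by (auto simp: L2_class_def intro!: Abs_L2_inverse)
  then show ?thesis
    using L2_fun_in_Rep[of "L2_class f :: 'd L2"] by (auto simp: L2_rel_def)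
qed

lemma L2_class_L2_fun: "L2_class (L2_fun u) = (u :: 'd::line_measure L2)"
proof -
  obtain f where f: "Rep_L2 u = {g. L2_rel TYPE('d) f g}"
    using Rep_L2[of u] by blast
  have "L2_rel TYPE('d) f (L2_fun u)"
    using L2_fun_in_Rep[of u] f by simp
  then have "{g. L2_rel TYPE('d) (L2_fun u) g} = Rep_L2 u"
    unfolding f by (auto simp: L2_rel_def)
  then show ?thesis
    by (simp add: L2_class_def square_integrable_L2_fun Rep_L2_inverse)
qed

lemma L2_class_cong:
  assumes "square_integrable (line_measure TYPE('d)) f"
    and "square_integrable (line_measure TYPE('d)) g"
    and "AE x in line_measure TYPE('d). f x = g x"
  shows "L2_class f = (L2_class g :: 'd::line_measure L2)"
proof -
  have "{h. L2_rel TYPE('d) f h} = {h. L2_rel TYPE('d) g h}"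
    using assms by (auto simp: L2_rel_def)
  then show ?thesis using assms by (simp add: L2_class_def)
qed

lemma L2_eqI:
  assumes "AE x in line_measure TYPE('d). L2_fun u x = L2_fun v x"
  shows "u = (v :: 'd::line_measure L2)"
  using L2_class_cong[OF square_integrable_L2_fun square_integrable_L2_fun assms]
  by (simp add: L2_class_L2_fun)

definition scaleC :: "complex \<Rightarrow> 'd::line_measure L2 \<Rightarrow> 'd L2" where
  "scaleC c u = L2_class (\<lambda>x. c * L2_fun u x)"

definition cinner :: "'d::line_measure L2 \<Rightarrow> 'd L2 \<Rightarrow> complex" where
  "cinner u v = (LINT x|line_measure TYPE('d). L2_fun u x * cnj (L2_fun v x))"

lemma L2_fun_scaleC:
  "AE x in line_measure TYPE('d). L2_fun (scaleC c u :: 'd::line_measure L2) x = c * L2_fun u x"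
  unfolding scaleC_def
  by (intro L2_fun_L2_class square_integrable_cmult square_integrable_L2_fun)

lemma cinner_cong_AE:
  assumes "AE x in line_measure TYPE('d). L2_fun u x = f x"
    and "f \<in> borel_measurable (line_measure TYPE('d))"
  shows "cinner u v = (LINT x|line_measure TYPE('d). f x * cnj (L2_fun (v :: 'd::line_measure L2) x))"
proof -
  have [measurable]: "L2_fun u \<in> borel_measurable (line_measure TYPE('d))"
      "L2_fun v \<in> borel_measurable (line_measure TYPE('d))"
      "f \<in> borel_measurable (line_measure TYPE('d))"
    using assms square_integrable_L2_fun[of u] square_integrable_L2_fun[of v]
    by (auto simp: square_integrable_def)
  show ?thesis
    unfolding cinner_def
    by (rule integral_cong_AE, measurable) (use assms(1) in \<open>auto elim: eventually_mono\<close>)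
qed

lemma integrable_cinner:
  "integrable (line_measure TYPE('d)) (\<lambda>x. L2_fun u x * cnj (L2_fun v x))"
  for u v :: "'d::line_measure L2"
  by (intro integrable_square_integrable_mult square_integrable_L2_fun)

lemma cinner_commute: "cinner v u = cnj (cinner u v)"
proof -
  have "cnj (cinner u v) =
      (LINT x|line_measure TYPE('a). cnj (L2_fun u x * cnj (L2_fun v x)))"
    unfolding cinner_def by (rule Bochner_Integration.integral_cnj[symmetric])
  then show ?thesis by (simp add: cinner_def mult.commute)
qed

lemma cinner_scaleC_left: "cinner (scaleC c u) v = c * cinner u v"
proof -
  have "cinner (scaleC c u) v =
      (LINT x|line_measure TYPE('a). c * L2_fun u x * cnj (L2_fun v x))"
    using square_integrable_L2_fun[of u]
    by (intro cinner_cong_AE L2_fun_scaleC) (auto simp: square_integrable_def)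
  also have "\<dots> = c * cinner u v"
    by (simp add: cinner_def mult.assoc)
  finally show ?thesis .
qed

lemma cinner_self:
  "cinner u u = complex_of_real
     (LINT x|line_measure TYPE('d). (norm (L2_fun (u :: 'd::line_measure L2) x))\<^sup>2)"
proof -
  have "(\<lambda>x. L2_fun u x * cnj (L2_fun u x)) = (\<lambda>x. complex_of_real ((norm (L2_fun u x))\<^sup>2))"
    by (simp add: fun_eq_iff complex_norm_square del: of_real_power)
  then show ?thesis by (simp add: cinner_def del: of_real_power)
qed

instantiation L2 :: (line_measure) real_inner
begin

definition zero_L2 :: "'a L2" where
  "0 = (L2_class (\<lambda>x. 0) :: 'a L2)"

definition plus_L2 :: "'a L2 \<Rightarrow> 'a L2 \<Rightarrow> 'a L2" where
  "u + v = L2_class (\<lambda>x. L2_fun u x + L2_fun v x)" for u v :: "'a L2"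

definition uminus_L2 :: "'a L2 \<Rightarrow> 'a L2" where
  "- u = scaleC (- 1) u" for u :: "'a L2"

definition minus_L2 :: "'a L2 \<Rightarrow> 'a L2 \<Rightarrow> 'a L2" where
  "u - v = u + (- v)" for u v :: "'a L2"

definition scaleR_L2 :: "real \<Rightarrow> 'a L2 \<Rightarrow> 'a L2" where
  "r *\<^sub>R u = scaleC (complex_of_real r) u" for u :: "'a L2"

definition inner_L2 :: "'a L2 \<Rightarrow> 'a L2 \<Rightarrow> real" where
  "u \<bullet> v = Re (cinner u v)" for u v :: "'a L2"

definition norm_L2 :: "'a L2 \<Rightarrow> real" where
  "norm u = sqrt (u \<bullet> u)" for u :: "'a L2"

definition dist_L2 :: "'a L2 \<Rightarrow> 'a L2 \<Rightarrow> real" where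
  "dist u v = norm (u - v)" for u v :: "'a L2"

definition sgn_L2 :: "'a L2 \<Rightarrow> 'a L2" where
  "sgn u = scaleR (inverse (norm u)) u" for u :: "'a L2"

definition uniformity_L2 :: "('a L2 \<times> 'a L2) filter" where
  "uniformity_L2 = (INF e\<in>{0<..}. principal {(u, v). dist u v < e})"

definition open_L2 :: "'a L2 set \<Rightarrow> bool" where
  "open_L2 U = (\<forall>u\<in>U. \<forall>\<^sub>F (u', v) in uniformity. u' = u \<longrightarrow> v \<in> U)"

lemma L2_fun_zero: "AE x in line_measure TYPE('a). L2_fun (0 :: 'a L2) x = 0"
  unfolding zero_L2_def by (intro L2_fun_L2_class square_integrable_zero)

lemma L2_fun_plus:
  "AE x in line_measure TYPE('a). L2_fun (u + v :: 'a L2) x = L2_fun u x + L2_fun v x"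
  unfolding plus_L2_def
  by (intro L2_fun_L2_class square_integrable_add square_integrable_L2_fun)

instance
proof
  fix u v w :: "'a L2" and r s :: real
  note [simp] = scaleR_L2_def
  show "u + v + w = u + (v + w)"
    using L2_fun_plus[of "u + v" w] L2_fun_plus[of u v] L2_fun_plus[of u "v + w"] L2_fun_plus[of v w]
    by (intro L2_eqI, eventually_elim) simp
  show "u + v = v + u"
    using L2_fun_plus[of u v] L2_fun_plus[of v u]
    by (intro L2_eqI, eventually_elim) simp
  show "0 + u = u"
    using L2_fun_plus[of 0 u] L2_fun_zero
    by (intro L2_eqI, eventually_elim) simp
  show "- u + u = 0"
    using L2_fun_plus[of "- u" u] L2_fun_zero L2_fun_scaleC[of "- 1" u]
    by (intro L2_eqI, eventually_elim) (simp add: uminus_L2_def)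
  show "u - v = u + - v"
    by (rule minus_L2_def)
  show "r *\<^sub>R (u + v) = r *\<^sub>R u + r *\<^sub>R v"
    using L2_fun_plus[of u v] L2_fun_plus[of "r *\<^sub>R u" "r *\<^sub>R v"]
      L2_fun_scaleC[of r u] L2_fun_scaleC[of r v] L2_fun_scaleC[of r "u + v"]
    by (intro L2_eqI, eventually_elim) (simp add: algebra_simps)
  show "(r + s) *\<^sub>R u = r *\<^sub>R u + s *\<^sub>R u"
    using L2_fun_plus[of "r *\<^sub>R u" "s *\<^sub>R u"]
      L2_fun_scaleC[of r u] L2_fun_scaleC[of s u] L2_fun_scaleC[of "of_real (r + s)" u]
    by (intro L2_eqI, eventually_elim) (simp add: algebra_simps)
  show "r *\<^sub>R s *\<^sub>R u = (r * s) *\<^sub>R u"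
    using L2_fun_scaleC[of r "s *\<^sub>R u"] L2_fun_scaleC[of s u] L2_fun_scaleC[of "of_real (r * s)" u]
    by (intro L2_eqI, eventually_elim) simp
  show "1 *\<^sub>R u = u"
    using L2_fun_scaleC[of 1 u] by (intro L2_eqI, eventually_elim) simp
  show "dist u v = norm (u - v)"
    by (rule dist_L2_def)
  show "sgn u = scaleR (inverse (norm u)) u"
    by (rule sgn_L2_def)
  show "norm u = sqrt (u \<bullet> u)"
    by (rule norm_L2_def)
  show "u \<bullet> v = v \<bullet> u"
    unfolding inner_L2_def by (subst cinner_commute) simp
  have "cinner (u + v) w =
      (LINT x|line_measure TYPE('a). (L2_fun u x + L2_fun v x) * cnj (L2_fun w x))"
    using square_integrable_L2_fun[of u] square_integrable_L2_fun[of v]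
    by (intro cinner_cong_AE L2_fun_plus) (auto simp: square_integrable_def)
  also have "\<dots> = cinner u w + cinner v w"
    by (simp add: cinner_def distrib_right integrable_cinner)
  finally show "(u + v) \<bullet> w = u \<bullet> w + v \<bullet> w"
    by (simp add: inner_L2_def)
  show "(r *\<^sub>R u) \<bullet> v = r * (u \<bullet> v)"
    by (simp add: inner_L2_def cinner_scaleC_left)
  show "0 \<le> u \<bullet> u"
    by (simp add: inner_L2_def cinner_self)
  have "u \<bullet> u = 0 \<longleftrightarrow> (AE x in line_measure TYPE('a). (norm (L2_fun u x))\<^sup>2 = 0)"
    using square_integrable_L2_fun[of u] unfolding inner_L2_def cinner_self Re_complex_of_real
    by (intro integral_nonneg_eq_0_iff_AE) (auto simp: square_integrable_def)
  also have "\<dots> \<longleftrightarrow> u = 0"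
  proof
    assume "AE x in line_measure TYPE('a). (norm (L2_fun u x))\<^sup>2 = 0"
    then show "u = 0"
      using L2_fun_zero by (intro L2_eqI, eventually_elim) simp
  qed (use L2_fun_zero in \<open>auto elim: eventually_mono\<close>)
  finally show "u \<bullet> u = 0 \<longleftrightarrow> u = 0" .
qed (simp_all add: uniformity_L2_def open_L2_def)

end

definition unitary_op :: "('d::line_measure L2 \<Rightarrow> 'd L2) \<Rightarrow> bool" where
  "unitary_op T \<longleftrightarrow>
     (\<forall>u v. T (u + v) = T u + T v) \<and>
     (\<forall>c u. T (scaleC c u) = scaleC c (T u)) \<and>
     bij T \<and>
     (\<forall>u v. cinner (T u) (T v) = cinner u v)"


section \<open>\<open>SL(2,\<real>)\<close> and its unitary representations\<close>

definition SL2 :: "(real^2^2) set" where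
  "SL2 = {A. det A = 1}"

text \<open>The action on \<open>\<real>\<close> is defined outside at most one point, where division by zero yields \<open>0\<close>.\<close>

definition moebius :: "real^2^2 \<Rightarrow> real \<Rightarrow> real" where
  "moebius A x = (A $ 1 $ 1 * x + A $ 1 $ 2) / (A $ 2 $ 1 * x + A $ 2 $ 2)"

text \<open>As usual for topological groups, a unitary representation is strongly continuous.\<close>

definition unitary_rep_SL2 :: "(real^2^2 \<Rightarrow> 'd::line_measure L2 \<Rightarrow> 'd L2) \<Rightarrow> bool" where
  "unitary_rep_SL2 \<pi> \<longleftrightarrow>
     (\<forall>A\<in>SL2. unitary_op (\<pi> A)) \<and>
     \<pi> (mat 1) = id \<and>
     (\<forall>A\<in>SL2. \<forall>B\<in>SL2. \<pi> (A ** B) = \<pi> A \<circ> \<pi> B) \<and>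
     (\<forall>u. continuous_on SL2 (\<lambda>A. \<pi> A u))"


section \<open>Operators on \<open>L\<^sup>2(\<real>)\<close> and \<open>L\<^sup>2(\<real>\<^sub>+)\<close>\<close>

text \<open>
  Integrability of \<open>L2_fun u\<close> does not depend on the representative, so the
  condition on \<open>T\<close> is the integral formula on \<open>L\<^sup>1 \<inter> L\<^sup>2\<close>.
\<close>

definition fourier :: "line L2 \<Rightarrow> line L2" where
  "fourier = (THE T. unitary_op T \<and>
     (\<forall>u. integrable lborel (L2_fun u) \<longrightarrow>
       (AE x in lborel. L2_fun (T u) x =
          complex_of_real (1 / sqrt (2 * pi)) *
          (LINT y|lborel. exp (- \<i> * complex_of_real (x * y)) * L2_fun u y))))"

text \<open>
  The principal value is the limit of the truncated integrals as \<open>\<epsilon>\<close> tends to \<open>0\<close> from above,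
  taken in the norm of \<open>L\<^sup>2(\<real>)\<close>.
\<close>

definition hilbert_truncated :: "real \<Rightarrow> line L2 \<Rightarrow> line L2" where
  "hilbert_truncated \<epsilon> u = L2_class (\<lambda>x.
     1 / (\<i> * complex_of_real pi) *
     (LINT y:{y. \<epsilon> < \<bar>y - x\<bar>}|lborel. L2_fun u y / complex_of_real (y - x)))"

definition hilbert :: "line L2 \<Rightarrow> line L2" where
  "hilbert u = Lim (at_right 0) (\<lambda>\<epsilon>. hilbert_truncated \<epsilon> u)"

definition Linf :: "(real \<Rightarrow> complex) set" where
  "Linf = {\<kappa> \<in> borel_measurable lborel. \<exists>C. AE x in lborel. norm (\<kappa> x) \<le> C}"

definition mult_op :: "(real \<Rightarrow> complex) \<Rightarrow> line L2 \<Rightarrow> line L2" where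
  "mult_op \<kappa> u = L2_class (\<lambda>x. \<kappa> x * L2_fun u x)"

definition P_plus :: "line L2 \<Rightarrow> half_line L2" where
  "P_plus u = L2_class (L2_fun u)"

definition P_plus_adj :: "half_line L2 \<Rightarrow> line L2" where
  "P_plus_adj v = L2_class (\<lambda>x. if 0 < x then L2_fun v x else 0)"

definition wiener_hopf :: "(real \<Rightarrow> complex) \<Rightarrow> half_line L2 \<Rightarrow> half_line L2" where
  "wiener_hopf \<kappa> = P_plus \<circ> fourier \<circ> mult_op \<kappa> \<circ> inv fourier \<circ> P_plus_adj"

definition F_rep :: "real^2^2 \<Rightarrow> line L2 \<Rightarrow> line L2" where
  "F_rep A u = L2_class (\<lambda>x.
     complex_of_real (1 / (- (A $ 2 $ 1) * x + A $ 1 $ 1)) * L2_fun u (moebius (matrix_inv A) x))"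

definition fourier_F_rep :: "real^2^2 \<Rightarrow> line L2 \<Rightarrow> line L2" where
  "fourier_F_rep A = fourier \<circ> F_rep A \<circ> inv fourier"

definition F'_rep :: "real^2^2 \<Rightarrow> half_line L2 \<Rightarrow> half_line L2" where
  "F'_rep A = P_plus \<circ> fourier \<circ> F_rep A \<circ> inv fourier \<circ> P_plus_adj"

definition symbol_act :: "real^2^2 \<Rightarrow> (real \<Rightarrow> complex) \<Rightarrow> real \<Rightarrow> complex" where
  "symbol_act A \<kappa> = (\<lambda>x. \<kappa> (moebius (matrix_inv A) x))"

end

(*
  Cauchy kernels k_w(y) = 1/(y - w) with Im w \<noteq> 0 span a dense subspace of L^2(R), and
  F_A k_w = k_(A.w) / (c w + d), where A.w lies in the same half plane as w.  Moreover
  F^-1 of a one-sided exponential is a multiple of a Cauchy kernel, so P = F^-1 1_(xi > 0) F is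
  the projection that keeps k_w for Im w < 0 and kills it for Im w > 0.  Hence F_A commutes with P.
  This yields at once the commutation with H = 2 P - 1, the invariance of L^2(R_+) under the
  conjugated representation, and, since F_A M(kappa) = M(A.kappa) F_A, the covariance of
  Wiener-Hopf operators; strong continuity is read off from the continuity of w |-> k_w.

  Plancherel's theorem rests on the same functions: one-sided exponentials e^(-n|y|) are dense by
  the Weierstrass theorem, on their span the Fourier integral is isometric by an arctan integral,
  and the symmetry of the kernel e^(-ixy) makes the isometric extension surjective.

  The truncated Hilbert transformation is the conjugate Poisson integral, i.e. the multiplier
  sgn(xi) e^(-eps|xi|), plus a convolution with the eps-dilate of an odd integrable function,
  which tends strongly to 0.
*)
theory Submission
  imports Defs "HOL-Probability.Sinc_Integral" "HOL-Real_Asymp.Real_Asymp"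
begin

section \<open>Hilbert space structure of \<open>L\<^sup>2\<close>\<close>

text \<open>\<open>fourier\<close> is a definite description and \<open>hilbert\<close> a limit, so
  nothing can be computed with either before existence is proved. The excised interval |y - x| \<le>
  \<epsilon> is not carried to an interval of the same kind by a Moebius map; commutation with H is
  therefore invisible on the truncated integrals and has to be read off from a formula for H in
  which no truncation is left. The half planes enter through the sign in exp(-ixy): F^-1 of a
  function living on \<xi> > 0 continues analytically to the upper half plane, so the poles of the
  corresponding kernels lie below the axis. A determinant that is positive keeps each half plane.
  The weight 1/(-cx + a) is a square root of the derivative of A^-1.x, whence the unitarity of F_A.
  Throughout, \<open>L2_class\<close> sends a function outside L2 to 0 and representatives are
  arbitrary. Hence each identity between classes comes with a proof of square integrability and an
  almost everywhere argument.\<close>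

lemma L2_class_add:
  assumes "square_integrable (line_measure TYPE('d)) f" "square_integrable (line_measure TYPE('d)) g"
  shows "L2_class (\<lambda>x. f x + g x) = (L2_class f + L2_class g :: 'd::line_measure L2)"
  unfolding plus_L2_def
  using L2_fun_L2_class[OF assms(1)] L2_fun_L2_class[OF assms(2)]
  by (intro L2_class_cong square_integrable_add assms square_integrable_L2_fun, eventually_elim) simp

lemma scaleC_L2_class:
  assumes "square_integrable (line_measure TYPE('d)) f"
  shows "scaleC c (L2_class f) = (L2_class (\<lambda>x. c * f x) :: 'd::line_measure L2)"
  unfolding scaleC_def
  using L2_fun_L2_class[OF assms]
  by (intro L2_class_cong square_integrable_cmult assms square_integrable_L2_fun, eventually_elim) simp

lemma L2_class_diff:
  assumes "square_integrable (line_measure TYPE('d)) f" "square_integrable (line_measure TYPE('d)) g"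
  shows "L2_class (\<lambda>x. f x - g x) = (L2_class f - L2_class g :: 'd::line_measure L2)"
proof -
  have "square_integrable (line_measure TYPE('d)) (\<lambda>x. (- 1) * g x)"
    by (rule square_integrable_cmult[OF assms(2)])
  then show ?thesis
    using L2_class_add[OF assms(1), of "\<lambda>x. (- 1) * g x"]
    by (simp add: minus_L2_def uminus_L2_def scaleC_L2_class assms(2))
qed

lemma square_integrable_diff:
  assumes "square_integrable M f" "square_integrable M g"
  shows "square_integrable M (\<lambda>x. f x - g x)"
  using square_integrable_add[OF assms(1) square_integrable_cmult[OF assms(2), of "- 1"]] by simp

lemma L2_class_eq_iff:
  assumes "square_integrable (line_measure TYPE('d)) f" "square_integrable (line_measure TYPE('d)) g"
  shows "L2_class f = (L2_class g :: 'd::line_measure L2) \<longleftrightarrow>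
    (AE x in line_measure TYPE('d). f x = g x)"
proof
  assume eq: "L2_class f = (L2_class g :: 'd L2)"
  show "AE x in line_measure TYPE('d). f x = g x"
    using L2_fun_L2_class[OF assms(1)] L2_fun_L2_class[OF assms(2)] unfolding eq
    by eventually_elim simp
qed (rule L2_class_cong[OF assms])

lemma L2_fun_diff:
  "AE x in line_measure TYPE('d). L2_fun (u - v :: 'd::line_measure L2) x = L2_fun u x - L2_fun v x"
  using L2_fun_plus[of u "- v"] L2_fun_scaleC[of "- 1" v]
  by eventually_elim (simp add: minus_L2_def uminus_L2_def)

lemma norm_L2_sq:
  "(norm u)\<^sup>2 = (LINT x|line_measure TYPE('d). (norm (L2_fun (u :: 'd::line_measure L2) x))\<^sup>2)"
  by (simp add: power2_norm_eq_inner inner_L2_def cinner_self)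

lemma cinner_L2_class:
  assumes "square_integrable (line_measure TYPE('d)) f" "square_integrable (line_measure TYPE('d)) g"
  shows "cinner (L2_class f) (L2_class g :: 'd::line_measure L2) =
    (LINT x|line_measure TYPE('d). f x * cnj (g x))"
proof -
  have [measurable]: "f \<in> borel_measurable (line_measure TYPE('d))"
    "g \<in> borel_measurable (line_measure TYPE('d))"
    "L2_fun (L2_class f :: 'd L2) \<in> borel_measurable (line_measure TYPE('d))"
    "L2_fun (L2_class g :: 'd L2) \<in> borel_measurable (line_measure TYPE('d))"
    using assms square_integrable_L2_fun[of "L2_class f :: 'd L2"]
      square_integrable_L2_fun[of "L2_class g :: 'd L2"]
    by (auto simp: square_integrable_def)
  show ?thesis
    unfolding cinner_def
    by (rule integral_cong_AE, measurable)
      (use L2_fun_L2_class[OF assms(1)] L2_fun_L2_class[OF assms(2)] in \<open>eventually_elim, simp\<close>)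
qed

lemma norm_L2_class_sq:
  assumes "square_integrable (line_measure TYPE('d)) f"
  shows "(norm (L2_class f :: 'd::line_measure L2))\<^sup>2 = (LINT x|line_measure TYPE('d). (norm (f x))\<^sup>2)"
proof -
  have "(\<lambda>x. f x * cnj (f x)) = (\<lambda>x. complex_of_real ((norm (f x))\<^sup>2))"
    by (simp add: fun_eq_iff complex_norm_square del: of_real_power)
  then show ?thesis
    by (simp add: power2_norm_eq_inner inner_L2_def cinner_L2_class[OF assms assms] del: of_real_power)
qed

lemma norm_L2_class_le:
  assumes "square_integrable (line_measure TYPE('d)) f" "square_integrable (line_measure TYPE('d)) g"
    and "AE x in line_measure TYPE('d). norm (f x) \<le> norm (g x)"
  shows "norm (L2_class f :: 'd::line_measure L2) \<le> norm (L2_class g :: 'd::line_measure L2)"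
proof -
  have "(norm (L2_class f :: 'd L2))\<^sup>2 \<le> (norm (L2_class g :: 'd L2))\<^sup>2"
    unfolding norm_L2_class_sq[OF assms(1)] norm_L2_class_sq[OF assms(2)]
    using assms by (intro integral_mono_AE) (auto simp: square_integrable_def elim!: eventually_mono)
  then show ?thesis by (rule power2_le_imp_le) simp
qed

lemma square_integrable_bound:
  assumes "square_integrable M g" "f \<in> borel_measurable M" "AE x in M. norm (f x) \<le> norm (g x)"
  shows "square_integrable M f"
  unfolding square_integrable_def
proof
  show "integrable M (\<lambda>x. (norm (f x))\<^sup>2)"
    by (rule Bochner_Integration.integrable_bound[of _ "\<lambda>x. (norm (g x))\<^sup>2"])
      (use assms in \<open>auto simp: square_integrable_def elim!: eventually_mono\<close>)
qed fact

section \<open>Complex linear structure and sesquilinearity\<close>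

lemma scaleC_add_right: "scaleC c (u + v) = scaleC c u + scaleC c (v :: 'd::line_measure L2)"
  using L2_fun_plus[of u v] L2_fun_plus[of "scaleC c u" "scaleC c v"]
    L2_fun_scaleC[of c u] L2_fun_scaleC[of c v] L2_fun_scaleC[of c "u + v"]
  by (intro L2_eqI, eventually_elim) (simp add: algebra_simps)

lemma scaleC_add_left: "scaleC (c + d) u = scaleC c u + scaleC d (u :: 'd::line_measure L2)"
  using L2_fun_plus[of "scaleC c u" "scaleC d u"]
    L2_fun_scaleC[of c u] L2_fun_scaleC[of d u] L2_fun_scaleC[of "c + d" u]
  by (intro L2_eqI, eventually_elim) (simp add: algebra_simps)

lemma scaleC_scaleC [simp]: "scaleC c (scaleC d u) = scaleC (c * d) (u :: 'd::line_measure L2)"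
  using L2_fun_scaleC[of c "scaleC d u"] L2_fun_scaleC[of d u] L2_fun_scaleC[of "c * d" u]
  by (intro L2_eqI, eventually_elim) simp

lemma scaleC_one [simp]: "scaleC 1 u = (u :: 'd::line_measure L2)"
  using L2_fun_scaleC[of 1 u] by (intro L2_eqI, eventually_elim) simp

lemma scaleC_zero_left [simp]: "scaleC 0 u = (0 :: 'd::line_measure L2)"
  using L2_fun_scaleC[of 0 u] L2_fun_zero by (intro L2_eqI, eventually_elim) simp

lemma scaleC_minus1: "scaleC (- 1) u = - (u :: 'd::line_measure L2)"
  by (simp add: uminus_L2_def)

lemma cinner_add_left: "cinner (u + v) w = cinner u w + cinner v (w :: 'd::line_measure L2)"
proof -
  have "cinner (u + v) w =
      (LINT x|line_measure TYPE('d). (L2_fun u x + L2_fun v x) * cnj (L2_fun w x))"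
    using square_integrable_L2_fun[of u] square_integrable_L2_fun[of v]
    by (intro cinner_cong_AE L2_fun_plus) (auto simp: square_integrable_def)
  also have "\<dots> = cinner u w + cinner v w"
    by (simp add: cinner_def distrib_right integrable_cinner)
  finally show ?thesis .
qed

lemma cinner_add_right: "cinner u (v + w) = cinner u v + cinner u (w :: 'd::line_measure L2)"
  by (subst (1 2 3) cinner_commute) (simp add: cinner_add_left)

lemma cinner_scaleC_right: "cinner u (scaleC c v) = cnj c * cinner u v"
  by (subst (1 2) cinner_commute) (simp add: cinner_scaleC_left)

lemma cinner_zero_left [simp]: "cinner 0 u = 0"
  using cinner_scaleC_left[of 0 u u] by simp

lemma cinner_zero_right [simp]: "cinner u 0 = 0"
  by (subst cinner_commute) simp

lemma cinner_diff_right: "cinner w (u - v) = cinner w u - cinner w (v :: 'd::line_measure L2)"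
  using cinner_add_right[of w "u - v" v] by simp

lemma norm_L2_eq_cinner: "norm u = sqrt (Re (cinner u u))"
  by (simp add: norm_L2_def inner_L2_def)

lemma cinner_self_eq_0_iff: "cinner u u = 0 \<longleftrightarrow> u = (0 :: 'd::line_measure L2)"
proof -
  have "cinner u u = complex_of_real (u \<bullet> u)"
    by (simp add: inner_L2_def cinner_self)
  then show ?thesis by simp
qed

text \<open>Conjugate linearity in the second argument turns the imaginary part into a real inner
  product with \<open>scaleC \<i> v\<close>. Limits and continuity of \<open>cinner\<close> are
  thereby inherited from the real inner product space.\<close>

lemma cinner_conv_inner: "cinner u v = Complex (u \<bullet> v) (u \<bullet> scaleC \<i> v)"
  by (simp add: inner_L2_def cinner_scaleC_right complex_eq_iff)

lemma norm_scaleC [simp]: "norm (scaleC c u) = norm c * norm (u :: 'd::line_measure L2)"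
proof -
  have "cinner (scaleC c u) (scaleC c u) = complex_of_real ((norm c)\<^sup>2) * cinner u u"
    by (simp only: cinner_scaleC_left cinner_scaleC_right complex_norm_square mult_ac)
  then show ?thesis
    by (simp add: norm_L2_eq_cinner real_sqrt_mult del: of_real_power)
qed

lemma bounded_linear_scaleC: "bounded_linear (scaleC c :: 'd::line_measure L2 \<Rightarrow> 'd L2)"
  by (rule bounded_linear_intro[where K = "norm c"])
    (simp_all add: scaleC_add_right scaleR_L2_def mult.commute)

lemma scaleC_zero_right [simp]: "scaleC c 0 = (0 :: 'd::line_measure L2)"
  by (rule linear_simps(3)[OF bounded_linear_scaleC])

lemmas tendsto_scaleC [tendsto_intros] = bounded_linear.tendsto[OF bounded_linear_scaleC]
lemmas continuous_on_scaleC' [continuous_intros] = bounded_linear.continuous_on[OF bounded_linear_scaleC]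

lemma tendsto_cinner [tendsto_intros]:
  assumes "(u \<longlongrightarrow> a) F" "(v \<longlongrightarrow> b) F"
  shows "((\<lambda>x. cinner (u x) (v x)) \<longlongrightarrow> cinner a b) F"
  unfolding cinner_conv_inner by (intro tendsto_intros assms)

lemma continuous_on_cinner [continuous_intros]:
  assumes "continuous_on S f" "continuous_on S g"
  shows "continuous_on S (\<lambda>x. cinner (f x) (g x))"
  using assms unfolding continuous_on_def by (auto intro: tendsto_cinner)

section \<open>Dominated convergence and completeness\<close>

lemma tendsto_L2_class_dominated:
  fixes f :: "nat \<Rightarrow> real \<Rightarrow> complex"
  assumes f: "\<And>n. f n \<in> borel_measurable (line_measure TYPE('d))"
    and g: "g \<in> borel_measurable (line_measure TYPE('d))"
    and w: "square_integrable (line_measure TYPE('d)) w"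
    and lim: "AE x in line_measure TYPE('d). (\<lambda>n. f n x) \<longlonglongrightarrow> g x"
    and bound: "\<And>n. AE x in line_measure TYPE('d). norm (f n x) \<le> norm (w x)"
  shows "(\<lambda>n. L2_class (f n)) \<longlonglongrightarrow> (L2_class g :: 'd::line_measure L2)"
proof -
  let ?M = "line_measure TYPE('d)"
  note [measurable] = f g
  have all_bound: "AE x in ?M. \<forall>n. norm (f n x) \<le> norm (w x)"
    using bound by (simp add: AE_all_countable)
  have gw: "AE x in ?M. norm (g x) \<le> norm (w x)"
    using lim all_bound
  proof eventually_elim
    case (elim x)
    then show ?case by (intro LIMSEQ_le_const2[OF tendsto_norm]) auto
  qed
  have sf: "square_integrable ?M (f n)" for n by (rule square_integrable_bound[OF w f bound])
  have sg: "square_integrable ?M g" by (rule square_integrable_bound[OF w g gw])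
  have sd: "square_integrable ?M (\<lambda>x. f n x - g x)" for n
    by (intro square_integrable_diff sf sg)
  have "(\<lambda>n. LINT x|?M. (norm (f n x - g x))\<^sup>2) \<longlonglongrightarrow> (LINT x|?M. 0)"
  \<comment> \<open>Both \<open>f n\<close> and \<open>g\<close> are bounded by \<open>w\<close>, so
    the squared difference is at most (2|w|)^2.\<close>
  proof (rule integral_dominated_convergence[where w = "\<lambda>x. 4 * (norm (w x))\<^sup>2"])
    show "integrable ?M (\<lambda>x. 4 * (norm (w x))\<^sup>2)" using w by (simp add: square_integrable_def)
    show "AE x in ?M. (\<lambda>n. (norm (f n x - g x))\<^sup>2) \<longlonglongrightarrow> 0"
      using lim
    proof eventually_elim
      case (elim x)
      then have "(\<lambda>n. (norm (f n x - g x))\<^sup>2) \<longlonglongrightarrow> (norm (g x - g x))\<^sup>2"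
        by (intro tendsto_intros)
      then show ?case by simp
    qed
    show "AE x in ?M. norm ((norm (f n x - g x))\<^sup>2) \<le> 4 * (norm (w x))\<^sup>2" for n
      using bound[of n] gw
    proof eventually_elim
      case (elim x)
      have "norm (f n x - g x) \<le> 2 * norm (w x)"
        using norm_triangle_ineq4[of "f n x" "g x"] elim by linarith
      then have "(norm (f n x - g x))\<^sup>2 \<le> (2 * norm (w x))\<^sup>2" by (intro power_mono) auto
      then show ?case by (simp add: power_mult_distrib)
    qed
  qed auto
  then have "(\<lambda>n. (norm (L2_class (f n) - L2_class g :: 'd L2))\<^sup>2) \<longlonglongrightarrow> 0"
    by (simp add: norm_L2_class_sq[OF sd] flip: L2_class_diff[OF sf sg])
  then have "(\<lambda>n. sqrt ((norm (L2_class (f n) - L2_class g :: 'd L2))\<^sup>2)) \<longlonglongrightarrow> sqrt 0"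
    by (intro tendsto_intros)
  then have "(\<lambda>n. norm (L2_class (f n) - L2_class g :: 'd L2)) \<longlonglongrightarrow> 0" by simp
  then show ?thesis by (rule LIM_zero_cancel[OF tendsto_norm_zero_cancel])
qed

text \<open>Riesz--Fischer: along a subsequence whose consecutive distances \<open>d\<^sub>k\<close> decay like \<open>8\<^sup>-\<^sup>k\<close>, the
  integral of \<open>\<Sum> 4\<^sup>k \<bar>d\<^sub>k\<bar>\<^sup>2\<close> is finite, so almost everywhere \<open>\<bar>d\<^sub>k\<bar> = O(2\<^sup>-\<^sup>k)\<close>.\<close>

lemma L2_fast_Cauchy_AE:
  fixes X :: "nat \<Rightarrow> 'd::line_measure L2"
  assumes fast: "\<And>k. (norm (X (Suc k) - X k))\<^sup>2 \<le> (1/8) ^ k"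
  shows "AE x in line_measure TYPE('d). Cauchy (\<lambda>k. L2_fun (X k) x)"
proof -
  let ?M = "line_measure TYPE('d)"
  have [measurable]: "L2_fun (X k) \<in> borel_measurable ?M" for k
    using square_integrable_L2_fun[of "X k"] by (simp add: square_integrable_def)
  define d where "d k x = norm (L2_fun (X (Suc k)) x - L2_fun (X k) x)" for k x
  have [measurable]: "d k \<in> borel_measurable ?M" for k unfolding d_def by measurable
  have sq: "square_integrable ?M (\<lambda>x. L2_fun (X (Suc k)) x - L2_fun (X k) x)" for k
    by (intro square_integrable_diff square_integrable_L2_fun)
  have int_d: "(\<integral>\<^sup>+x. ennreal ((d k x)\<^sup>2) \<partial>?M) \<le> ennreal ((1/8) ^ k)" for k
  proof -
    have "(\<integral>\<^sup>+x. ennreal ((d k x)\<^sup>2) \<partial>?M) = ennreal (LINT x|?M. (d k x)\<^sup>2)"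
      using sq[of k] by (intro nn_integral_eq_integral) (auto simp: d_def square_integrable_def)
    also have "(LINT x|?M. (d k x)\<^sup>2) = (norm (X (Suc k) - X k))\<^sup>2"
      using norm_L2_class_sq[OF sq[of k]]
        L2_class_diff[OF square_integrable_L2_fun[of "X (Suc k)"] square_integrable_L2_fun[of "X k"]]
      by (simp add: d_def L2_class_L2_fun)
    finally show ?thesis using fast[of k] by (simp add: ennreal_leI)
  qed
  have "(\<integral>\<^sup>+x. (\<Sum>k. ennreal (4 ^ k * (d k x)\<^sup>2)) \<partial>?M) = (\<Sum>k. \<integral>\<^sup>+x. ennreal (4 ^ k * (d k x)\<^sup>2) \<partial>?M)"
    by (intro nn_integral_suminf) measurable
  also have "\<dots> \<le> (\<Sum>k. ennreal ((1/2) ^ k))"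
  proof (intro suminf_le allI)
    fix k
    have "(\<integral>\<^sup>+x. ennreal (4 ^ k * (d k x)\<^sup>2) \<partial>?M) = ennreal (4 ^ k) * (\<integral>\<^sup>+x. ennreal ((d k x)\<^sup>2) \<partial>?M)"
      by (simp add: ennreal_mult nn_integral_cmult)
    also have "\<dots> \<le> ennreal (4 ^ k) * ennreal ((1/8) ^ k)"
      by (intro mult_left_mono int_d) auto
    also have "\<dots> = ennreal ((4 * (1/8)) ^ k)"
      unfolding power_mult_distrib by (simp add: ennreal_mult)
    finally show "(\<integral>\<^sup>+x. ennreal (4 ^ k * (d k x)\<^sup>2) \<partial>?M) \<le> ennreal ((1/2) ^ k)" by simp
  qed auto
  also have "\<dots> < \<infinity>"
  proof -
    have "(\<Sum>k. ennreal ((1/2) ^ k)) = ennreal (\<Sum>k. (1/2) ^ k)"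
      by (intro suminf_ennreal2) auto
    then show ?thesis by simp
  qed
  finally have "AE x in ?M. (\<Sum>k. ennreal (4 ^ k * (d k x)\<^sup>2)) \<noteq> \<infinity>"
    by (intro nn_integral_noteq_infinite) auto
  then show ?thesis
  proof eventually_elim
    case (elim x)
    then have "summable (\<lambda>k. 4 ^ k * (d k x)\<^sup>2)"
      by (intro summable_suminf_not_top) (auto simp: top_ennreal.rep_eq)
    then have "(\<lambda>k. 4 ^ k * (d k x)\<^sup>2) \<longlonglongrightarrow> 0" by (rule summable_LIMSEQ_zero)
    then have "Bseq (\<lambda>k. 4 ^ k * (d k x)\<^sup>2)" by (intro convergent_imp_Bseq convergentI)
    then obtain C where C: "C > 0" "\<And>k. \<bar>4 ^ k * (d k x)\<^sup>2\<bar> \<le> C" unfolding Bseq_def by auto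
    have small: "norm (L2_fun (X (Suc k)) x - L2_fun (X k) x) \<le> sqrt C * (1/2) ^ k" for k
    proof -
      have "(2 ^ k * d k x)\<^sup>2 = 4 ^ k * (d k x)\<^sup>2"
        by (simp add: power_mult_distrib power2_eq_square flip: power_mult_distrib[of "2::real" 2])
      then have "(2 ^ k * d k x)\<^sup>2 \<le> C" using C(2)[of k] by simp
      then have "2 ^ k * d k x \<le> sqrt C" by (rule real_le_rsqrt)
      then show ?thesis by (simp add: d_def field_simps power_divide)
    qed
    have "summable (\<lambda>k. sqrt C * (1/2) ^ k)"
      by (intro summable_mult summable_geometric) simp
    then have "summable (\<lambda>k. norm (L2_fun (X (Suc k)) x - L2_fun (X k) x))"
      by (rule summable_comparison_test'[where N = 0]) (simp add: small)
    then have "summable (\<lambda>k. L2_fun (X (Suc k)) x - L2_fun (X k) x)"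
      by (rule summable_norm_cancel)
    then have "(\<lambda>n. \<Sum>k<n. L2_fun (X (Suc k)) x - L2_fun (X k) x)
        \<longlonglongrightarrow> (\<Sum>k. L2_fun (X (Suc k)) x - L2_fun (X k) x)"
      by (rule summable_LIMSEQ)
    then have "(\<lambda>n. L2_fun (X n) x - L2_fun (X 0) x)
        \<longlonglongrightarrow> (\<Sum>k. L2_fun (X (Suc k)) x - L2_fun (X k) x)"
      by (simp add: sum_lessThan_telescope[of "\<lambda>k. L2_fun (X k) x"])
    from tendsto_add[OF this tendsto_const[of "L2_fun (X 0) x"]] show ?case
      by (auto intro: LIMSEQ_imp_Cauchy)
  qed
qed

text \<open>The candidate is the pointwise limit along a fast subsequence. Fatou's lemma bounds its
  distance to \<open>Y k\<close> by the distances within the tail, which yields square integrability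
  and the rate together. A Cauchy sequence with a convergent subsequence converges.\<close>

lemma L2_Cauchy_convergent:
  fixes X :: "nat \<Rightarrow> 'd::line_measure L2"
  assumes X: "Cauchy X"
  shows "convergent X"
proof -
  let ?M = "line_measure TYPE('d)"
  have "\<exists>r. strict_mono r \<and> (\<forall>k. \<forall>m\<ge>r k. \<forall>n\<ge>r k. dist (X m) (X n) < (1/8) ^ k)"
  proof -
    have "\<exists>M. \<forall>m\<ge>M. \<forall>n\<ge>M. dist (X m) (X n) < (1/8) ^ k" for k :: nat
      using X unfolding Cauchy_def by simp
    then obtain M where M: "\<And>k m n. m \<ge> M k \<Longrightarrow> n \<ge> M k \<Longrightarrow> dist (X m) (X n) < (1/8) ^ k"
      by metis
    \<comment> \<open>Partial sums of \<open>Suc (M i)\<close> are strictly increasing and dominate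
      each \<open>M k\<close>.\<close>
    define r where "r k = (\<Sum>i\<le>k. Suc (M i))" for k
    have "strict_mono r" by (rule strict_monoI_Suc) (simp add: r_def)
    moreover have "M k \<le> r k" for k
    proof -
      have "Suc (M k) \<le> r k" unfolding r_def by (rule member_le_sum) auto
      then show ?thesis by simp
    qed
    ultimately show ?thesis using M by (meson le_trans)
  qed
  then obtain r where r: "strict_mono r"
    and close: "\<And>k m n. m \<ge> r k \<Longrightarrow> n \<ge> r k \<Longrightarrow> dist (X m) (X n) < (1/8) ^ k"
    by blast
  define Y where "Y = X \<circ> r"
  have close_Y: "dist (Y m) (Y n) < (1/8) ^ k" if "m \<ge> k" "n \<ge> k" for k m n
    using that r by (auto simp: Y_def strict_mono_less_eq intro!: close)
  have [measurable]: "L2_fun (Y k) \<in> borel_measurable ?M" for k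
    using square_integrable_L2_fun[of "Y k"] by (simp add: square_integrable_def)
  have "(norm (Y (Suc k) - Y k))\<^sup>2 \<le> (1/8) ^ k" for k
  proof -
    have "norm (Y (Suc k) - Y k) \<le> (1/8) ^ k"
      using close_Y[of k "Suc k" k] by (simp add: dist_norm)
    then have "(norm (Y (Suc k) - Y k))\<^sup>2 \<le> ((1/8) ^ k)\<^sup>2" by (intro power_mono) auto
    also have "\<dots> \<le> ((1/8) ^ k) ^ 1" by (intro power_decreasing) (auto simp: power_le_one)
    finally show ?thesis by simp
  qed
  then have AE_Cauchy: "AE x in ?M. Cauchy (\<lambda>k. L2_fun (Y k) x)" by (rule L2_fast_Cauchy_AE)
  define f where "f x = lim (\<lambda>k. L2_fun (Y k) x)" for x
  have [measurable]: "f \<in> borel_measurable ?M"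
    unfolding f_def by (rule borel_measurable_lim_metric) measurable
  have lim_f: "AE x in ?M. (\<lambda>k. L2_fun (Y k) x) \<longlonglongrightarrow> f x"
    using AE_Cauchy by eventually_elim (auto simp: f_def Cauchy_convergent_iff convergent_LIMSEQ_iff)
  have bound: "(\<integral>\<^sup>+x. ennreal ((norm (f x - L2_fun (Y k) x))\<^sup>2) \<partial>?M) \<le> ennreal (((1/8) ^ k)\<^sup>2)" for k
  proof -
    have "(\<integral>\<^sup>+x. ennreal ((norm (f x - L2_fun (Y k) x))\<^sup>2) \<partial>?M) =
        (\<integral>\<^sup>+x. liminf (\<lambda>n. ennreal ((norm (L2_fun (Y n) x - L2_fun (Y k) x))\<^sup>2)) \<partial>?M)"
    proof (rule nn_integral_cong_AE)
      show "AE x in ?M. ennreal ((norm (f x - L2_fun (Y k) x))\<^sup>2) =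
          liminf (\<lambda>n. ennreal ((norm (L2_fun (Y n) x - L2_fun (Y k) x))\<^sup>2))"
        using lim_f
      proof eventually_elim
        case (elim x)
        then have "(\<lambda>n. ennreal ((norm (L2_fun (Y n) x - L2_fun (Y k) x))\<^sup>2))
            \<longlonglongrightarrow> ennreal ((norm (f x - L2_fun (Y k) x))\<^sup>2)"
          by (intro tendsto_intros)
        then show ?case by (intro lim_imp_Liminf[symmetric]) auto
      qed
    qed
    also have "\<dots> \<le> liminf (\<lambda>n. \<integral>\<^sup>+x. ennreal ((norm (L2_fun (Y n) x - L2_fun (Y k) x))\<^sup>2) \<partial>?M)"
      by (rule nn_integral_liminf) measurable
    also have "\<dots> \<le> ennreal (((1/8) ^ k)\<^sup>2)"
    proof (rule Liminf_le)
      show "\<forall>\<^sub>F n in sequentially. (\<integral>\<^sup>+x. ennreal ((norm (L2_fun (Y n) x - L2_fun (Y k) x))\<^sup>2) \<partial>?M)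
          \<le> ennreal (((1/8) ^ k)\<^sup>2)"
        using eventually_ge_at_top[of k]
      proof eventually_elim
        case (elim n)
        have sq: "square_integrable ?M (\<lambda>x. L2_fun (Y n) x - L2_fun (Y k) x)"
          by (intro square_integrable_diff square_integrable_L2_fun)
        have "(\<integral>\<^sup>+x. ennreal ((norm (L2_fun (Y n) x - L2_fun (Y k) x))\<^sup>2) \<partial>?M) =
            ennreal (LINT x|?M. (norm (L2_fun (Y n) x - L2_fun (Y k) x))\<^sup>2)"
          using sq by (intro nn_integral_eq_integral) (auto simp: square_integrable_def)
        also have "\<dots> = ennreal ((dist (Y n) (Y k))\<^sup>2)"
          using norm_L2_class_sq[OF sq]
            L2_class_diff[OF square_integrable_L2_fun[of "Y n"] square_integrable_L2_fun[of "Y k"]]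
          by (simp add: dist_norm L2_class_L2_fun)
        also have "\<dots> \<le> ennreal (((1/8) ^ k)\<^sup>2)"
          using close_Y[OF elim order_refl] by (intro ennreal_leI power_mono) auto
        finally show ?case .
      qed
    qed simp
    finally show ?thesis .
  qed
  have sq: "square_integrable ?M (\<lambda>x. f x - L2_fun (Y k) x)" for k
    unfolding square_integrable_def
  proof
    show "integrable ?M (\<lambda>x. (norm (f x - L2_fun (Y k) x))\<^sup>2)"
      using bound[of k] by (intro integrableI_bounded) (auto intro: le_less_trans)
  qed measurable
  \<comment> \<open>So far only differences from \<open>Y k\<close> are known to be square
    integrable; adding \<open>Y 0\<close> back gives \<open>f\<close>.\<close>
  have sq_f: "square_integrable ?M f"
    using square_integrable_add[OF sq[of 0] square_integrable_L2_fun[of "Y 0"]] by simp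
  have "dist (Y k) (L2_class f) \<le> (1/8) ^ k" for k
  proof -
    have "ennreal ((dist (Y k) (L2_class f))\<^sup>2) = ennreal (LINT x|?M. (norm (f x - L2_fun (Y k) x))\<^sup>2)"
      using norm_L2_class_sq[OF sq[of k]] L2_class_diff[OF sq_f square_integrable_L2_fun[of "Y k"]]
      by (simp add: dist_norm norm_minus_commute L2_class_L2_fun)
    also have "\<dots> = (\<integral>\<^sup>+x. ennreal ((norm (f x - L2_fun (Y k) x))\<^sup>2) \<partial>?M)"
      using sq by (intro nn_integral_eq_integral[symmetric]) (auto simp: square_integrable_def)
    also have "\<dots> \<le> ennreal (((1/8) ^ k)\<^sup>2)" by (rule bound)
    finally have "(dist (Y k) (L2_class f))\<^sup>2 \<le> ((1/8) ^ k)\<^sup>2" by (simp add: ennreal_le_iff)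
    then show ?thesis by (rule power2_le_imp_le) simp
  qed
  then have close_lim: "dist (Y k) (L2_class f) \<le> (1/8) ^ k" for k .
  have "(\<lambda>k. dist (Y k) (L2_class f)) \<longlonglongrightarrow> 0"
    by (rule tendsto_sandwich[OF _ _ tendsto_const LIMSEQ_power_zero[of "1/8::real"]]) (simp_all add: close_lim)
  then have "Y \<longlonglongrightarrow> L2_class f"
    by (rule iffD2[OF tendsto_dist_iff])
  then show ?thesis
    using Cauchy_converges_subseq[OF X r] unfolding Y_def by (blast intro: convergentI)
qed

text \<open>Completeness of the target is what lets \<open>fourier_extension\<close> extend a
  uniformly continuous map from a dense subspace.\<close>

instance L2 :: (line_measure) complete_space
  by standard (rule L2_Cauchy_convergent)

section \<open>Unitary operators\<close>

lemma unitary_opD: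
  fixes T :: "'d::line_measure L2 \<Rightarrow> 'd L2"
  assumes "unitary_op T"
  shows "T (u + v) = T u + T v" "T (scaleC c u) = scaleC c (T u)" "bij T"
    "cinner (T u) (T v) = cinner u v" "norm (T u) = norm u"
    "T (u - v) = T u - T v" "bounded_linear T"
proof -
  show add: "T (u + v) = T u + T v" and sc: "T (scaleC c u) = scaleC c (T u)" and "bij T"
    and "cinner (T u) (T v) = cinner u v" for u v c
    using assms by (auto simp: unitary_op_def)
  then show no: "norm (T u) = norm u" for u by (simp add: norm_L2_eq_cinner)
  show "T (u - v) = T u - T v"
    using add[of "u - v" v] by simp
  show "bounded_linear T"
    by (rule bounded_linear_intro[where K = 1]) (simp_all add: add sc no scaleR_L2_def)
qed

lemma unitary_op_comp: "unitary_op S \<Longrightarrow> unitary_op T \<Longrightarrow> unitary_op (S \<circ> T)"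
  by (simp add: unitary_op_def bij_comp)

lemma unitary_op_inv:
  assumes "unitary_op T"
  shows "unitary_op (inv T)"
proof -
  note T = unitary_opD[OF assms]
  have inv: "T (inv T u) = u" "inv T (T u) = u" for u
    using T(3) by (simp_all add: bij_is_surj bij_is_inj surj_f_inv_f)
  show ?thesis
    unfolding unitary_op_def
  proof (intro conjI allI)
    show "inv T (u + v) = inv T u + inv T v" for u v
      by (rule injD[OF bij_is_inj[OF T(3)]]) (simp add: T(1) inv)
    show "inv T (scaleC c u) = scaleC c (inv T u)" for c u
      by (rule injD[OF bij_is_inj[OF T(3)]]) (simp add: T(2) inv)
    show "bij (inv T)" by (simp add: T(3) bij_imp_bij_inv)
    show "cinner (inv T u) (inv T v) = cinner u v" for u v
      using T(4)[of "inv T u" "inv T v"] by (simp add: inv)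
  qed
qed

section \<open>Density of exponentials\<close>

lemma line_measure_line [simp]: "line_measure TYPE(line) = lborel"
  by (simp add: line_measure_line_def)

text \<open>For s = 1 or s = -1 this is exp(-z|y|) on the half line of sign s. Keeping the side as a
  parameter lets both half lines share one proof, and a complex rate z absorbs the oscillating
  factor of the Fourier integral.\<close>

definition half_exp :: "real \<Rightarrow> complex \<Rightarrow> real \<Rightarrow> complex" where
  "half_exp s z y = (if 0 < s * y then exp (- (z * of_real (s * y))) else 0)"

lemma half_exp_measurable [measurable]: "half_exp s z \<in> borel_measurable borel"
  unfolding half_exp_def by measurable

lemma norm_half_exp: "norm (half_exp s z y) = (if 0 < s * y then exp (- (Re z * (s * y))) else 0)"
  by (simp add: half_exp_def)

lemma norm_half_exp_le_1: "0 \<le> Re z \<Longrightarrow> norm (half_exp s z y) \<le> 1"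
  unfolding norm_half_exp by (auto intro!: mult_nonneg_nonneg)

lemma half_exp_1_integral:
  assumes z: "0 < Re z"
  shows "integrable lborel (half_exp 1 z)" "(LINT y|lborel. half_exp 1 z y) = 1 / z"
proof -
  have "set_integrable lborel {0<..} (\<lambda>y. exp (- (y * Re z)))"
    by (rule integrable_I0i_exp_mscale[OF z])
  then have *: "integrable lborel (\<lambda>y. indicator {0<..} y *\<^sub>R exp (- (y * Re z)))"
    by (simp add: set_integrable_def)
  show int: "integrable lborel (half_exp 1 z)"
    by (rule Bochner_Integration.integrable_bound[OF *])
      (auto simp: norm_half_exp indicator_def mult.commute)
  have z0: "z \<noteq> 0" using z by auto
  define G where "G y = - exp (- (z * of_real y)) / z" for y :: real
  have eq: "(\<lambda>y. indicator {0<..} y *\<^sub>R exp (- (z * of_real y))) = half_exp 1 z"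
    by (auto simp: half_exp_def indicator_def fun_eq_iff)
  have "(LBINT y=ereal 0..\<infinity>. exp (- (z * of_real y))) = 0 - G 0"
  proof (rule interval_integral_FTC_integrable)
    show "(G has_vector_derivative exp (- (z * of_real x))) (at x)" for x
      unfolding G_def
      by (rule has_vector_derivative_real_field) (use z0 in \<open>auto intro!: derivative_eq_intros\<close>)
    show "isCont (\<lambda>y. exp (- (z * of_real y))) x" for x :: real
      by (intro continuous_intros)
    show "set_integrable lborel (einterval (ereal 0) \<infinity>) (\<lambda>y. exp (- (z * of_real y)))"
      using int by (simp add: set_integrable_def eq)
    have "(G \<longlongrightarrow> G 0) (at_right 0)"
      unfolding G_def by (intro tendsto_intros z0)
    then show "((G \<circ> real_of_ereal) \<longlongrightarrow> G 0) (at_right (ereal 0))"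
      by (simp add: ereal_tendsto_simps)
    have "((\<lambda>y. exp (- (Re z * y)) / norm z) \<longlongrightarrow> 0 / norm z) at_top"
      using z0 z
      by (intro tendsto_divide tendsto_const) (auto intro!: filterlim_compose[OF exp_at_bot]
        filterlim_tendsto_pos_mult_at_top[OF tendsto_const] filterlim_ident
        simp: filterlim_uminus_at_bot)
    then have "((\<lambda>y. norm (G y)) \<longlongrightarrow> 0) at_top"
      by (simp add: G_def norm_divide)
    then show "((G \<circ> real_of_ereal) \<longlongrightarrow> 0) (at_left \<infinity>)"
      by (simp add: ereal_tendsto_simps tendsto_norm_zero_iff)
  qed auto
  also have "(LBINT y=ereal 0..\<infinity>. exp (- (z * of_real y))) = (LINT y|lborel. half_exp 1 z y)"
    by (simp add: interval_lebesgue_integral_le_eq set_lebesgue_integral_def eq)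
  finally show "(LINT y|lborel. half_exp 1 z y) = 1 / z" by (simp add: G_def)
qed

lemma half_exp_integral:
  assumes s: "\<bar>s\<bar> = 1" and z: "0 < Re z"
  shows "integrable lborel (half_exp s z)" "(LINT y|lborel. half_exp s z y) = 1 / z"
proof -
  have s0: "s \<noteq> 0" using s by auto
  have ss: "s * (s * y) = y" for y using s by (auto simp: abs_if split: if_splits)
  have eq: "(\<lambda>y. half_exp s z (0 + s * y)) = half_exp 1 z"
    unfolding half_exp_def by (simp add: fun_eq_iff ss)
  show "integrable lborel (half_exp s z)"
    using lborel_integrable_real_affine_iff[OF s0, of "half_exp s z" 0] half_exp_1_integral[OF z]
    unfolding eq by simp
  show "(LINT y|lborel. half_exp s z y) = 1 / z"
    using lborel_integral_real_affine[OF s0, of "half_exp s z" 0] half_exp_1_integral[OF z] s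
    unfolding eq by simp
qed

lemma half_exp_mult:
  "half_exp s z y * half_exp s w y = half_exp s (z + w) y"
  by (simp add: half_exp_def distrib_right flip: exp_add)

lemma norm_half_exp_sq: "(norm (half_exp s z y))\<^sup>2 = norm (half_exp s (z + z) y)"
  by (simp only: power2_eq_square norm_mult flip: half_exp_mult)

lemma square_integrable_half_exp:
  assumes "\<bar>s\<bar> = 1" "0 < Re z"
  shows "square_integrable lborel (half_exp s z)"
  using half_exp_integral(1)[of s "z + z"] assms
  by (simp add: square_integrable_def norm_half_exp_sq)

text \<open>\<open>span\<close> is the real span, so complex scalars are built into the generators.
  With integer rates the span consists, on each half line, of polynomials in exp(-|y|) without
  constant term.\<close>

definition exp_family :: "line L2 set" where
  "exp_family = {scaleC c (L2_class (half_exp s (of_nat n))) | c s n. \<bar>s\<bar> = 1 \<and> 0 < n}"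

lemma exp_familyI: "\<bar>s\<bar> = 1 \<Longrightarrow> 0 < n \<Longrightarrow>
    scaleC c (L2_class (half_exp s (of_nat n))) \<in> exp_family"
  by (auto simp: exp_family_def)

lemma scaleC_span_exp_family:
  assumes "u \<in> span exp_family" shows "scaleC c u \<in> span exp_family"
  using assms
proof (induction rule: span_induct_alt)
  case base
  then show ?case by (metis bounded_linear_scaleC linear_simps(3) span_zero)
next
  case (step r x y)
  obtain d s n where x: "x = scaleC d (L2_class (half_exp s (of_nat n)))" "\<bar>s\<bar> = 1" "0 < n"
    using step(1) by (auto simp: exp_family_def)
  have "scaleC c (r *\<^sub>R x) = scaleC (c * r * d) (L2_class (half_exp s (of_nat n)))"
    by (simp add: x scaleR_L2_def mult.assoc)
  then have "scaleC c (r *\<^sub>R x) \<in> span exp_family"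
    using x by (auto intro!: span_base exp_familyI)
  then show ?case
    using step(2) by (simp add: scaleC_add_right span_add)
qed

section \<open>The closed span of the exponentials\<close>

lemma closure_add:
  fixes x y :: "'a::real_normed_vector"
  assumes V: "subspace V" and x: "x \<in> closure V" and y: "y \<in> closure V"
  shows "x + y \<in> closure V"
proof -
  obtain f g where "\<And>n. f n \<in> V" "f \<longlonglongrightarrow> x" "\<And>n. g n \<in> V" "g \<longlonglongrightarrow> y"
    using x y unfolding closure_sequential by blast
  then show ?thesis
    unfolding closure_sequential
    by (intro exI[of _ "\<lambda>n. f n + g n"]) (auto intro: tendsto_add subspace_add[OF V])
qed

abbreviation exp_closure :: "line L2 set" where
  "exp_closure \<equiv> closure (span exp_family)"

lemma exp_closure_add: "u \<in> exp_closure \<Longrightarrow> v \<in> exp_closure \<Longrightarrow> u + v \<in> exp_closure"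
  by (rule closure_add[OF subspace_span])

lemma exp_closure_scaleC: "u \<in> exp_closure \<Longrightarrow> scaleC c u \<in> exp_closure"
proof -
  assume "u \<in> exp_closure"
  then obtain f where f: "\<And>n. f n \<in> span exp_family" "f \<longlonglongrightarrow> u"
    unfolding closure_sequential by blast
  then have "(\<lambda>n. scaleC c (f n)) \<longlonglongrightarrow> scaleC c u" by (intro tendsto_intros)
  then show ?thesis
    using f(1) unfolding closure_sequential
    by (intro exI[of _ "\<lambda>n. scaleC c (f n)"]) (simp add: scaleC_span_exp_family)
qed

lemma exp_closure_diff: "u \<in> exp_closure \<Longrightarrow> v \<in> exp_closure \<Longrightarrow> u - v \<in> exp_closure"
  using exp_closure_add[OF _ exp_closure_scaleC[of v "- 1"], of u]
  by (simp add: scaleC_minus1)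

lemma exp_closure_limit:
  "(\<And>n. f n \<in> exp_closure) \<Longrightarrow> f \<longlonglongrightarrow> u \<Longrightarrow> u \<in> exp_closure"
  by (metis closed_closure closed_sequentially)

lemma exp_closure_sum: "(\<And>i. i \<in> I \<Longrightarrow> f i \<in> exp_closure) \<Longrightarrow> (\<Sum>i\<in>I. f i) \<in> exp_closure"
  by (induction I rule: infinite_finite_induct)
    (auto intro: exp_closure_add closure_subset[THEN subsetD] span_zero)

lemma L2_class_sum:
  fixes f :: "'i \<Rightarrow> real \<Rightarrow> complex"
  assumes "finite I" "\<And>i. i \<in> I \<Longrightarrow> square_integrable (line_measure TYPE('d)) (f i)"
  shows "square_integrable (line_measure TYPE('d)) (\<lambda>x. \<Sum>i\<in>I. f i x)"
    and "L2_class (\<lambda>x. \<Sum>i\<in>I. f i x) = (\<Sum>i\<in>I. L2_class (f i) :: 'd::line_measure L2)"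
  using assms
proof (induction I)
  case empty
  { case 1 then show ?case by (simp add: square_integrable_zero) }
  { case 2 then show ?case by (simp add: zero_L2_def) }
next
  case (insert i I)
  { case 1 then show ?case using insert by (simp add: square_integrable_add) }
  { case 2 then show ?case using insert by (simp add: L2_class_add) }
qed

text \<open>Substituting \<open>t = e\<^sup>-\<^sup>y\<close> turns exponential sums into polynomials without constant term, so
  \<open>\<phi>(- ln t) / t\<close> is approximated uniformly by a polynomial.\<close>

lemma continuous_in_exp_closure:
  fixes \<phi> :: "real \<Rightarrow> real"
  assumes s: "\<bar>s\<bar> = 1" and cont: "continuous_on UNIV \<phi>" and "0 < a"
    and supp: "\<And>y. y \<notin> {a<..<b} \<Longrightarrow> \<phi> y = 0"
  shows "L2_class (\<lambda>y. of_real (\<phi> (s * y))) \<in> exp_closure"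
proof -
  \<comment> \<open>\<open>\<phi>\<close> vanishes from \<open>b\<close> on, that is for t \<le>
    exp(-b). Cutting off there removes the singularities of ln t and 1/t at 0 and leaves
    \<open>g\<close> continuous on the closed unit interval.\<close>
  define g where "g t = (if t \<le> exp (- b) then 0 else \<phi> (- ln t) / t)" for t
  have "continuous_on {0..1} g"
  proof -
    have eq: "{0..1} = {0..1} \<inter> {..exp (- b)} \<union> {0..1} \<inter> {exp (- b)..}"
      by (intro set_eqI; simp only: Un_iff Int_iff atMost_iff atLeast_iff; use linear in blast)
    show ?thesis
    proof (subst eq, rule continuous_on_closed_Un)
      have "continuous_on ({0..1} \<inter> {..exp (- b)}) (\<lambda>x. 0 :: real)" by simp
      then show "continuous_on ({0..1} \<inter> {..exp (- b)}) g"
        by (rule continuous_on_eq) (auto simp: g_def)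
      have pos: "0 < x" if "x \<in> ({0..1} \<inter> {exp (- b)..})" for x
        using that exp_gt_zero[of "- b"] by (auto simp del: exp_gt_zero)
      have "continuous_on ({0..1} \<inter> {exp (- b)..}) (\<lambda>t. \<phi> (- ln t) / t)"
        by (intro continuous_intros continuous_on_compose2[OF cont]) (auto dest!: pos)
      then show "continuous_on ({0..1} \<inter> {exp (- b)..}) g"
        by (rule continuous_on_eq) (auto simp: g_def supp)
    qed auto
  qed
  have g: "t * g t = \<phi> y" if "y > 0" "t = exp (- y)" for y t
    using that by (auto simp: g_def supp)
  let ?E = "\<lambda>n. half_exp s (of_nat n)"
  have sqE: "square_integrable lborel (?E n)" if "0 < n" for n
    using that by (intro square_integrable_half_exp s) auto
  have sq\<phi>: "square_integrable lborel (\<lambda>y. complex_of_real (\<phi> (s * y)))"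
  proof -
    have "compact (\<phi> ` {a..b})"
      by (intro compact_continuous_image continuous_on_subset[OF cont]) auto
    then have "bounded (\<phi> ` {a..b})" by (rule compact_imp_bounded)
    then obtain B where B: "\<forall>y\<in>{a..b}. \<bar>\<phi> y\<bar> \<le> B"
      unfolding bounded_iff by auto
    have B0: "\<bar>\<phi> y\<bar> \<le> \<bar>B\<bar>" for y
      using B supp[of y] by (cases "y \<in> {a..b}") fastforce+
    have [measurable]: "\<phi> \<in> borel_measurable borel"
      by (rule borel_measurable_continuous_onI[OF cont])
    \<comment> \<open>On the support of \<open>\<phi>\<close> one has exp(b) exp(-sy) \<ge> 1, so a
      multiple of the exponential of rate 1 dominates.\<close>
    have "square_integrable lborel (\<lambda>y. of_real (\<bar>B\<bar> * exp b) * ?E 1 y)"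
      by (intro square_integrable_cmult sqE) simp
    then show ?thesis
    proof (rule square_integrable_bound)
      have bd: "\<bar>\<phi> (s * y)\<bar> \<le> \<bar>B\<bar> * exp b * (if 0 < s * y then exp (- (s * y)) else 0)" for y
      proof (cases "s * y \<in> {a<..<b}")
        case True
        then have "1 \<le> exp b * exp (- (s * y))" by (simp flip: exp_add)
        then have "\<bar>B\<bar> * 1 \<le> \<bar>B\<bar> * (exp b * exp (- (s * y)))" by (intro mult_left_mono) auto
        then show ?thesis using True B0[of "s * y"] \<open>0 < a\<close> by (simp add: mult.assoc)
      qed (simp add: supp)
      have "norm (of_real (\<bar>B\<bar> * exp b) * ?E 1 y) =
          \<bar>B\<bar> * exp b * (if 0 < s * y then exp (- (s * y)) else 0)" for y
        by (simp add: norm_mult norm_half_exp)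
      then show "AE y in lborel. norm (complex_of_real (\<phi> (s * y))) \<le>
          norm (of_real (\<bar>B\<bar> * exp b) * ?E 1 y)"
        by (intro AE_I2) (simp only: norm_of_real bd)
    qed measurable
  qed
  show ?thesis
    unfolding closure_approachable
  proof (intro allI impI)
    fix e :: real assume "0 < e"
    define N where "N = norm (L2_class (?E 1) :: line L2)"
    \<comment> \<open>As \<phi> = t g(t) with t = exp(-sy), a uniform error \<epsilon> in
      approximating \<open>g\<close> costs only \<epsilon> t pointwise, hence \<epsilon> N in norm.
      The summand 1 keeps the quotient defined and the final inequality strict.\<close>
    define \<epsilon> where "\<epsilon> = e / (N + 1)"
    have "0 \<le> N" by (simp add: N_def)
    then have "0 < \<epsilon>" "\<epsilon> * N < e" using \<open>0 < e\<close> by (auto simp: \<epsilon>_def field_simps)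
    obtain p where p: "real_polynomial_function p" "\<And>t. t \<in> {0..1} \<Longrightarrow> \<bar>g t - p t\<bar> < \<epsilon>"
      using Stone_Weierstrass_real_polynomial_function[OF _ \<open>continuous_on {0..1} g\<close> \<open>0 < \<epsilon>\<close>]
      by blast
    obtain c n where pc: "p = (\<lambda>t. \<Sum>i\<le>n. c i * t ^ i)"
      using p(1) unfolding real_polynomial_function_iff_sum by blast
    \<comment> \<open>\<open>Q\<close> is t p(t). The factor t shifts the power t^i to the
      exponential of rate i + 1, so the rate 0, which is not square integrable, never
      occurs.\<close>
    define Q where "Q y = (\<Sum>i\<le>n. of_real (c i) * ?E (Suc i) y)" for y
    have sqQ: "square_integrable lborel Q"
      and clQ: "L2_class Q = (\<Sum>i\<le>n. L2_class (\<lambda>y. of_real (c i) * ?E (Suc i) y) :: line L2)"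
      unfolding Q_def by (rule L2_class_sum[where 'd = line, simplified]; simp add: square_integrable_cmult sqE del: of_nat_Suc)+
    have "L2_class Q \<in> span exp_family"
      unfolding clQ
    proof (intro span_sum span_base)
      fix i
      show "L2_class (\<lambda>y. of_real (c i) * ?E (Suc i) y) \<in> exp_family"
        using exp_familyI[OF s, of "Suc i" "of_real (c i)"]
        by (simp add: scaleC_L2_class sqE del: of_nat_Suc)
    qed
    moreover have "dist (L2_class Q) (L2_class (\<lambda>y. of_real (\<phi> (s * y))) :: line L2) < e"
    proof -
      have "Q y = of_real (if 0 < s * y then exp (- (s * y)) * p (exp (- (s * y))) else 0)" for y
      proof (cases "0 < s * y")
        case True
        then have E: "?E (Suc i) y = of_real (exp (- (s * y)) * exp (- (s * y)) ^ i)" for i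
          unfolding half_exp_def power_Suc[symmetric] exp_of_nat_mult[symmetric]
          by (simp add: exp_of_real[symmetric] del: of_nat_Suc power_Suc)
            (simp add: distrib_right flip: exp_add)
        show ?thesis using True
          by (simp add: Q_def E pc sum_distrib_left mult.assoc mult.left_commute del: of_nat_Suc)
      qed (simp add: Q_def half_exp_def)
      then have "Q y - of_real (\<phi> (s * y)) = of_real (if 0 < s * y
          then exp (- (s * y)) * (p (exp (- (s * y))) - g (exp (- (s * y)))) else 0)" for y
        using g[of "s * y"] \<open>0 < a\<close> by (auto simp: right_diff_distrib supp)
      moreover have "exp (- t) * \<bar>p (exp (- t)) - g (exp (- t))\<bar> \<le> \<epsilon> * exp (- t)" if "0 < t" for t
        using p(2)[of "exp (- t)"] that by (simp add: abs_minus_commute less_imp_le)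
      ultimately have "norm (Q y - of_real (\<phi> (s * y))) \<le> norm (of_real \<epsilon> * ?E 1 y)" for y
        using \<open>0 < \<epsilon>\<close> by (simp add: norm_mult norm_half_exp abs_mult)
      then have "norm (L2_class (\<lambda>y. Q y - of_real (\<phi> (s * y))) :: line L2) \<le>
          norm (L2_class (\<lambda>y. of_real \<epsilon> * ?E 1 y) :: line L2)"
        by (intro norm_L2_class_le)
          (simp_all add: square_integrable_diff sqQ sq\<phi> square_integrable_cmult sqE[of 1, simplified])
      also have "\<dots> = \<epsilon> * N"
        using \<open>0 < \<epsilon>\<close> sqE[of 1]
        by (simp add: N_def scaleC_L2_class[symmetric])
      finally show ?thesis
        using \<open>\<epsilon> * N < e\<close> by (simp add: dist_norm L2_class_diff sqQ sq\<phi>)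
    qed
    ultimately show "\<exists>v\<in>span exp_family. dist v (L2_class (\<lambda>y. of_real (\<phi> (s * y)))) < e"
      by blast
  qed
qed

section \<open>From continuous functions to indicators and simple functions\<close>

lemma norm_indicator_sq: "(norm (indicator A x :: complex))\<^sup>2 = indicator A x"
  by (auto split: split_indicator)

lemma square_integrable_indicator:
  assumes s: "\<bar>s\<bar> = 1" and A: "A \<in> sets borel" "A \<subseteq> {a<..<b}"
  shows "square_integrable lborel (\<lambda>y. indicator A (s * y))"
proof -
  have s0: "s \<noteq> 0" using s by auto
  have "emeasure lborel A < \<infinity>"
    by (rule emeasure_bounded_finite[OF bounded_subset[OF bounded_box[of a b, unfolded box_real] A(2)]])
  then have "integrable lborel (indicator A :: real \<Rightarrow> real)"
    using A by (simp add: integrable_indicator_iff)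
  then have "integrable lborel (\<lambda>y. indicator A (0 + s * y) :: real)"
    by (rule lborel_integrable_real_affine[OF _ s0])
  then show ?thesis
    using A by (simp add: square_integrable_def norm_indicator_sq)
qed

text \<open>The continuous functions \<open>\<phi> n\<close> converge to the indicator from below
  and vanish off the open set, so the indicator itself serves as the dominating function.\<close>

lemma indicator_open_in_exp_closure:
  assumes s: "\<bar>s\<bar> = 1" and U: "open U" and a: "0 < a"
  shows "L2_class (\<lambda>y. indicator (U \<inter> {a<..<b}) (s * y)) \<in> exp_closure"
proof -
  define W where "W = U \<inter> {a<..<b}"
  have W: "open W" "W \<subseteq> {a<..<b}" using U by (auto simp: W_def)
  \<comment> \<open>\<open>infdist\<close> to the empty set is 0 by convention, so the complement
    must be seen to contain a point.\<close>
  have "0 \<in> - W" using a by (auto simp: W_def)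
  then have nW: "closed (- W)" "- W \<noteq> {}" using W by (auto simp: closed_def)
  have [measurable]: "W \<in> sets borel" using W by simp
  define \<phi> where "\<phi> n y = min 1 (real n * infdist y (- W))" for n y
  have cont: "continuous_on UNIV (\<phi> n)" for n
    unfolding \<phi>_def by (intro continuous_intros)
  have [measurable]: "\<phi> n \<in> borel_measurable borel" for n
    by (rule borel_measurable_continuous_onI[OF cont])
  have out: "\<phi> n y = 0" if "y \<notin> W" for n y
    using that by (simp add: \<phi>_def)
  have bound: "0 \<le> \<phi> n y" "\<phi> n y \<le> 1" for n y
    by (simp_all add: \<phi>_def infdist_nonneg)
  have lim: "(\<lambda>n. \<phi> n y) \<longlonglongrightarrow> indicator W y" for y
  proof (cases "y \<in> W")
    case True
    then have pos: "0 < infdist y (- W)" by (intro infdist_pos_not_in_closed nW) auto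
    obtain N :: nat where N: "1 / infdist y (- W) \<le> N" using real_arch_simple by blast
    have "\<phi> n y = 1" if "N \<le> n" for n
    proof -
      have "1 \<le> real N * infdist y (- W)" using N pos by (simp add: field_simps)
      also have "\<dots> \<le> real n * infdist y (- W)" using that pos by (intro mult_right_mono) auto
      finally show ?thesis by (simp add: \<phi>_def)
    qed
    then have "\<forall>\<^sub>F n in sequentially. \<phi> n y = 1" by (rule eventually_sequentiallyI)
    then show ?thesis using True by (simp add: tendsto_eventually)
  qed (simp add: out)
  have "(\<lambda>n. L2_class (\<lambda>y. of_real (\<phi> n (s * y))) :: line L2)
      \<longlonglongrightarrow> L2_class (\<lambda>y. indicator W (s * y))"
  proof (rule tendsto_L2_class_dominated)
    show "square_integrable (line_measure TYPE(line)) (\<lambda>y. indicator W (s * y))"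
      using square_integrable_indicator[OF s _ W(2)] by simp
    show "AE y in line_measure TYPE(line). (\<lambda>n. complex_of_real (\<phi> n (s * y))) \<longlonglongrightarrow> indicator W (s * y)"
      using tendsto_of_real[OF lim, where 'a = complex] by (simp add: of_real_indicator)
    show "AE y in line_measure TYPE(line). norm (complex_of_real (\<phi> n (s * y)))
        \<le> norm (indicator W (s * y) :: complex)" for n
      using out bound by (intro AE_I2) (simp add: indicator_def abs_le_iff)
  qed simp_all
  moreover have "L2_class (\<lambda>y. of_real (\<phi> n (s * y))) \<in> exp_closure" for n
    by (rule continuous_in_exp_closure[where \<phi> = "\<phi> n" and b = b, OF s cont a out]) (use W(2) in blast)
  ultimately show ?thesis
    unfolding W_def by (rule exp_closure_limit[rotated])
qed

text \<open>A Dynkin argument starting from the open sets. The fixed bounded window gives every set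
  in play finite measure, so complements stay in L2 and the window dominates the partial
  unions.\<close>

lemma indicator_borel_in_exp_closure:
  assumes s: "\<bar>s\<bar> = 1" and a: "0 < a" and B: "B \<in> sets borel"
  shows "L2_class (\<lambda>y. indicator (B \<inter> {a<..<b}) (s * y)) \<in> exp_closure"
proof -
  have "Int_stable {S :: real set. open S}" by (auto simp: Int_stable_def)
  moreover have "{S :: real set. open S} \<subseteq> Pow UNIV" by simp
  moreover have "B \<in> sigma_sets UNIV {S. open S}" using B by (simp add: sets_borel)
  ultimately show ?thesis
  proof (induction rule: sigma_sets_induct_disjoint)
    case (basic A)
    then show ?case by (intro indicator_open_in_exp_closure[OF s _ a]) simp
  next
    case empty
    show ?case using indicator_open_in_exp_closure[OF s open_empty a] by simp
  next
    case (compl A)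
    then have A: "A \<in> sets borel" by (simp add: sets_borel)
    have "L2_class (\<lambda>y. indicator (UNIV \<inter> {a<..<b}) (s * y)) \<in> exp_closure"
      by (rule indicator_open_in_exp_closure[OF s open_UNIV a])
    with compl have "L2_class (\<lambda>y. indicator (UNIV \<inter> {a<..<b}) (s * y)) -
        L2_class (\<lambda>y. indicator (A \<inter> {a<..<b}) (s * y)) \<in> exp_closure"
      by (intro exp_closure_diff) auto
    also have "L2_class (\<lambda>y. indicator (UNIV \<inter> {a<..<b}) (s * y)) -
        L2_class (\<lambda>y. indicator (A \<inter> {a<..<b}) (s * y)) = (L2_class (\<lambda>y.
          indicator (UNIV \<inter> {a<..<b}) (s * y) - indicator (A \<inter> {a<..<b}) (s * y)) :: line L2)"
      using A by (intro L2_class_diff[symmetric])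
        (auto intro!: square_integrable_indicator[OF s, of _ a b])
    also have "(\<lambda>y. indicator (UNIV \<inter> {a<..<b}) (s * y) - indicator (A \<inter> {a<..<b}) (s * y)) =
        (\<lambda>y. indicator ((UNIV - A) \<inter> {a<..<b}) (s * y) :: complex)"
      by (auto simp: fun_eq_iff split: split_indicator)
    finally show ?case .
  next
    case (union A)
    then have A: "A i \<in> sets borel" for i by (auto simp: sets_borel)
    note [measurable] = A
    define f where "f n y = (\<Sum>i<n. indicator (A i \<inter> {a<..<b}) (s * y) :: complex)" for n :: nat and y
    have sq: "square_integrable lborel (\<lambda>y. indicator (A i \<inter> {a<..<b}) (s * y))" for i
      using A by (intro square_integrable_indicator[OF s, of _ a b]) auto
    have f_eq: "f n y = indicator ((\<Union>i<n. A i) \<inter> {a<..<b}) (s * y)" for n y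
    proof -
      have "disjoint_family_on (\<lambda>i. A i \<inter> {a<..<b}) {..<n}"
        using union(1) by (auto simp: disjoint_family_on_def)
      then have "f n y = indicator (\<Union>i<n. A i \<inter> {a<..<b}) (s * y)"
        unfolding f_def by (subst indicator_UN_disjoint) auto
      then show ?thesis by simp
    qed
    have "L2_class (f n) = (\<Sum>i<n. L2_class (\<lambda>y. indicator (A i \<inter> {a<..<b}) (s * y)) :: line L2)" for n
      unfolding f_def by (rule L2_class_sum) (auto simp: sq)
    then have "L2_class (f n) \<in> exp_closure" for n
      using union(3) by (auto intro!: exp_closure_sum)
    moreover have "(\<lambda>n. L2_class (f n) :: line L2) \<longlonglongrightarrow>
        L2_class (\<lambda>y. indicator (\<Union> (range A) \<inter> {a<..<b}) (s * y))"
    proof (rule tendsto_L2_class_dominated)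
      show "square_integrable (line_measure TYPE(line)) (\<lambda>y. indicator (UNIV \<inter> {a<..<b}) (s * y))"
        using square_integrable_indicator[OF s, of "UNIV \<inter> {a<..<b}" a b] by simp
      show "f n \<in> borel_measurable (line_measure TYPE(line))" for n
        unfolding f_def line_measure_line by measurable
      show "AE y in line_measure TYPE(line).
          (\<lambda>n. f n y) \<longlonglongrightarrow> indicator (\<Union> (range A) \<inter> {a<..<b}) (s * y)"
      proof (intro AE_I2)
        fix y
        have "(\<lambda>n. indicator (\<Union>i<n. A i) (s * y) :: complex) \<longlonglongrightarrow> indicator (\<Union> (range A)) (s * y)"
          by (rule LIMSEQ_indicator_UN)
        then have "(\<lambda>n. indicator (\<Union>i<n. A i) (s * y) * indicator {a<..<b} (s * y) :: complex)
            \<longlonglongrightarrow> indicator (\<Union> (range A)) (s * y) * indicator {a<..<b} (s * y)"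
          by (intro tendsto_intros)
        then show "(\<lambda>n. f n y) \<longlonglongrightarrow> indicator (\<Union> (range A) \<inter> {a<..<b}) (s * y)"
          by (simp only: f_eq indicator_inter_arith)
      qed
      have [measurable]: "\<Union> (range A) \<in> sets borel" using A by blast
      show "(\<lambda>y. indicator (\<Union> (range A) \<inter> {a<..<b}) (s * y) :: complex)
          \<in> borel_measurable (line_measure TYPE(line))"
        unfolding line_measure_line by measurable
      show "AE y in line_measure TYPE(line). norm (f n y) \<le>
          norm (indicator (UNIV \<inter> {a<..<b}) (s * y) :: complex)" for n
        unfolding f_eq by (auto split: split_indicator)
    qed
    ultimately show ?case by (rule exp_closure_limit)
  qed
qed

text \<open>The windows 1/(n+1) < |y| < n+1 exhaust the line up to the null set {0}. The part on the
  negative axis is the reflection of \<open>B'\<close>, reached with s = -1.\<close>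

lemma square_integrable_indicator_in_exp_closure:
  assumes [measurable]: "B \<in> sets borel" and sq: "square_integrable lborel (indicator B)"
  shows "L2_class (indicator B) \<in> exp_closure"
proof -
  define a b where "a n = inverse (real (Suc n))" and "b n = real (Suc n)" for n
  define B' where "B' = {y. - y \<in> B}"
  have [measurable]: "B' \<in> sets borel" unfolding B'_def by measurable
  define f where "f n y = indicator (B \<inter> {a n<..<b n}) (1 * y) +
      (indicator (B' \<inter> {a n<..<b n}) ((- 1) * y) :: complex)" for n y
  have a0: "0 < a n" for n by (simp add: a_def)
  have f_eq: "f n y = indicator (B \<inter> {y. \<bar>y\<bar> \<in> {a n<..<b n}}) y" for n y
    using a0[of n] by (auto simp: f_def B'_def indicator_def)
  have "L2_class (f n) = (L2_class (\<lambda>y. indicator (B \<inter> {a n<..<b n}) (1 * y)) +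
      L2_class (\<lambda>y. indicator (B' \<inter> {a n<..<b n}) ((- 1) * y)) :: line L2)" for n
    unfolding f_def
    using square_integrable_indicator[of 1 "B \<inter> {a n<..<b n}" "a n" "b n"]
      square_integrable_indicator[of "-1" "B' \<inter> {a n<..<b n}" "a n" "b n"]
    by (intro L2_class_add) simp_all
  then have "L2_class (f n) \<in> exp_closure" for n
    by (simp only:) (intro exp_closure_add indicator_borel_in_exp_closure a0; simp)
  moreover have "(\<lambda>n. L2_class (f n) :: line L2) \<longlonglongrightarrow> L2_class (indicator B)"
  proof (rule tendsto_L2_class_dominated)
    show "square_integrable (line_measure TYPE(line)) (indicator B)" using sq by simp
    show "f n \<in> borel_measurable (line_measure TYPE(line))" for n
      unfolding f_def by simp
    show "AE y in line_measure TYPE(line). norm (f n y) \<le> norm (indicator B y :: complex)" for n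
      unfolding f_eq by (auto split: split_indicator)
    have "AE y in lborel. y \<noteq> (0 :: real)" by (rule AE_lborel_singleton)
    then show "AE y in line_measure TYPE(line). (\<lambda>n. f n y) \<longlonglongrightarrow> indicator B y"
      unfolding line_measure_line
    proof eventually_elim
      case (elim y)
      obtain N :: nat where N: "max \<bar>y\<bar> (1 / \<bar>y\<bar>) \<le> N" using real_arch_simple by blast
      have "f n y = indicator B y" if "N \<le> n" for n
      proof -
        have "\<bar>y\<bar> < real (Suc n)" "1 / \<bar>y\<bar> < real (Suc n)" using N that by linarith+
        then have "\<bar>y\<bar> \<in> {a n<..<b n}" using elim by (simp add: a_def b_def field_simps)
        then show ?thesis by (simp add: f_eq indicator_def)
      qed
      then have "\<forall>\<^sub>F n in sequentially. f n y = indicator B y" by (rule eventually_sequentiallyI)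
      then show ?case by (rule tendsto_eventually)
    qed
  qed simp_all
  ultimately show ?thesis by (rule exp_closure_limit)
qed

lemma simple_in_exp_closure:
  assumes simple: "simple_function lborel f" and sq: "square_integrable lborel f"
  shows "L2_class f \<in> exp_closure"
proof -
  have fin: "finite (range f)" using simple by (simp add: simple_function_def)
  have [measurable]: "f \<in> borel_measurable lborel" using sq by (simp add: square_integrable_def)
  define g where "g z y = z * indicator (f -` {z}) y" for z y
  have meas: "f -` {z} \<in> sets borel" for z
    using measurable_sets[of f lborel borel "{z}"] by simp
  \<comment> \<open>On the level set of z the function \<open>f / z\<close> has modulus 1, so it
    dominates the indicator. The level set of 0 may have infinite measure, but its summand
    \<open>g 0\<close> vanishes.\<close>
  have ind: "square_integrable lborel (indicator (f -` {z}))" if "z \<noteq> 0" for z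
    by (rule square_integrable_bound[OF square_integrable_cmult[OF sq, of "1 / z"]])
      (use that meas in \<open>auto split: split_indicator\<close>)
  have sqg: "square_integrable lborel (g z)" for z
    unfolding g_def by (cases "z = 0") (auto intro: square_integrable_cmult square_integrable_zero ind)
  have f_eq: "f = (\<lambda>y. \<Sum>z\<in>range f. g z y)"
  proof
    fix y
    have "(\<Sum>z\<in>range f. g z y) = (\<Sum>z\<in>{f y}. g z y)"
      by (rule sum.mono_neutral_right) (auto simp: fin g_def split: split_indicator)
    then show "f y = (\<Sum>z\<in>range f. g z y)" by (simp add: g_def)
  qed
  have "L2_class f = (\<Sum>z\<in>range f. L2_class (g z) :: line L2)"
    by (subst f_eq) (rule L2_class_sum, auto simp: fin sqg)
  also have "\<dots> \<in> exp_closure"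
  proof (rule exp_closure_sum)
    fix z
    show "L2_class (g z) \<in> exp_closure"
    proof (cases "z = 0")
      case True
      then have "L2_class (g z) = (0 :: line L2)" by (simp add: g_def[abs_def] zero_L2_def)
      then show ?thesis by (simp add: closure_subset[THEN subsetD] span_zero)
    next
      case False
      then have "L2_class (g z) = (scaleC z (L2_class (indicator (f -` {z}))) :: line L2)"
        by (simp add: g_def[abs_def] scaleC_L2_class ind)
      then show ?thesis
        using square_integrable_indicator_in_exp_closure[OF meas ind[OF False]]
        by (simp add: exp_closure_scaleC)
    qed
  qed
  finally show ?thesis .
qed

lemma exp_closure_UNIV: "exp_closure = UNIV"
proof (intro set_eqI iffI UNIV_I)
  fix u :: "line L2"
  have sq: "square_integrable lborel (L2_fun u)" using square_integrable_L2_fun[of u] by simp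
  then have [measurable]: "L2_fun u \<in> borel_measurable lborel" by (simp add: square_integrable_def)
  obtain F where F: "\<And>i. simple_function lborel (F i)" "\<And>x. (\<lambda>i. F i x) \<longlonglongrightarrow> L2_fun u x"
      "\<And>i x. norm (F i x) \<le> 2 * norm (L2_fun u x)"
    using borel_measurable_implies_sequence_metric[of "L2_fun u" lborel 0] by (auto simp: dist_norm)
  have meas: "F i \<in> borel_measurable lborel" for i
    using F(1) by (rule borel_measurable_simple_function)
  have w: "square_integrable lborel (\<lambda>x. 2 * L2_fun u x)" by (rule square_integrable_cmult[OF sq])
  have bd: "AE x in lborel. norm (F i x) \<le> norm (2 * L2_fun u x)" for i
    using F(3) by (simp add: norm_mult)
  have "(\<lambda>i. L2_class (F i) :: line L2) \<longlonglongrightarrow> L2_class (L2_fun u)"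
    by (rule tendsto_L2_class_dominated[where 'd = line, unfolded line_measure_line, OF meas _ w _ bd])
      (simp_all add: F(2))
  moreover have "L2_class (F i) \<in> exp_closure" for i
    by (intro simple_in_exp_closure F(1) square_integrable_bound[OF w meas bd])
  ultimately show "u \<in> exp_closure"
    unfolding L2_class_L2_fun by (rule exp_closure_limit[rotated])
qed

text \<open>Density in the form of an induction rule: a closed property that survives sums and real
  multiples only has to be checked on the generators.\<close>

lemma exp_family_induct [case_names closed add scaleR basis]:
  fixes u :: "line L2"
  assumes "closed {u. P u}" "\<And>u v. P u \<Longrightarrow> P v \<Longrightarrow> P (u + v)" "\<And>r u. P u \<Longrightarrow> P (r *\<^sub>R u)"
    "\<And>c s n. \<bar>s\<bar> = 1 \<Longrightarrow> 0 < n \<Longrightarrow> P (scaleC c (L2_class (half_exp s (of_nat n))))"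
  shows "P u"
proof -
  have "P 0" using assms(3)[of _ 0] assms(4)[of 1 1 0] by simp
  have "v \<in> span exp_family \<Longrightarrow> P v" for v
  proof (induction rule: span_induct_alt)
    case (step c x y)
    then show ?case using assms by (auto simp: exp_family_def)
  qed fact
  then have "exp_closure \<subseteq> {u. P u}"
    by (intro closure_minimal assms) auto
  then show ?thesis by (auto simp: exp_closure_UNIV)
qed

section \<open>Plancherel's theorem\<close>

lemma integral_FTC_UNIV:
  fixes f F :: "real \<Rightarrow> 'a::euclidean_space"
  assumes F: "\<And>x. (F has_vector_derivative f x) (at x)"
    and cont: "\<And>x. isCont f x" and int: "integrable lborel f"
    and A: "(F \<longlongrightarrow> A) at_bot" and B: "(F \<longlongrightarrow> B) at_top"
  shows "(LINT x|lborel. f x) = B - A"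
proof -
  have "(LBINT x=-\<infinity>..\<infinity>. f x) = B - A"
    by (rule interval_integral_FTC_integrable[where F = F])
      (use assms in \<open>auto simp: ereal_tendsto_simps set_integrable_def\<close>)
  then show ?thesis
    by (simp add: interval_lebesgue_integral_def set_lebesgue_integral_def)
qed

lemma add_imaginary_nonzero:
  assumes "a \<noteq> 0" shows "complex_of_real a + \<i> * of_real x \<noteq> 0"
  using assms by (simp add: complex_eq_iff)

lemma square_integrable_resolvent:
  assumes a: "a \<noteq> 0"
  shows "square_integrable lborel (\<lambda>x. 1 / (complex_of_real a + \<i> * of_real x))"
  unfolding square_integrable_def
proof
  show "(\<lambda>x. 1 / (complex_of_real a + \<i> * of_real x)) \<in> borel_measurable lborel" by measurable
  have "integrable lborel (\<lambda>x :: real. inverse (1 + x\<^sup>2))"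
    using integrable_inverse_1_plus_square by (simp add: set_integrable_def)
  then have "integrable lborel (\<lambda>x. (1 + 1 / a\<^sup>2) * inverse (1 + x\<^sup>2))" by simp
  then show "integrable lborel (\<lambda>x. (norm (1 / (complex_of_real a + \<i> * of_real x)))\<^sup>2)"
  proof (rule Bochner_Integration.integrable_bound)
    have "(norm (1 / (complex_of_real a + \<i> * of_real x)))\<^sup>2 \<le> (1 + 1 / a\<^sup>2) * inverse (1 + x\<^sup>2)" for x
    proof -
      \<comment> \<open>The constant works because (1 + 1/a^2)(a^2 + x^2) = 1 + x^2 + a^2 +
        x^2/a^2.\<close>
      have "1 + x\<^sup>2 \<le> (1 + 1 / a\<^sup>2) * (a\<^sup>2 + x\<^sup>2)"
        using a by (simp add: field_simps)
      moreover have "0 < a\<^sup>2 + x\<^sup>2" "0 < 1 + x\<^sup>2"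
        using a by (auto intro: add_pos_nonneg)
      moreover have "(norm (1 / (complex_of_real a + \<i> * of_real x)))\<^sup>2 = 1 / (a\<^sup>2 + x\<^sup>2)"
        by (simp add: norm_divide power_divide cmod_power2)
      ultimately show ?thesis by (simp add: field_simps)
    qed
    then show "AE x in lborel. norm ((norm (1 / (complex_of_real a + \<i> * of_real x)))\<^sup>2) \<le>
        norm ((1 + 1 / a\<^sup>2) * inverse (1 + x\<^sup>2))"
      by (intro AE_I2) (simp add: abs_mult)
  qed measurable
qed

text \<open>If a and b differ, b - a times the integrand is a difference of two resolvents, with
  antiderivatives of the form arctan(x/a) - (i/2) ln(a^2 + x^2). In the difference the logarithms
  cancel at both ends, and each arctangent contributes \<pi> times a sign. If a = b, an
  antiderivative is i/(a + ix), which vanishes at both ends, in agreement with 0 / 0 = 0 on the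
  right.\<close>

lemma integral_resolvent_product:
  assumes a: "a \<noteq> 0" and b: "b \<noteq> 0"
  shows "(LINT x|lborel. 1 / ((complex_of_real a + \<i> * of_real x) * (of_real b + \<i> * of_real x))) =
    of_real (pi * (sgn a - sgn b) / (b - a))"
proof -
  let ?k = "\<lambda>a x. complex_of_real a + \<i> * of_real x"
  let ?f = "\<lambda>x. 1 / (?k a x * ?k b x)"
  have nz: "?k a x \<noteq> 0" "?k b x \<noteq> 0" for x
    using a b by (simp_all add: add_imaginary_nonzero)
  have int: "integrable lborel ?f"
  proof -
    \<comment> \<open>Conjugating the resolvent at -b gives minus the resolvent at b, so the
      integrand is, up to sign, a pairing of two L2 functions.\<close>
    have "integrable lborel (\<lambda>x. 1 / ?k a x * cnj (1 / ?k (- b) x))"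
      by (intro integrable_square_integrable_mult square_integrable_resolvent) (use a b in auto)
    then have "integrable lborel (\<lambda>x. - (1 / ?k a x * cnj (1 / ?k (- b) x)))" by simp
    also have "(\<lambda>x. - (1 / ?k a x * cnj (1 / ?k (- b) x))) = ?f"
    proof
      fix x
      have "cnj (?k (- b) x) = - ?k b x" by simp
      then show "- (1 / ?k a x * cnj (1 / ?k (- b) x)) = ?f x"
        by (simp only: complex_cnj_divide complex_cnj_one divide_minus_right mult_minus_right
            minus_minus times_divide_times_eq mult_1_left)
    qed
    finally show ?thesis .
  qed
  have cont: "isCont ?f x" for x by (intro continuous_intros) (simp add: nz)
  show ?thesis
  proof (cases "a = b")
    case True
    have "(LINT x|lborel. ?f x) = 0 - 0"
    proof (rule integral_FTC_UNIV[OF _ cont int])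
      show "((\<lambda>x. \<i> / ?k a x) has_vector_derivative ?f x) (at x)" for x
        by (rule has_vector_derivative_real_field)
          (use nz True in \<open>auto intro!: derivative_eq_intros simp: field_simps power2_eq_square\<close>)
      have norm: "norm (\<i> / ?k a x) = 1 / sqrt (a\<^sup>2 + x\<^sup>2)" for x
        by (simp add: norm_divide) (simp add: cmod_def)
      have "((\<lambda>x. 1 / sqrt (a\<^sup>2 + x\<^sup>2)) \<longlongrightarrow> 0) at_top" by real_asymp
      then show "((\<lambda>x. \<i> / ?k a x) \<longlongrightarrow> 0) at_top"
        unfolding norm[symmetric] by (rule tendsto_norm_zero_cancel)
      have "((\<lambda>x. 1 / sqrt (a\<^sup>2 + x\<^sup>2)) \<longlongrightarrow> 0) at_bot" by real_asymp
      then show "((\<lambda>x. \<i> / ?k a x) \<longlongrightarrow> 0) at_bot"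
        unfolding norm[symmetric] by (rule tendsto_norm_zero_cancel)
    qed
    then show ?thesis using True by simp
  next
    case False
    define G where "G x = Complex (arctan (x / a) - arctan (x / b))
        ((ln (b\<^sup>2 + x\<^sup>2) - ln (a\<^sup>2 + x\<^sup>2)) / 2)" for x
    have pos: "0 < a\<^sup>2 + x\<^sup>2" "0 < b\<^sup>2 + x\<^sup>2" for x
      using a b by (auto intro: add_pos_nonneg)
    have inv: "1 / ?k c x = Complex (c / (c\<^sup>2 + x\<^sup>2)) (- x / (c\<^sup>2 + x\<^sup>2))" for c x
      by (simp add: complex_eq_iff Re_divide Im_divide)
    have d_arctan: "((\<lambda>x. arctan (x / c)) has_real_derivative c / (c\<^sup>2 + x\<^sup>2)) (at x)" if "c \<noteq> 0" for c x
    proof -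
      have "((\<lambda>x. arctan (x / c)) has_real_derivative inverse (1 + (x / c)\<^sup>2) * (1 / c)) (at x)"
        using that by (auto intro!: derivative_eq_intros)
      also have "inverse (1 + (x / c)\<^sup>2) * (1 / c) = c / (c\<^sup>2 + x\<^sup>2)"
      proof -
        have "0 < c\<^sup>2 + x\<^sup>2" using that by (auto intro: add_pos_nonneg)
        then show ?thesis using that by (simp add: divide_simps power2_eq_square)
      qed
      finally show ?thesis .
    qed
    have d_ln: "((\<lambda>x. ln (c\<^sup>2 + x\<^sup>2) / 2) has_real_derivative x / (c\<^sup>2 + x\<^sup>2)) (at x)"
      if "0 < c\<^sup>2 + x\<^sup>2" for c x
    proof -
      have "((\<lambda>x. ln (c\<^sup>2 + x\<^sup>2)) has_real_derivative 2 * x / (c\<^sup>2 + x\<^sup>2)) (at x)"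
        using that by (auto intro!: derivative_eq_intros)
      then have "((\<lambda>x. ln (c\<^sup>2 + x\<^sup>2) / 2) has_real_derivative 2 * x / (c\<^sup>2 + x\<^sup>2) / 2) (at x)"
        by (rule DERIV_cdivide)
      moreover have "2 * x / (c\<^sup>2 + x\<^sup>2) / 2 = x / (c\<^sup>2 + x\<^sup>2)"
        by (simp only: divide_divide_eq_left mult.commute[of _ 2] mult_divide_mult_cancel_left_if) simp
      ultimately show ?thesis by (simp only:)
    qed
    have dG: "(G has_vector_derivative (1 / ?k a x - 1 / ?k b x)) (at x)" for x
    proof -
      have "((\<lambda>x. arctan (x / a) - arctan (x / b)) has_real_derivative
          a / (a\<^sup>2 + x\<^sup>2) - b / (b\<^sup>2 + x\<^sup>2)) (at x)"
        by (intro DERIV_diff d_arctan a b)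
      moreover have "((\<lambda>x. (ln (b\<^sup>2 + x\<^sup>2) - ln (a\<^sup>2 + x\<^sup>2)) / 2) has_real_derivative
          x / (b\<^sup>2 + x\<^sup>2) - x / (a\<^sup>2 + x\<^sup>2)) (at x)"
        unfolding diff_divide_distrib by (intro DERIV_diff d_ln pos)
      ultimately show ?thesis
        unfolding G_def has_vector_derivative_complex_iff inv by simp
    qed
    have eq: "1 / ?k a x - 1 / ?k b x = of_real (b - a) * ?f x" for x
      using nz[of x] by (simp add: field_simps)
    have int': "integrable lborel (\<lambda>x. of_real (b - a) * ?f x)"
      by (intro integrable_mult_right int)
    have lim_top: "(G \<longlongrightarrow> Complex (pi / 2 * sgn a - pi / 2 * sgn b) 0) at_top"
    proof -
      have "((\<lambda>x. arctan (x / c)) \<longlongrightarrow> pi / 2 * sgn c) at_top" if "c \<noteq> 0" for c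
      proof (cases "0 < c")
        case True then show ?thesis by (simp, real_asymp)
      next
        case False then have "c < 0" using that by simp then show ?thesis by (simp, real_asymp)
      qed
      moreover have "((\<lambda>x. (ln (b\<^sup>2 + x\<^sup>2) - ln (a\<^sup>2 + x\<^sup>2)) / 2) \<longlongrightarrow> 0) at_top" by real_asymp
      ultimately show ?thesis
        unfolding G_def using a b by (intro tendsto_Complex tendsto_diff) auto
    qed
    have lim_bot: "(G \<longlongrightarrow> Complex (- (pi / 2 * sgn a) + pi / 2 * sgn b) 0) at_bot"
    proof -
      have "((\<lambda>x. arctan (x / c)) \<longlongrightarrow> - (pi / 2 * sgn c)) at_bot" if "c \<noteq> 0" for c
      proof (cases "0 < c")
        case True then show ?thesis by (simp, real_asymp)
      next
        case False then have "c < 0" using that by simp then show ?thesis by (simp, real_asymp)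
      qed
      from tendsto_diff[OF this[OF a] this[OF b]]
      have "((\<lambda>x. arctan (x / a) - arctan (x / b)) \<longlongrightarrow> - (pi / 2 * sgn a) + pi / 2 * sgn b) at_bot"
        by simp
      moreover have "((\<lambda>x. (ln (b\<^sup>2 + x\<^sup>2) - ln (a\<^sup>2 + x\<^sup>2)) / 2) \<longlongrightarrow> 0) at_bot" by real_asymp
      ultimately show ?thesis
        unfolding G_def by (intro tendsto_Complex) auto
    qed
    have "(LINT x|lborel. of_real (b - a) * ?f x) =
        Complex (pi / 2 * sgn a - pi / 2 * sgn b) 0 - Complex (- (pi / 2 * sgn a) + pi / 2 * sgn b) 0"
      by (rule integral_FTC_UNIV[OF dG[unfolded eq] _ int' lim_bot lim_top])
        (intro continuous_intros cont)
    also have "\<dots> = of_real (pi * (sgn a - sgn b))"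
      by (simp add: complex_eq_iff algebra_simps)
    finally have "of_real (b - a) * (LINT x|lborel. ?f x) = complex_of_real (pi * (sgn a - sgn b))"
      by (simp only: integral_mult_right_zero)
    then have "(LINT x|lborel. ?f x) = complex_of_real (pi * (sgn a - sgn b)) / of_real (b - a)"
      using False by (simp add: field_simps)
    then show ?thesis by simp
  qed
qed

section \<open>The Fourier integral of integrable functions\<close>

definition fourier_integral :: "(real \<Rightarrow> complex) \<Rightarrow> real \<Rightarrow> complex" where
  "fourier_integral f x = complex_of_real (1 / sqrt (2 * pi)) *
     (LINT y|lborel. exp (- \<i> * complex_of_real (x * y)) * f y)"

lemma fourier_integral_measurable [measurable]:
  assumes "f \<in> borel_measurable lborel"
  shows "fourier_integral f \<in> borel_measurable lborel"
proof -
  have [measurable]: "f \<in> borel_measurable borel" using assms by simp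
  show ?thesis
    unfolding fourier_integral_def[abs_def] by measurable
qed

lemma integrable_exp_mult:
  assumes "integrable lborel f"
  shows "integrable lborel (\<lambda>y. exp (- \<i> * complex_of_real (x * y)) * f y)"
  using assms by (rule Bochner_Integration.integrable_bound) (use assms in \<open>auto simp: norm_mult\<close>)

lemma fourier_integral_add:
  "integrable lborel f \<Longrightarrow> integrable lborel g \<Longrightarrow>
    fourier_integral (\<lambda>y. f y + g y) x = fourier_integral f x + fourier_integral g x"
  unfolding fourier_integral_def
  by (simp only: distrib_left
      Bochner_Integration.integral_add[OF integrable_exp_mult integrable_exp_mult])

lemma fourier_integral_cmult: "fourier_integral (\<lambda>y. c * f y) x = c * fourier_integral f x"
  unfolding fourier_integral_def
  by (simp only: mult.left_commute[of _ c] integral_mult_right_zero)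

lemma fourier_integral_cong_AE:
  assumes "f \<in> borel_measurable lborel" "g \<in> borel_measurable lborel" "AE y in lborel. f y = g y"
  shows "fourier_integral f = fourier_integral g"
proof
  fix x
  have [measurable]: "f \<in> borel_measurable borel" "g \<in> borel_measurable borel" using assms by simp_all
  have "(LINT y|lborel. exp (- \<i> * complex_of_real (x * y)) * f y) =
      (LINT y|lborel. exp (- \<i> * complex_of_real (x * y)) * g y)"
    by (rule integral_cong_AE, measurable) (use assms(3) in \<open>auto elim: eventually_mono\<close>)
  then show "fourier_integral f x = fourier_integral g x" by (simp add: fourier_integral_def)
qed

lemma norm_fourier_integral_le:
  "norm (fourier_integral f x) \<le> 1 / sqrt (2 * pi) * (LINT y|lborel. norm (f y))"
proof -
  have "norm (LINT y|lborel. exp (- \<i> * complex_of_real (x * y)) * f y) \<le> (LINT y|lborel. norm (f y))"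
    using integral_norm_bound[of lborel "\<lambda>y. exp (- \<i> * complex_of_real (x * y)) * f y"]
    by (simp add: norm_mult)
  then show ?thesis
    unfolding fourier_integral_def norm_mult norm_of_real by (intro mult_mono) auto
qed

lemma fourier_integral_half_exp:
  assumes s: "\<bar>s\<bar> = 1" and z: "0 < Re z"
  shows "fourier_integral (half_exp s z) x = of_real (1 / sqrt (2 * pi)) / (z + \<i> * of_real (s * x))"
proof -
  have "s * s = 1" using s by (auto simp: abs_if split: if_splits)
  then have ss: "complex_of_real s * (of_real s * w) = w" for w
    by (metis mult.assoc mult_1 of_real_1 of_real_mult)
  have "exp (- \<i> * complex_of_real (x * y)) * half_exp s z y = half_exp s (z + \<i> * of_real (s * x)) y" for y
    by (simp add: half_exp_def ss algebra_simps flip: exp_add)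
  then show ?thesis
    using half_exp_integral(2)[OF s, of "z + \<i> * of_real (s * x)"] z
    by (simp add: fourier_integral_def)
qed

text \<open>Fubini for a kernel that is symmetric in x and y, with |f(y)| |g(x)| as integrable
  majorant. This makes the transform its own transpose.\<close>

lemma fourier_integral_multiplication:
  assumes f: "integrable lborel f" and g: "integrable lborel g"
  shows "(LINT x|lborel. fourier_integral f x * g x) = (LINT y|lborel. f y * fourier_integral g y)"
proof -
  have [measurable]: "f \<in> borel_measurable borel" "g \<in> borel_measurable borel"
    using f g by auto
  let ?h = "\<lambda>x y. exp (- \<i> * complex_of_real (x * y)) * f y * g x"
  have int: "integrable (lborel \<Otimes>\<^sub>M lborel) (\<lambda>(x, y). ?h x y)"
  proof (rule lborel_pair.Fubini_integrable)
    show "(\<lambda>(x, y). ?h x y) \<in> borel_measurable (lborel \<Otimes>\<^sub>M lborel)" by measurable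
    have "integrable lborel (\<lambda>x. norm (g x) * (LINT y|lborel. norm (f y)))"
      using g by simp
    then show "integrable lborel (\<lambda>x. LINT y|lborel. norm (case (x, y) of (x, y) \<Rightarrow> ?h x y))"
      by (simp add: norm_mult mult.commute)
    show "AE x in lborel. integrable lborel (\<lambda>y. case (x, y) of (x, y) \<Rightarrow> ?h x y)"
      using integrable_exp_mult[OF f] by (intro AE_I2) simp
  qed
  have "(LINT y|lborel. ?h x y) = (LINT y|lborel. exp (- \<i> * complex_of_real (x * y)) * f y) * g x" for x
    by (rule integral_mult_left_zero)
  then have left: "fourier_integral f x * g x = of_real (1 / sqrt (2 * pi)) * (LINT y|lborel. ?h x y)" for x
    by (simp only: fourier_integral_def mult.assoc)
  have "(LINT x|lborel. ?h x y) = (LINT x|lborel. f y * (exp (- \<i> * complex_of_real (y * x)) * g x))" for y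
    by (simp only: mult.commute mult.left_commute)
  then have right: "f y * fourier_integral g y = of_real (1 / sqrt (2 * pi)) * (LINT x|lborel. ?h x y)" for y
    by (simp only: fourier_integral_def mult.left_commute integral_mult_right_zero)
  show ?thesis
    by (simp only: left right integral_mult_right_zero lborel_pair.Fubini_integral[OF int])
qed

section \<open>Isometry on the generators\<close>

lemma cnj_half_exp: "cnj (half_exp s z y) = half_exp s (cnj z) y"
  by (simp add: half_exp_def exp_cnj)

text \<open>The factor (s t + 1)/2 is 1 on a common half line and 0 for disjoint supports. One
  formula for both cases can be compared with the value on the Fourier side.\<close>

lemma cinner_half_exp:
  assumes s: "\<bar>s\<bar> = 1" "\<bar>t\<bar> = 1" and n: "0 < n" "0 < m"
  shows "cinner (L2_class (half_exp s (of_nat n))) (L2_class (half_exp t (of_nat m)) :: line L2) =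
    of_real ((s * t + 1) / 2 / real (n + m))"
proof -
  have "cinner (L2_class (half_exp s (of_nat n))) (L2_class (half_exp t (of_nat m)) :: line L2) =
      (LINT y|lborel. half_exp s (of_nat n) y * half_exp t (of_nat m) y)"
    using assms by (subst cinner_L2_class) (simp_all add: square_integrable_half_exp cnj_half_exp)
  also have "\<dots> = of_real ((s * t + 1) / 2 / real (n + m))"
  proof (cases "s = t")
    case True
    then have "s * t = 1" using s by (auto simp: abs_if split: if_splits)
    then show ?thesis
      using half_exp_integral(2)[OF s(2), of "of_nat (n + m)"] n True
      by (simp add: half_exp_mult)
  next
    case False
    then have ts: "t = - s" "s * t = - 1" using s by (auto simp: abs_if split: if_splits)
    have zero: "half_exp s (of_nat n) y * half_exp t (of_nat m) y = 0" for y
      by (auto simp: half_exp_def ts(1))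
    show ?thesis by (simp only: zero ts(2)) simp
  qed
  finally show ?thesis .
qed

lemma square_integrable_fourier_integral_half_exp:
  assumes "\<bar>s\<bar> = 1" "0 < n"
  shows "square_integrable lborel (fourier_integral (half_exp s (of_nat n)))"
proof -
  have "fourier_integral (half_exp s (of_nat n)) x =
      of_real (s / sqrt (2 * pi)) * (1 / (of_real (s * n) + \<i> * of_real x))" for x
  proof -
    have st: "s = 1 \<or> s = - 1" using assms by (auto simp: abs_if split: if_splits)
    then have "of_nat n + \<i> * of_real (s * x) = of_real s * (of_real (s * n) + \<i> * complex_of_real x)"
      by auto
    then have "fourier_integral (half_exp s (of_nat n)) x =
        of_real (1 / sqrt (2 * pi)) / (of_real s * (of_real (s * n) + \<i> * of_real x))"
      using assms by (simp only: fourier_integral_half_exp complex_Re_of_nat of_nat_0_less_iff)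
    also have "\<dots> = of_real (s / sqrt (2 * pi)) * (1 / (of_real (s * n) + \<i> * of_real x))"
      using st by (auto simp only: of_real_1 of_real_minus mult_minus_left mult_1_left divide_minus_right
          divide_minus_left times_divide_eq_right mult_1_right)
    finally show ?thesis .
  qed
  then have "fourier_integral (half_exp s (of_nat n)) =
      (\<lambda>x. of_real (s / sqrt (2 * pi)) * (1 / (of_real (s * n) + \<i> * of_real x)))" ..
  then show ?thesis
    using assms by (simp only:) (intro square_integrable_cmult square_integrable_resolvent, auto)
qed

text \<open>Since n + i s x = s (s n + i x), the pairing is a resolvent product with a = s n and b =
  - t m, the minus sign coming from conjugation. Then sgn a - sgn b = s + t, which vanishes for
  opposite sides, including the case n = m where the denominator is 0 too. The result agrees with
  \<open>cinner_half_exp\<close>.\<close>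

lemma cinner_fourier_integral_half_exp:
  assumes s: "\<bar>s\<bar> = 1" "\<bar>t\<bar> = 1" and n: "0 < n" "0 < m"
  shows "cinner (L2_class (fourier_integral (half_exp s (of_nat n))))
      (L2_class (fourier_integral (half_exp t (of_nat m))) :: line L2) =
    of_real ((s * t + 1) / 2 / real (n + m))"
proof -
  have st: "s = 1 \<or> s = - 1" "t = 1 \<or> t = - 1" using s by (auto simp: abs_if split: if_splits)
  have c: "complex_of_real (1 / sqrt (2 * pi)) * of_real (1 / sqrt (2 * pi)) = of_real (1 / (2 * pi))"
    by (simp flip: of_real_mult)
  let ?k = "\<lambda>a x. complex_of_real a + \<i> * of_real x"
  have nz: "?k (s * n) x \<noteq> 0" "?k (- (t * m)) x \<noteq> 0" for x
    by (rule add_imaginary_nonzero, use s n in auto)+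
  have eq: "fourier_integral (half_exp s (of_nat n)) x * cnj (fourier_integral (half_exp t (of_nat m)) x) =
      of_real (- (s * t) / (2 * pi)) * (1 / (?k (s * n) x * ?k (- (t * m)) x))" for x
  proof -
    have "of_nat n + \<i> * of_real (s * x) = of_real s * ?k (s * n) x"
      "cnj (of_nat m + \<i> * of_real (t * x)) = of_real (- t) * ?k (- (t * m)) x"
      using st by (auto simp: algebra_simps)
    then have "fourier_integral (half_exp s (of_nat n)) x * cnj (fourier_integral (half_exp t (of_nat m)) x) =
        (of_real (1 / sqrt (2 * pi)) * of_real (1 / sqrt (2 * pi))) /
        (of_real s * ?k (s * n) x * (of_real (- t) * ?k (- (t * m)) x))"
      using s n by (simp only: fourier_integral_half_exp complex_cnj_divide complex_cnj_complex_of_real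
          complex_Re_of_nat of_nat_0_less_iff times_divide_times_eq)
    also have "\<dots> = of_real (- (s * t) / (2 * pi)) * (1 / (?k (s * n) x * ?k (- (t * m)) x))"
    proof -
      have "P / (of_real s * A * (of_real (- t) * B)) = of_real (- (s * t)) * P * (1 / (A * B))"
        for P A B :: complex
        using st by auto
      then show ?thesis unfolding c by simp
    qed
    finally show ?thesis .
  qed
  have "cinner (L2_class (fourier_integral (half_exp s (of_nat n))))
      (L2_class (fourier_integral (half_exp t (of_nat m))) :: line L2) =
      of_real (- (s * t) / (2 * pi)) * (LINT x|lborel. 1 / (?k (s * n) x * ?k (- (t * m)) x))"
    using assms by (subst cinner_L2_class)
      (simp_all only: eq line_measure_line square_integrable_fourier_integral_half_exp
        integral_mult_right_zero)
  also have "\<dots> = of_real (- (s * t) / (2 * pi)) *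
      of_real (pi * (sgn (s * n) - sgn (- (t * m))) / (- (t * m) - s * n))"
    using s n by (subst integral_resolvent_product) auto
  also have "\<dots> = of_real ((s * t + 1) / 2 / real (n + m))"
    unfolding of_real_mult[symmetric] of_real_eq_iff
    using st n by (auto simp: divide_simps sgn_mult)
  finally show ?thesis .
qed

lemmas L2_fun_L2_class_line = L2_fun_L2_class[where 'd = line, unfolded line_measure_line]
  and L2_fun_plus_line = L2_fun_plus[where 'a = line, unfolded line_measure_line]
  and L2_fun_scaleC_line = L2_fun_scaleC[where 'd = line, unfolded line_measure_line]
  and L2_class_eq_iff_line = L2_class_eq_iff[where 'd = line, unfolded line_measure_line]
  and square_integrable_L2_fun_line = square_integrable_L2_fun[where 'd = line, unfolded line_measure_line]

lemma cinner_scaleR: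
  "cinner (r *\<^sub>R u) v = of_real r * cinner u v" "cinner u (r *\<^sub>R v) = of_real r * cinner u v"
  by (simp_all add: scaleR_L2_def cinner_scaleC_left cinner_scaleC_right)

text \<open>With one argument conjugated, \<open>cinner\<close> becomes the bilinear integral of u
  v, the pairing in which the Fourier kernel is symmetric. Conjugation also converts the transform
  into its inverse, see \<open>inv_fourier\<close>.\<close>

definition L2_cnj :: "'d::line_measure L2 \<Rightarrow> 'd L2" where
  "L2_cnj u = L2_class (\<lambda>x. cnj (L2_fun u x))"

lemma square_integrable_cnj:
  assumes "square_integrable M f" shows "square_integrable M (\<lambda>x. cnj (f x))"
  using assms by (auto simp: square_integrable_def)

lemma L2_cnj_L2_class:
  assumes "square_integrable (line_measure TYPE('d)) f"
  shows "L2_cnj (L2_class f) = (L2_class (\<lambda>x. cnj (f x)) :: 'd::line_measure L2)"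
  unfolding L2_cnj_def using L2_fun_L2_class[OF assms]
  by (intro L2_class_cong square_integrable_cnj assms square_integrable_L2_fun, eventually_elim) simp

lemma L2_cnj_cnj [simp]: "L2_cnj (L2_cnj u) = (u :: 'd::line_measure L2)"
  using L2_cnj_L2_class[OF square_integrable_cnj[OF square_integrable_L2_fun[of u]]]
  by (simp add: L2_cnj_def L2_class_L2_fun)

lemma L2_cnj_add: "L2_cnj (u + v) = L2_cnj u + L2_cnj (v :: 'd::line_measure L2)"
proof -
  have "L2_cnj (u + v) = L2_class (\<lambda>x. cnj (L2_fun u x) + cnj (L2_fun v x))"
    unfolding plus_L2_def
    by (subst L2_cnj_L2_class) (auto intro: square_integrable_add square_integrable_L2_fun)
  then show ?thesis
    unfolding L2_cnj_def[of u] L2_cnj_def[of v]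
    by (simp only: L2_class_add square_integrable_cnj square_integrable_L2_fun)
qed

lemma L2_cnj_scaleC: "L2_cnj (scaleC c u) = scaleC (cnj c) (L2_cnj (u :: 'd::line_measure L2))"
proof -
  have "L2_cnj (scaleC c u) = L2_cnj (L2_class (\<lambda>x. c * L2_fun u x))"
    by (simp add: scaleC_def)
  then show ?thesis
    by (simp add: L2_cnj_L2_class L2_cnj_def[of u] scaleC_L2_class
        square_integrable_cmult square_integrable_cnj square_integrable_L2_fun)
qed

lemma cinner_L2_cnj: "cinner (L2_cnj u) (L2_cnj v) = cnj (cinner u (v :: 'd::line_measure L2))"
  unfolding L2_cnj_def
  by (subst cinner_L2_class)
    (simp_all add: square_integrable_cnj square_integrable_L2_fun cinner_def flip: Bochner_Integration.integral_cnj)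

lemma norm_L2_cnj [simp]: "norm (L2_cnj u) = norm (u :: 'd::line_measure L2)"
  by (simp add: norm_L2_eq_cinner cinner_L2_cnj)

lemma bounded_linear_L2_cnj: "bounded_linear (L2_cnj :: 'd::line_measure L2 \<Rightarrow> 'd L2)"
  by (rule bounded_linear_intro[where K = 1]) (simp_all add: L2_cnj_add L2_cnj_scaleC scaleR_L2_def)

section \<open>The transform on the span and its isometric extension\<close>

lemma dense_closed_all:
  fixes P :: "line L2 \<Rightarrow> bool"
  assumes "closed {u. P u}" "\<And>u. u \<in> span exp_family \<Longrightarrow> P u"
  shows "P u"
proof -
  have "exp_closure \<subseteq> {u. P u}" by (intro closure_minimal assms) (auto simp: assms)
  then show ?thesis by (auto simp: exp_closure_UNIV)
qed

text \<open>Before Plancherel is available, square integrability of the Fourier integral has to be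
  carried along: otherwise \<open>L2_class\<close> in \<open>fourier0\<close> would return 0 and
  linearity would break.\<close>

definition transformable :: "line L2 \<Rightarrow> bool" where
  "transformable u \<longleftrightarrow> integrable lborel (L2_fun u) \<and> square_integrable lborel (fourier_integral (L2_fun u))"

definition fourier0 :: "line L2 \<Rightarrow> line L2" where
  "fourier0 u = L2_class (fourier_integral (L2_fun u))"

lemma L2_fun_measurable [measurable]: "L2_fun (u :: line L2) \<in> borel_measurable borel"
  using square_integrable_L2_fun[of u] by (simp add: square_integrable_def)

lemma integrable_L2_class:
  assumes "square_integrable lborel f" "integrable lborel f"
  shows "integrable lborel (L2_fun (L2_class f :: line L2))"
    "fourier_integral (L2_fun (L2_class f :: line L2)) = fourier_integral f"
proof -
  have AE: "AE x in lborel. L2_fun (L2_class f :: line L2) x = f x"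
    by (rule L2_fun_L2_class_line[OF assms(1)])
  have [measurable]: "f \<in> borel_measurable borel" using assms(2) by auto
  show "integrable lborel (L2_fun (L2_class f :: line L2))"
    using assms(2) AE by (subst integrable_cong_AE[where g = f]) auto
  show "fourier_integral (L2_fun (L2_class f :: line L2)) = fourier_integral f"
    by (rule fourier_integral_cong_AE[OF _ _ AE]) auto
qed

lemma transformable_half_exp:
  assumes "\<bar>s\<bar> = 1" "0 < n"
  shows "transformable (L2_class (half_exp s (of_nat n)))"
    "fourier0 (L2_class (half_exp s (of_nat n))) = L2_class (fourier_integral (half_exp s (of_nat n)))"
proof -
  have "square_integrable lborel (half_exp s (of_nat n))" "integrable lborel (half_exp s (of_nat n))"
    using assms by (auto intro: square_integrable_half_exp half_exp_integral)
  from integrable_L2_class[OF this] show "transformable (L2_class (half_exp s (of_nat n)))"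
    "fourier0 (L2_class (half_exp s (of_nat n))) = L2_class (fourier_integral (half_exp s (of_nat n)))"
    using square_integrable_fourier_integral_half_exp[OF assms] by (simp_all add: transformable_def fourier0_def)
qed

lemma transformable_add:
  assumes u: "transformable u" and v: "transformable v"
  shows "transformable (u + v)" "fourier0 (u + v) = fourier0 u + fourier0 v"
proof -
  have AE: "AE x in lborel. L2_fun (u + v) x = L2_fun u x + L2_fun v x"
    by (rule L2_fun_plus_line)
  have int: "integrable lborel (\<lambda>x. L2_fun u x + L2_fun v x)"
    using u v by (auto simp: transformable_def)
  have ft: "fourier_integral (L2_fun (u + v)) = (\<lambda>x. fourier_integral (L2_fun u) x + fourier_integral (L2_fun v) x)"
  proof -
    have "fourier_integral (L2_fun (u + v)) = fourier_integral (\<lambda>x. L2_fun u x + L2_fun v x)"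
      by (rule fourier_integral_cong_AE[OF _ _ AE]) auto
    then show ?thesis using u v by (simp add: fun_eq_iff fourier_integral_add transformable_def)
  qed
  show "transformable (u + v)"
    unfolding transformable_def ft
  proof
    show "integrable lborel (L2_fun (u + v))"
      using int AE by (subst integrable_cong_AE[where g = "\<lambda>x. L2_fun u x + L2_fun v x"]) auto
    show "square_integrable lborel (\<lambda>x. fourier_integral (L2_fun u) x + fourier_integral (L2_fun v) x)"
      using u v by (intro square_integrable_add) (auto simp: transformable_def)
  qed
  show "fourier0 (u + v) = fourier0 u + fourier0 v"
    unfolding fourier0_def ft using u v by (intro L2_class_add) (auto simp: transformable_def)
qed

lemma transformable_scaleC:
  assumes u: "transformable u"
  shows "transformable (scaleC c u)" "fourier0 (scaleC c u) = scaleC c (fourier0 u)"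
proof -
  have AE: "AE x in lborel. L2_fun (scaleC c u) x = c * L2_fun u x"
    by (rule L2_fun_scaleC_line)
  have int: "integrable lborel (\<lambda>x. c * L2_fun u x)"
    using u by (auto simp: transformable_def)
  have ft: "fourier_integral (L2_fun (scaleC c u)) = (\<lambda>x. c * fourier_integral (L2_fun u) x)"
  proof -
    have "fourier_integral (L2_fun (scaleC c u)) = fourier_integral (\<lambda>x. c * L2_fun u x)"
      by (rule fourier_integral_cong_AE[OF _ _ AE]) auto
    then show ?thesis by (simp add: fun_eq_iff fourier_integral_cmult)
  qed
  show "transformable (scaleC c u)"
    unfolding transformable_def ft
  proof
    show "integrable lborel (L2_fun (scaleC c u))"
      using int AE by (subst integrable_cong_AE[where g = "\<lambda>x. c * L2_fun u x"]) auto
    show "square_integrable lborel (\<lambda>x. c * fourier_integral (L2_fun u) x)"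
      using u by (intro square_integrable_cmult) (auto simp: transformable_def)
  qed
  show "fourier0 (scaleC c u) = scaleC c (fourier0 u)"
    unfolding fourier0_def ft using u by (intro scaleC_L2_class[symmetric]) (auto simp: transformable_def)
qed

lemma transformable_span: "u \<in> span exp_family \<Longrightarrow> transformable u"
proof (induction rule: span_induct_alt)
  case base
  have "transformable (scaleC 0 (L2_class (half_exp 1 (of_nat 1))))" by (intro transformable_scaleC transformable_half_exp) auto
  then show ?case by simp
next
  case (step c x y)
  then show ?case by (auto simp: exp_family_def scaleR_L2_def intro!: transformable_add transformable_scaleC transformable_half_exp)
qed

lemma cinner_fourier0:
  assumes u: "u \<in> span exp_family" and v: "v \<in> span exp_family"
  shows "cinner (fourier0 u) (fourier0 v) = cinner u v"
proof -
  have f0: "fourier0 0 = 0"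
    using transformable_scaleC(2)[OF transformable_half_exp(1), of 1 1 0] by simp
  have lin: "fourier0 (r *\<^sub>R x + y) = r *\<^sub>R fourier0 x + fourier0 y"
    if "x \<in> exp_family" "y \<in> span exp_family" for r x y
    using that by (simp add: transformable_add transformable_scaleC transformable_span span_base scaleR_L2_def)
  have basis: "cinner (fourier0 x) (fourier0 y) = cinner x y" if xy: "x \<in> exp_family" "y \<in> exp_family" for x y
  proof -
    obtain c s n where x: "x = scaleC c (L2_class (half_exp s (of_nat n)))" "\<bar>s\<bar> = 1" "0 < n"
      using xy(1) by (auto simp: exp_family_def)
    obtain d t m where y: "y = scaleC d (L2_class (half_exp t (of_nat m)))" "\<bar>t\<bar> = 1" "0 < m"
      using xy(2) by (auto simp: exp_family_def)
    show ?thesis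
      unfolding x y using x(2,3) y(2,3)
      by (simp add: transformable_scaleC transformable_half_exp cinner_scaleC_left cinner_scaleC_right
          cinner_half_exp cinner_fourier_integral_half_exp del: of_nat_add)
  qed
  \<comment> \<open>Membership in the span is carried through the induction because
    \<open>lin\<close> asks for it.\<close>
  have half: "v \<in> span exp_family \<and> cinner (fourier0 x) (fourier0 v) = cinner x v" if "x \<in> exp_family" for x
    using v
  proof (induction rule: span_induct_alt)
    case base
    show ?case by (simp add: f0 span_zero)
  next
    case (step r z y)
    then show ?case using that
      by (simp add: lin cinner_add_right cinner_scaleR basis span_add span_base span_scale)
  qed
  have "u \<in> span exp_family \<and> cinner (fourier0 u) (fourier0 v) = cinner u v"
    using u
  proof (induction rule: span_induct_alt)
    case base
    show ?case by (simp add: f0 span_zero)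
  next
    case (step r z y)
    then show ?case
      by (simp add: lin cinner_add_left cinner_scaleR half span_add span_base span_scale)
  qed
  then show ?thesis by simp
qed

lemma fourier_extension:
  obtains T where "continuous_on UNIV T" "\<And>u. u \<in> span exp_family \<Longrightarrow> T u = fourier0 u"
proof -
  have dist: "dist (fourier0 u) (fourier0 v) = dist u v"
    if "u \<in> span exp_family" "v \<in> span exp_family" for u v
  proof -
    have "u - v \<in> span exp_family" by (intro span_diff that)
    have "fourier0 (u - v + v) = fourier0 (u - v) + fourier0 v"
      by (intro transformable_add transformable_span that span_diff)
    then have "fourier0 u - fourier0 v = fourier0 (u - v)" by simp
    then show ?thesis
      using cinner_fourier0[OF \<open>u - v \<in> _\<close> \<open>u - v \<in> _\<close>]
      by (simp add: dist_norm norm_L2_eq_cinner)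
  qed
  have "uniformly_continuous_on (span exp_family) fourier0"
    unfolding uniformly_continuous_on_def by (auto simp: dist)
  then obtain T where "uniformly_continuous_on exp_closure T"
    "\<And>u. u \<in> span exp_family \<Longrightarrow> fourier0 u = T u"
    by (rule uniformly_continuous_on_extension_on_closure) blast
  then show ?thesis
    by (intro that[of T]) (auto simp: exp_closure_UNIV intro: uniformly_continuous_imp_continuous)
qed

lemma cinner_L2_cnj_eq_integral:
  "cinner u (L2_cnj v) = (LINT x|lborel. L2_fun u x * L2_fun (v :: line L2) x)"
proof -
  have "cinner u (L2_cnj v) = cinner (L2_class (L2_fun u)) (L2_class (\<lambda>x. cnj (L2_fun v x)) :: line L2)"
    by (simp only: L2_cnj_def L2_class_L2_fun)
  also have "\<dots> = (LINT x|lborel. L2_fun u x * L2_fun v x)"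
    by (subst cinner_L2_class) (simp_all add: square_integrable_cnj square_integrable_L2_fun_line)
  finally show ?thesis .
qed

lemma fourier0_transpose:
  assumes "transformable u" "transformable v"
  shows "cinner (fourier0 u) (L2_cnj v) = cinner u (L2_cnj (fourier0 v))"
proof -
  have sq: "square_integrable lborel (fourier_integral (L2_fun u))"
      "square_integrable lborel (fourier_integral (L2_fun v))"
    and int: "integrable lborel (L2_fun u)" "integrable lborel (L2_fun v)"
    using assms by (auto simp: transformable_def)
  have [measurable]: "fourier_integral (L2_fun w) \<in> borel_measurable borel" for w :: "line L2"
    using fourier_integral_measurable[of "L2_fun w"] by simp
  have "cinner (fourier0 u) (L2_cnj v) = (LINT x|lborel. fourier_integral (L2_fun u) x * L2_fun v x)"
    unfolding cinner_L2_cnj_eq_integral fourier0_def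
    by (rule integral_cong_AE, measurable)
      (use L2_fun_L2_class_line[of "fourier_integral (L2_fun u)"] sq
        in \<open>auto elim!: eventually_mono\<close>)
  also have "\<dots> = (LINT x|lborel. L2_fun u x * fourier_integral (L2_fun v) x)"
    by (rule fourier_integral_multiplication[OF int])
  also have "\<dots> = cinner u (L2_cnj (fourier0 v))"
    unfolding cinner_L2_cnj_eq_integral fourier0_def
    by (rule integral_cong_AE, measurable)
      (use L2_fun_L2_class_line[of "fourier_integral (L2_fun v)"] sq
        in \<open>auto elim!: eventually_mono\<close>)
  finally show ?thesis .
qed

text \<open>Meant for functions \<open>h\<close> that are not known to lie in L2. The damped
  function h exp(-|x|) does, and it is orthogonal to the generators, because damping only raises
  their rate.\<close>

lemma orthogonal_half_exp_imp_AE_zero: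
  assumes [measurable]: "h \<in> borel_measurable borel"
    and sq: "\<And>s. \<bar>s\<bar> = 1 \<Longrightarrow> square_integrable lborel (\<lambda>x. h x * half_exp s 1 x)"
    and orth: "\<And>s n. \<bar>s\<bar> = 1 \<Longrightarrow> 0 < n \<Longrightarrow> (LINT x|lborel. h x * half_exp s (of_nat n) x) = 0"
  shows "AE x in lborel. h x = 0"
proof -
  define g where "g x = h x * half_exp 1 1 x + h x * half_exp (- 1) 1 x" for x
  have sqg: "square_integrable lborel g"
    unfolding g_def by (intro square_integrable_add sq) auto
  have "cinner (L2_class g) v = 0" for v :: "line L2"
  proof (induction v rule: exp_family_induct)
    case closed
    then show ?case by (intro closed_Collect_eq continuous_intros)
  next
    case (add u v) then show ?case by (simp add: cinner_add_right)
  next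
    case (scaleR r u) then show ?case by (simp add: scaleR_L2_def cinner_scaleC_right)
  next
    case (basis c s n)
    then have st: "s = 1 \<or> s = - 1" by (auto simp: abs_if split: if_splits)
    \<comment> \<open>The damping factor raises the rate from n to n + 1, which \<open>orth\<close>
      covers as well.\<close>
    have "g x * half_exp s (of_nat n) x = h x * half_exp s (of_nat (Suc n)) x" for x
    proof -
      have "half_exp (- s) 1 x * half_exp s (of_nat n) x = 0"
        by (auto simp: half_exp_def)
      moreover have "g x = h x * half_exp s 1 x + h x * half_exp (- s) 1 x"
        using st by (auto simp: g_def)
      ultimately show ?thesis
        by (simp add: distrib_right mult.assoc half_exp_mult)
    qed
    then have "cinner (L2_class g) (L2_class (half_exp s (of_nat n)) :: line L2) = 0"
      using orth[of s "Suc n"] basis sqg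
      by (subst cinner_L2_class) (simp_all add: square_integrable_half_exp cnj_half_exp del: of_nat_Suc)
    then show ?case by (simp add: cinner_scaleC_right)
  qed
  then have "L2_class g = (0 :: line L2)" by (simp flip: cinner_self_eq_0_iff)
  then have "AE x in lborel. g x = 0"
    using L2_class_eq_iff_line[of g "\<lambda>x. 0"] sqg
    by (simp add: zero_L2_def square_integrable_zero)
  moreover have "AE x in lborel. x \<noteq> (0 :: real)" by (rule AE_lborel_singleton)
  ultimately show ?thesis
    by eventually_elim (auto simp: g_def half_exp_def split: if_splits)
qed

lemma fourier_extension_inverse:
  assumes cont: "continuous_on UNIV T" and T0: "\<And>u. u \<in> span exp_family \<Longrightarrow> T u = fourier0 u"
    and iso: "\<And>u v. cinner (T u) (T v) = cinner u v"
  shows fourier_extension_transpose: "cinner (T u) (L2_cnj v) = cinner u (L2_cnj (T v))"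
    and fourier_extension_left_inverse: "L2_cnj (T (L2_cnj (T v))) = v"
proof -
  have cT [continuous_intros]: "continuous_on UNIV f \<Longrightarrow> continuous_on UNIV (\<lambda>u. T (f u))" for f :: "line L2 \<Rightarrow> line L2"
    using continuous_on_compose2[OF cont] by auto
  have ccnj [continuous_intros]: "continuous_on UNIV f \<Longrightarrow> continuous_on UNIV (\<lambda>u. L2_cnj (f u))"
    for f :: "line L2 \<Rightarrow> line L2"
    by (rule bounded_linear.continuous_on[OF bounded_linear_L2_cnj])
  note [continuous_intros] = continuous_on_id continuous_on_const
  note closed = closed_Collect_eq
  have transpose: "cinner (T u) (L2_cnj v) = cinner u (L2_cnj (T v))" for u v
  proof (rule dense_closed_all[of "\<lambda>u. cinner (T u) (L2_cnj v) = cinner u (L2_cnj (T v))"])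
    show "closed {u. cinner (T u) (L2_cnj v) = cinner u (L2_cnj (T v))}" by (intro closed continuous_intros)
    fix u assume u: "u \<in> span exp_family"
    show "cinner (T u) (L2_cnj v) = cinner u (L2_cnj (T v))"
    proof (rule dense_closed_all[of "\<lambda>v. cinner (T u) (L2_cnj v) = cinner u (L2_cnj (T v))"])
      show "closed {v. cinner (T u) (L2_cnj v) = cinner u (L2_cnj (T v))}" by (intro closed continuous_intros)
    qed (use u in \<open>simp add: T0 fourier0_transpose transformable_span\<close>)
  qed
  text \<open>The transpose of \<open>T\<close> is \<open>T\<close>, so the adjoint is \<open>L2_cnj \<circ> T \<circ> L2_cnj\<close>, and
    an isometry with \<open>T\<^sup>* T = 1\<close> of this form also satisfies \<open>T T\<^sup>* = 1\<close>.\<close>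
  show "L2_cnj (T (L2_cnj (T v))) = v" for v
  proof -
    let ?w = "L2_cnj (T (L2_cnj (T v)))"
    have "cinner u ?w = cinner u v" for u
      using transpose[of u "L2_cnj (T v)"] iso[of u v] by simp
    then have "cinner (?w - v) (?w - v) = 0" by (simp add: cinner_diff_right)
    then show ?thesis by (simp add: cinner_self_eq_0_iff)
  qed
  show "cinner (T u) (L2_cnj v) = cinner u (L2_cnj (T v))" by (rule transpose)
qed

section \<open>Existence and uniqueness of the Fourier transformation\<close>

definition is_fourier :: "(line L2 \<Rightarrow> line L2) \<Rightarrow> bool" where
  "is_fourier T \<longleftrightarrow> unitary_op T \<and> (\<forall>u. integrable lborel (L2_fun u) \<longrightarrow>
     (AE x in lborel. L2_fun (T u) x = fourier_integral (L2_fun u) x))"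

lemma is_fourier_fourier0:
  assumes "is_fourier T" "transformable u"
  shows "T u = fourier0 u"
proof -
  have "AE x in lborel. L2_fun (T u) x = fourier_integral (L2_fun u) x"
    using assms by (auto simp: is_fourier_def transformable_def)
  then have "L2_class (L2_fun (T u)) = fourier0 u"
    unfolding fourier0_def using assms(2)
    by (simp add: L2_class_eq_iff_line transformable_def square_integrable_L2_fun_line)
  then show ?thesis by (simp add: L2_class_L2_fun)
qed

lemma is_fourier_unique:
  assumes "is_fourier S" "is_fourier T" shows "S = T"
proof
  fix u
  have "bounded_linear S" "bounded_linear T"
    using assms unitary_opD(7) by (auto simp: is_fourier_def)
  then have cont: "continuous_on UNIV S" "continuous_on UNIV T"
    by (auto intro: linear_continuous_on)
  show "S u = T u"
    by (rule dense_closed_all[of "\<lambda>u. S u = T u"])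
      (use assms in \<open>auto simp: is_fourier_fourier0 transformable_span intro: closed_Collect_eq cont\<close>)
qed

text \<open>The extension inherits its algebra from the span by density. What density does not give
  at once is the integral formula for an arbitrary integrable \<open>u\<close>; it is verified
  weakly, by testing against exponentials.\<close>

lemma is_fourier_exists: "\<exists>T. is_fourier T"
proof -
  obtain T where cont: "continuous_on UNIV T" and T0: "\<And>u. u \<in> span exp_family \<Longrightarrow> T u = fourier0 u"
    using fourier_extension by blast
  have cT [continuous_intros]: "continuous_on UNIV f \<Longrightarrow> continuous_on UNIV (\<lambda>u. T (f u))" for f :: "line L2 \<Rightarrow> line L2"
    using continuous_on_compose2[OF cont] by auto
  note [continuous_intros] = continuous_on_id continuous_on_const
  note closed = closed_Collect_eq
  have add: "T (u + v) = T u + T v" for u v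
  proof (rule dense_closed_all[of "\<lambda>u. T (u + v) = T u + T v"])
    show "closed {u. T (u + v) = T u + T v}" by (intro closed continuous_intros)
    fix u assume u: "u \<in> span exp_family"
    show "T (u + v) = T u + T v"
    proof (rule dense_closed_all[of "\<lambda>v. T (u + v) = T u + T v"])
      show "closed {v. T (u + v) = T u + T v}" by (intro closed continuous_intros)
    qed (use u in \<open>simp add: T0 span_add transformable_add transformable_span\<close>)
  qed
  have sc: "T (scaleC c u) = scaleC c (T u)" for c u
  proof (rule dense_closed_all[of "\<lambda>u. T (scaleC c u) = scaleC c (T u)"])
    show "closed {u. T (scaleC c u) = scaleC c (T u)}" by (intro closed continuous_intros)
  qed (simp add: T0 scaleC_span_exp_family transformable_scaleC transformable_span)
  have iso: "cinner (T u) (T v) = cinner u v" for u v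
  proof (rule dense_closed_all[of "\<lambda>u. cinner (T u) (T v) = cinner u v"])
    show "closed {u. cinner (T u) (T v) = cinner u v}" by (intro closed continuous_intros)
    fix u assume u: "u \<in> span exp_family"
    show "cinner (T u) (T v) = cinner u v"
    proof (rule dense_closed_all[of "\<lambda>v. cinner (T u) (T v) = cinner u v"])
      show "closed {v. cinner (T u) (T v) = cinner u v}" by (intro closed continuous_intros)
    qed (use u in \<open>simp add: T0 cinner_fourier0\<close>)
  qed
  note transpose = fourier_extension_transpose[OF cont T0 iso]
  note left_inv = fourier_extension_left_inverse[OF cont T0 iso]
  have "T (L2_cnj (T (L2_cnj v))) = v" for v
    using arg_cong[OF left_inv[of "L2_cnj v"], of L2_cnj] by simp
  then have "surj T" by (rule surjI)
  moreover have "inj T" by (rule inj_on_inverseI[where g = "\<lambda>v. L2_cnj (T (L2_cnj v))"]) (rule left_inv)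
  ultimately have unitary: "unitary_op T"
    unfolding unitary_op_def bij_def using add sc iso by blast
  have "AE x in lborel. L2_fun (T u) x = fourier_integral (L2_fun u) x"
    if int: "integrable lborel (L2_fun u)" for u
  proof -
    \<comment> \<open>The Fourier integral of \<open>u\<close> is so far only known to be bounded,
      so \<open>h\<close> need not be square integrable. Hence the damped test in
      \<open>orthogonal_half_exp_imp_AE_zero\<close>.\<close>
    define h where "h x = L2_fun (T u) x - fourier_integral (L2_fun u) x" for x
    have [measurable]: "fourier_integral (L2_fun u) \<in> borel_measurable borel"
      using fourier_integral_measurable[of "L2_fun u"] by simp
    have [measurable]: "h \<in> borel_measurable borel" unfolding h_def by measurable
    obtain B where B: "\<And>x. norm (fourier_integral (L2_fun u) x) \<le> B"
      using norm_fourier_integral_le by blast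
    have B0: "0 \<le> B" by (rule order_trans[OF norm_ge_zero B])
    have sqT: "square_integrable lborel (L2_fun (T u))" using square_integrable_L2_fun[of "T u"] by simp
    have "AE x in lborel. h x = 0"
    proof (rule orthogonal_half_exp_imp_AE_zero)
      fix s :: real assume s: "\<bar>s\<bar> = 1"
      have "square_integrable lborel (\<lambda>x. L2_fun (T u) x * half_exp s 1 x)"
        by (rule square_integrable_bound[OF sqT])
          (auto simp: norm_mult norm_half_exp_le_1 mult_left_le)
      moreover have "square_integrable lborel (\<lambda>x. of_real B * half_exp s 1 x)"
        using s by (intro square_integrable_cmult square_integrable_half_exp) auto
      then have "square_integrable lborel (\<lambda>x. fourier_integral (L2_fun u) x * half_exp s 1 x)"
        by (rule square_integrable_bound)
          (use B B0 in \<open>auto simp: norm_mult intro!: mult_right_mono\<close>)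
      ultimately show "square_integrable lborel (\<lambda>x. h x * half_exp s 1 x)"
        unfolding h_def left_diff_distrib by (rule square_integrable_diff)
      fix n :: nat assume n: "0 < n"
      let ?e = "L2_class (half_exp s (of_nat n)) :: line L2"
      have sqe: "square_integrable lborel (half_exp s (of_nat n))" "integrable lborel (half_exp s (of_nat n))"
        using s n by (auto intro!: square_integrable_half_exp half_exp_integral)
      have AEe: "AE x in lborel. L2_fun ?e x = half_exp s (of_nat n) x"
        by (rule L2_fun_L2_class_line[OF sqe(1)])
      have Te: "T ?e = L2_class (fourier_integral (half_exp s (of_nat n)))"
        using T0[of ?e] transformable_half_exp(2)[OF s n] exp_familyI[OF s n, of 1]
        by (simp add: span_base)
      have sqfe: "square_integrable lborel (fourier_integral (half_exp s (of_nat n)))"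
        by (rule square_integrable_fourier_integral_half_exp[OF s n])
      have [measurable]: "fourier_integral (half_exp s (of_nat n)) \<in> borel_measurable borel"
        using sqfe by (simp add: square_integrable_def)
      \<comment> \<open>Both pairings reduce to \<open>u\<close> against the transform of the
        exponential: one by Fubini, the other by the transpose identity for
        \<open>T\<close>.\<close>
      have "(LINT x|lborel. fourier_integral (L2_fun u) x * half_exp s (of_nat n) x) =
          (LINT x|lborel. L2_fun u x * fourier_integral (half_exp s (of_nat n)) x)"
        by (rule fourier_integral_multiplication[OF int sqe(2)])
      also have "\<dots> = (LINT x|lborel. L2_fun u x * L2_fun (T ?e) x)"
        by (rule integral_cong_AE, measurable)
          (use L2_fun_L2_class_line[of "fourier_integral (half_exp s (of_nat n))"] sqfe Te
            in \<open>auto elim!: eventually_mono\<close>)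
      also have "\<dots> = (LINT x|lborel. L2_fun (T u) x * L2_fun ?e x)"
        using transpose[of u ?e] by (simp add: cinner_L2_cnj_eq_integral)
      also have "\<dots> = (LINT x|lborel. L2_fun (T u) x * half_exp s (of_nat n) x)"
        by (rule integral_cong_AE, measurable) (use AEe in \<open>auto elim!: eventually_mono\<close>)
      finally have eq: "(LINT x|lborel. fourier_integral (L2_fun u) x * half_exp s (of_nat n) x) =
        (LINT x|lborel. L2_fun (T u) x * half_exp s (of_nat n) x)" .
      have "integrable lborel (\<lambda>x. L2_fun (T u) x * half_exp s (of_nat n) x)"
        using integrable_square_integrable_mult[OF sqT sqe(1)] by (simp add: cnj_half_exp)
      moreover have "integrable lborel (\<lambda>x. fourier_integral (L2_fun u) x * half_exp s (of_nat n) x)"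
      proof (rule Bochner_Integration.integrable_bound)
        show "integrable lborel (\<lambda>x. of_real B * half_exp s (of_nat n) x)" using sqe by simp
        show "AE x in lborel. norm (fourier_integral (L2_fun u) x * half_exp s (of_nat n) x) \<le>
            norm (of_real B * half_exp s (of_nat n) x)"
          using B B0 by (auto simp: norm_mult intro!: mult_right_mono)
      qed measurable
      ultimately show "(LINT x|lborel. h x * half_exp s (of_nat n) x) = 0"
        unfolding h_def left_diff_distrib by (simp add: eq)
    qed measurable
    then show ?thesis by (simp add: h_def)
  qed
  with unitary show ?thesis unfolding is_fourier_def by blast
qed

lemma is_fourier_fourier: "is_fourier fourier"
proof -
  have "\<exists>!T. is_fourier T" using is_fourier_exists is_fourier_unique by blast
  moreover have "fourier = (THE T. is_fourier T)"
    unfolding fourier_def is_fourier_def fourier_integral_def ..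
  ultimately show ?thesis by (metis theI')
qed

lemma unitary_fourier: "unitary_op fourier"
  using is_fourier_fourier by (simp add: is_fourier_def)

lemma fourier_L1:
  "integrable lborel (L2_fun u) \<Longrightarrow> AE x in lborel. L2_fun (fourier u) x = fourier_integral (L2_fun u) x"
  using is_fourier_fourier by (simp add: is_fourier_def)

lemma continuous_on_unitary_op:
  "unitary_op T \<Longrightarrow> continuous_on S f \<Longrightarrow> continuous_on S (\<lambda>x. T (f x))"
  by (rule bounded_linear.continuous_on[OF unitary_opD(7)])

text \<open>\<open>fourier\<close> itself meets the hypotheses on \<open>T\<close> in
  \<open>fourier_extension_left_inverse\<close>. In terms of kernels, conjugation replaces exp(-ixy)
  by exp(ixy).\<close>

lemma inv_fourier: "inv fourier u = L2_cnj (fourier (L2_cnj u))"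
proof (rule inv_f_eq)
  show "inj fourier" using unitary_opD(3)[OF unitary_fourier] by (rule bij_is_inj)
  have "continuous_on UNIV fourier" by (intro continuous_on_unitary_op[OF unitary_fourier] continuous_on_id)
  then have "L2_cnj (fourier (L2_cnj (fourier (L2_cnj u)))) = L2_cnj u"
    by (rule fourier_extension_left_inverse)
      (auto simp: is_fourier_fourier0 is_fourier_fourier transformable_span unitary_opD(4)[OF unitary_fourier])
  then show "fourier (L2_cnj (fourier (L2_cnj u))) = u" by (metis L2_cnj_cnj)
qed

section \<open>The representation of \<open>SL(2,\<real>)\<close>\<close>

lemma SL2_det: "A \<in> SL2 \<Longrightarrow> A $ 1 $ 1 * A $ 2 $ 2 - A $ 1 $ 2 * A $ 2 $ 1 = 1"
  by (simp add: SL2_def det_2)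

lemma matrix_mult_2:
  fixes A B :: "real^2^2"
  shows "(A ** B) $ i $ j = A $ i $ 1 * B $ 1 $ j + A $ i $ 2 * B $ 2 $ j"
  by (simp add: matrix_matrix_mult_def sum_2)

lemma matrix_eq_2_iff:
  fixes A B :: "real^2^2"
  shows "A = B \<longleftrightarrow> A $ 1 $ 1 = B $ 1 $ 1 \<and> A $ 1 $ 2 = B $ 1 $ 2 \<and> A $ 2 $ 1 = B $ 2 $ 1 \<and> A $ 2 $ 2 = B $ 2 $ 2"
  by (auto simp: vec_eq_iff forall_2)

lemma mat_1_2: "(mat 1 :: real^2^2) $ 1 $ 1 = 1" "(mat 1 :: real^2^2) $ 1 $ 2 = 0"
  "(mat 1 :: real^2^2) $ 2 $ 1 = 0" "(mat 1 :: real^2^2) $ 2 $ 2 = 1"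
  by (simp_all add: mat_def)

lemma SL2_matrix_inv_eq:
  assumes A: "A \<in> SL2"
  shows "matrix_inv A = vector [vector [A $ 2 $ 2, - (A $ 1 $ 2)], vector [- (A $ 2 $ 1), A $ 1 $ 1]]"
    (is "_ = ?B")
proof -
  have B: "A ** ?B = mat 1" "?B ** A = mat 1"
    using SL2_det[OF A] by (simp_all add: matrix_eq_2_iff matrix_mult_2 mat_1_2 algebra_simps)
  \<comment> \<open>\<open>matrix_inv\<close> is a choice among inverses. The explicit matrix shows
    that the choice succeeds, and uniqueness of inverses then identifies the two.\<close>
  then have inv: "A ** matrix_inv A = mat 1 \<and> matrix_inv A ** A = mat 1"
    unfolding matrix_inv_def
    by (intro someI[where P = "\<lambda>A'. A ** A' = mat 1 \<and> A' ** A = mat 1"] conjI)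
  then have "matrix_inv A = (?B ** A) ** matrix_inv A" by (simp add: B)
  also have "\<dots> = ?B" using inv by (simp flip: matrix_mul_assoc)
  finally show ?thesis .
qed

lemma SL2_matrix_inv_nth:
  assumes "A \<in> SL2"
  shows "matrix_inv A $ 1 $ 1 = A $ 2 $ 2" "matrix_inv A $ 1 $ 2 = - (A $ 1 $ 2)"
    "matrix_inv A $ 2 $ 1 = - (A $ 2 $ 1)" "matrix_inv A $ 2 $ 2 = A $ 1 $ 1"
  by (simp_all add: SL2_matrix_inv_eq[OF assms])

lemma SL2_matrix_inv: "A \<in> SL2 \<Longrightarrow> matrix_inv A \<in> SL2"
  using SL2_det[of A] by (simp add: SL2_def det_2 SL2_matrix_inv_nth mult.commute)

lemma SL2_mult: "A \<in> SL2 \<Longrightarrow> B \<in> SL2 \<Longrightarrow> A ** B \<in> SL2"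
  by (simp add: SL2_def det_mul)

lemma SL2_one: "mat 1 \<in> SL2"
  by (simp add: SL2_def)

lemma SL2_inverse:
  assumes "A \<in> SL2" shows "A ** matrix_inv A = mat 1" "matrix_inv A ** A = mat 1"
  using SL2_det[OF assms]
  by (simp_all add: matrix_eq_2_iff matrix_mult_2 mat_1_2 SL2_matrix_inv_nth[OF assms] algebra_simps)

text \<open>The denominator of A^-1.x. The derivative of that map is 1 / denom^2, so the weight in
  \<open>F_rep\<close> is a square root, with sign, of the Jacobian.\<close>

abbreviation denom :: "real^2^2 \<Rightarrow> real \<Rightarrow> real" where
  "denom A x \<equiv> - (A $ 2 $ 1) * x + A $ 1 $ 1"

lemma SL2_moebius_inv:
  "A \<in> SL2 \<Longrightarrow> moebius (matrix_inv A) x = (A $ 2 $ 2 * x - A $ 1 $ 2) / denom A x"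
  by (simp add: moebius_def SL2_matrix_inv_nth)

lemma AE_denom_nonzero:
  assumes A: "A \<in> SL2" shows "AE x in lborel. denom A x \<noteq> 0"
proof (cases "A $ 2 $ 1 = 0")
  case True
  then show ?thesis using SL2_det[OF A] by auto
next
  case False
  have "AE x in lborel. x \<noteq> A $ 1 $ 1 / A $ 2 $ 1" by (rule AE_lborel_singleton)
  then show ?thesis by eventually_elim (use False in \<open>auto simp: field_simps\<close>)
qed

section \<open>Change of variables under Moebius maps\<close>

lemma moebius_measurable [measurable]: "moebius A \<in> borel_measurable borel"
  unfolding moebius_def[abs_def] by measurable

lemma SL2_moebius_inv_image:
  assumes A: "A \<in> SL2" and y: "A $ 2 $ 1 * y + A $ 2 $ 2 \<noteq> 0"
  shows "denom A (moebius A y) \<noteq> 0" "moebius (matrix_inv A) (moebius A y) = y"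
proof -
  let ?q = "A $ 2 $ 1 * y + A $ 2 $ 2"
  have "denom A (moebius A y) * ?q = A $ 1 $ 1 * A $ 2 $ 2 - A $ 1 $ 2 * A $ 2 $ 1"
    using y by (simp add: moebius_def field_simps)
  then have 1: "denom A (moebius A y) * ?q = 1" using SL2_det[OF A] by simp
  then show nz: "denom A (moebius A y) \<noteq> 0" by (metis mult_zero_left zero_neq_one)
  have "(A $ 2 $ 2 * moebius A y - A $ 1 $ 2) * ?q = (A $ 1 $ 1 * A $ 2 $ 2 - A $ 1 $ 2 * A $ 2 $ 1) * y"
    using y by (simp add: moebius_def field_simps)
  also have "\<dots> = y * denom A (moebius A y) * ?q" using SL2_det[OF A] 1 by simp
  finally have "A $ 2 $ 2 * moebius A y - A $ 1 $ 2 = y * denom A (moebius A y)" using y by simp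
  then show "moebius (matrix_inv A) (moebius A y) = y"
    using nz by (simp add: SL2_moebius_inv[OF A])
qed

text \<open>Checked on intervals: off the zero of \<open>denom A\<close> the map A^-1 is injective
  with derivative 1 / denom^2, and its image has full measure. Stating it for measures makes null
  sets, integrability and integrals transform by general facts on \<open>distr\<close> and
  \<open>density\<close>.\<close>

lemma lborel_moebius_invariance:
  assumes A: "A \<in> SL2"
  shows "distr (density lborel (\<lambda>x. ennreal (1 / (denom A x)\<^sup>2))) borel (moebius (matrix_inv A)) = lborel"
proof (rule lborel_eqI[symmetric])
  let ?g = "moebius (matrix_inv A)" and ?S = "{x. denom A x \<noteq> 0}"
  have meas [measurable]: "?g \<in> borel_measurable borel" by measurable
  fix l u :: real assume "\<And>b. b \<in> Basis \<Longrightarrow> l \<bullet> b \<le> u \<bullet> b"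
  then have lu: "l \<le> u" by simp
  let ?f = "indicator {l<..<u} :: real \<Rightarrow> real"
  have S: "?S \<in> sets borel" by measurable
  have dg: "(?g has_field_derivative 1 / (denom A x)\<^sup>2) (at x within ?S)" if "x \<in> ?S" for x
  proof -
    have nz: "denom A x \<noteq> 0" using that by simp
    have "((\<lambda>x. (A $ 2 $ 2 * x - A $ 1 $ 2) / denom A x) has_field_derivative
        (A $ 2 $ 2 * denom A x - (A $ 2 $ 2 * x - A $ 1 $ 2) * (- (A $ 2 $ 1))) / (denom A x * denom A x))
        (at x within ?S)"
      using nz by (auto intro!: derivative_eq_intros)
    moreover have "A $ 2 $ 2 * denom A x - (A $ 2 $ 2 * x - A $ 1 $ 2) * (- (A $ 2 $ 1)) = 1"
      using SL2_det[OF A] by (simp add: algebra_simps)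
    moreover have "?g = (\<lambda>x. (A $ 2 $ 2 * x - A $ 1 $ 2) / denom A x)"
      using SL2_moebius_inv[OF A] by (rule ext)
    ultimately show ?thesis by (simp only: power2_eq_square)
  qed
  have inj: "inj_on ?g ?S"
  proof (rule inj_on_inverseI[where g = "moebius A"])
    fix x assume x: "x \<in> ?S"
    have iA: "matrix_inv (matrix_inv A) = A"
      using SL2_matrix_inv_nth[OF A] SL2_matrix_inv_nth[OF SL2_matrix_inv[OF A]]
      by (simp add: matrix_eq_2_iff)
    show "moebius A (?g x) = x"
      using SL2_moebius_inv_image(2)[OF SL2_matrix_inv[OF A], of x] x
      by (simp add: iA SL2_matrix_inv_nth[OF A])
  qed
  \<comment> \<open>The only real number that can be missed is -d/c, the image of infinity; for c =
    0 nothing is missed.\<close>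
  have neg: "negligible (- (?g ` ?S))"
  proof (rule negligible_subset)
    show "- (?g ` ?S) \<subseteq> {- (A $ 2 $ 2) / A $ 2 $ 1}"
    proof
      fix y assume y: "y \<in> - (?g ` ?S)"
      have q: "A $ 2 $ 1 * y + A $ 2 $ 2 = 0"
      proof (rule ccontr)
        assume nz: "A $ 2 $ 1 * y + A $ 2 $ 2 \<noteq> 0"
        from SL2_moebius_inv_image[OF A nz] have "y \<in> ?g ` ?S"
          by (intro image_eqI[of _ _ "moebius A y"]) auto
        with y show False by simp
      qed
      then have "A $ 2 $ 1 \<noteq> 0" using SL2_det[OF A] by auto
      then show "y \<in> {- (A $ 2 $ 2) / A $ 2 $ 1}" using q by (simp add: field_simps)
    qed
  qed simp
  have fU: "(?f has_integral (u - l)) UNIV"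
    by (rule nn_integral_has_integral) (use lu in \<open>auto simp: ennreal_indicator\<close>)
  have fgS: "(?f has_integral (u - l)) (?g ` ?S)"
  proof -
    have "(?f has_integral (u - l)) UNIV \<longleftrightarrow> (?f has_integral (u - l)) (?g ` ?S)"
      by (rule has_integral_spike_set_eq) (auto intro: negligible_subset[OF neg])
    then show ?thesis using fU by simp
  qed
  then have "?f absolutely_integrable_on (?g ` ?S) \<and> integral (?g ` ?S) ?f = u - l"
    by (auto intro!: nonnegative_absolutely_integrable_1 simp: has_integral_iff)
  then have "(\<lambda>x. \<bar>1 / (denom A x)\<^sup>2\<bar> * ?f (?g x)) absolutely_integrable_on ?S \<and>
      integral ?S (\<lambda>x. \<bar>1 / (denom A x)\<^sup>2\<bar> * ?f (?g x)) = u - l"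
    using has_absolute_integral_change_of_variables_1'[OF _ dg inj, of ?f "u - l"] S by simp
  then have int: "((\<lambda>x. 1 / (denom A x)\<^sup>2 * ?f (?g x)) has_integral (u - l)) ?S"
    by (simp add: has_integral_iff set_lebesgue_integral_eq_integral)
  have "emeasure (distr (density lborel (\<lambda>x. ennreal (1 / (denom A x)\<^sup>2))) borel ?g) {l<..<u} =
      (\<integral>\<^sup>+x. ennreal (1 / (denom A x)\<^sup>2) * indicator (?g -` {l<..<u}) x \<partial>lborel)"
  proof -
    have "?g -` {l<..<u} \<in> sets borel" using measurable_sets[OF meas, of "{l<..<u}"] by simp
    then show ?thesis by (simp add: emeasure_distr emeasure_density)
  qed
  \<comment> \<open>Where \<open>denom A x\<close> is 0 the density is 1 / 0 = 0, so the integral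
    over the line is the one over \<open>?S\<close>.\<close>
  also have "\<dots> = (\<integral>\<^sup>+x. ennreal (indicator ?S x * (1 / (denom A x)\<^sup>2 * ?f (?g x))) \<partial>lborel)"
    by (intro nn_integral_cong) (auto split: split_indicator)
  also have "\<dots> = ennreal (u - l)"
    by (rule nn_integral_has_integral_lebesgue[OF _ int]) auto
  finally show "emeasure (distr (density lborel (\<lambda>x. ennreal (1 / (denom A x)\<^sup>2))) borel ?g) (box l u) =
      (\<Prod>b\<in>Basis. (u - l) \<bullet> b)"
    by (simp add: box_real)
qed simp

text \<open>Null sets pull back to null sets of the density measure, and the density is positive off
  the zero of \<open>denom A\<close>.\<close>

lemma AE_moebius_inv:
  assumes A: "A \<in> SL2" and P: "AE x in lborel. P x"
  shows "AE x in lborel. P (moebius (matrix_inv A) x)"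
proof -
  have "AE x in density lborel (\<lambda>x. ennreal (1 / (denom A x)\<^sup>2)). P (moebius (matrix_inv A) x)"
    by (rule AE_distrD[where M' = borel and f = "moebius (matrix_inv A)" and P = P])
      (simp, simp only: lborel_moebius_invariance[OF A] P)
  then have "AE x in lborel. 0 < ennreal (1 / (denom A x)\<^sup>2) \<longrightarrow> P (moebius (matrix_inv A) x)"
    by (subst (asm) AE_density) measurable
  then show ?thesis using AE_denom_nonzero[OF A] by eventually_elim auto
qed

lemma moebius_change_of_variables:
  fixes f :: "real \<Rightarrow> 'a::{banach, second_countable_topology}"
  assumes A: "A \<in> SL2" and [measurable]: "f \<in> borel_measurable borel"
  shows "integrable lborel (\<lambda>x. (1 / (denom A x)\<^sup>2) *\<^sub>R f (moebius (matrix_inv A) x)) \<longleftrightarrow> integrable lborel f"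
    and "(LINT x|lborel. (1 / (denom A x)\<^sup>2) *\<^sub>R f (moebius (matrix_inv A) x)) = (LINT x|lborel. f x)"
proof -
  let ?g = "moebius (matrix_inv A)"
  let ?D = "density lborel (\<lambda>x. ennreal (1 / (denom A x)\<^sup>2))"
  have [measurable]: "?g \<in> measurable ?D borel" by measurable
  have "integrable lborel f \<longleftrightarrow> integrable (distr ?D borel ?g) f"
    by (simp only: lborel_moebius_invariance[OF A])
  also have "\<dots> \<longleftrightarrow> integrable ?D (\<lambda>x. f (?g x))"
    by (rule integrable_distr_eq) measurable
  also have "\<dots> \<longleftrightarrow> integrable lborel (\<lambda>x. (1 / (denom A x)\<^sup>2) *\<^sub>R f (?g x))"
    by (rule integrable_density) auto
  finally show "integrable lborel (\<lambda>x. (1 / (denom A x)\<^sup>2) *\<^sub>R f (?g x)) \<longleftrightarrow> integrable lborel f" by simp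
  have "(LINT x|lborel. f x) = (LINT x|distr ?D borel ?g. f x)"
    by (simp only: lborel_moebius_invariance[OF A])
  also have "\<dots> = (LINT x|?D. f (?g x))"
    by (rule integral_distr) measurable
  also have "\<dots> = (LINT x|lborel. (1 / (denom A x)\<^sup>2) *\<^sub>R f (?g x))"
    by (rule integral_density) auto
  finally show "(LINT x|lborel. (1 / (denom A x)\<^sup>2) *\<^sub>R f (?g x)) = (LINT x|lborel. f x)" by simp
qed

section \<open>The operators \<open>F_rep A\<close>\<close>

definition F_fun :: "real^2^2 \<Rightarrow> (real \<Rightarrow> complex) \<Rightarrow> real \<Rightarrow> complex" where
  "F_fun A f x = complex_of_real (1 / denom A x) * f (moebius (matrix_inv A) x)"

lemma F_rep_eq: "F_rep A u = L2_class (F_fun A (L2_fun u))"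
  unfolding F_rep_def F_fun_def ..

lemma F_fun_measurable [measurable]:
  assumes [measurable]: "f \<in> borel_measurable borel"
  shows "F_fun A f \<in> borel_measurable borel"
  unfolding F_fun_def[abs_def] by measurable

lemma square_integrable_F_fun:
  assumes A: "A \<in> SL2" and f: "square_integrable lborel f"
  shows "square_integrable lborel (F_fun A f)"
proof -
  have [measurable]: "f \<in> borel_measurable borel" using f by (simp add: square_integrable_def)
  have eq: "(norm (F_fun A f x))\<^sup>2 = (1 / (denom A x)\<^sup>2) *\<^sub>R (norm (f (moebius (matrix_inv A) x)))\<^sup>2" for x
    unfolding F_fun_def norm_mult norm_of_real power_mult_distrib power2_abs by (simp add: power_divide)
  show ?thesis
    using f moebius_change_of_variables(1)[OF A, of "\<lambda>x. (norm (f x))\<^sup>2"]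
    by (simp only: square_integrable_def eq) simp
qed

lemma F_fun_cong_AE:
  assumes A: "A \<in> SL2" and "AE x in lborel. f x = g x"
  shows "AE x in lborel. F_fun A f x = F_fun A g x"
  using AE_moebius_inv[OF assms] by eventually_elim (simp add: F_fun_def)

lemma F_rep_L2_class:
  assumes A: "A \<in> SL2" and f: "square_integrable lborel f"
  shows "F_rep A (L2_class f) = L2_class (F_fun A f)"
  unfolding F_rep_eq
  using F_fun_cong_AE[OF A L2_fun_L2_class_line[OF f]]
  by (simp add: L2_class_eq_iff_line square_integrable_F_fun A f square_integrable_L2_fun_line)

lemma F_rep_add: "A \<in> SL2 \<Longrightarrow> F_rep A (u + v) = F_rep A u + F_rep A v"
proof -
  assume A: "A \<in> SL2"
  have "F_rep A (u + v) = F_rep A (L2_class (\<lambda>x. L2_fun u x + L2_fun v x))"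
    by (simp add: plus_L2_def)
  also have "\<dots> = L2_class (\<lambda>x. F_fun A (L2_fun u) x + F_fun A (L2_fun v) x)"
    by (subst F_rep_L2_class[OF A])
      (intro square_integrable_add square_integrable_L2_fun_line, simp only: F_fun_def[abs_def] distrib_left)
  also have "\<dots> = F_rep A u + F_rep A v"
    unfolding F_rep_eq by (intro L2_class_add) (simp_all add: square_integrable_F_fun[OF A] square_integrable_L2_fun_line)
  finally show ?thesis .
qed

lemma F_rep_scaleC: "A \<in> SL2 \<Longrightarrow> F_rep A (scaleC c u) = scaleC c (F_rep A u)"
proof -
  assume A: "A \<in> SL2"
  have "F_rep A (scaleC c u) = F_rep A (L2_class (\<lambda>x. c * L2_fun u x))"
    by (simp add: scaleC_def)
  also have "\<dots> = L2_class (\<lambda>x. c * F_fun A (L2_fun u) x)"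
    by (subst F_rep_L2_class[OF A])
      (intro square_integrable_cmult square_integrable_L2_fun_line, simp only: F_fun_def[abs_def] mult.left_commute)
  also have "\<dots> = scaleC c (F_rep A u)"
    unfolding F_rep_eq
    by (intro scaleC_L2_class[symmetric]) (simp_all add: square_integrable_F_fun[OF A] square_integrable_L2_fun_line)
  finally show ?thesis .
qed

lemma cinner_F_rep:
  assumes A: "A \<in> SL2" shows "cinner (F_rep A u) (F_rep A v) = cinner u v"
proof -
  have "cinner (F_rep A u) (F_rep A v) =
      (LINT x|lborel. F_fun A (L2_fun u) x * cnj (F_fun A (L2_fun v) x))"
    unfolding F_rep_eq
    by (subst cinner_L2_class) (simp_all add: square_integrable_F_fun[OF A] square_integrable_L2_fun_line)
  also have "(\<lambda>x. F_fun A (L2_fun u) x * cnj (F_fun A (L2_fun v) x)) =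
      (\<lambda>x. (1 / (denom A x)\<^sup>2) *\<^sub>R (\<lambda>y. L2_fun u y * cnj (L2_fun v y)) (moebius (matrix_inv A) x))"
    by (rule ext) (simp add: F_fun_def scaleR_conv_of_real power2_eq_square)
  also have "(LINT x|lborel. (1 / (denom A x)\<^sup>2) *\<^sub>R (\<lambda>y. L2_fun u y * cnj (L2_fun v y)) (moebius (matrix_inv A) x)) =
      (LINT y|lborel. L2_fun u y * cnj (L2_fun v y))"
    by (rule moebius_change_of_variables(2)[OF A]) measurable
  finally show ?thesis by (simp add: cinner_def)
qed

lemma F_rep_one: "F_rep (mat 1) u = u"
proof -
  have "F_fun (mat 1) (L2_fun u) = L2_fun u"
    by (rule ext) (simp add: F_fun_def SL2_moebius_inv[OF SL2_one] mat_1_2)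
  then show ?thesis by (simp add: F_rep_eq L2_class_L2_fun)
qed

text \<open>The weights satisfy the cocycle identity denom (AB) x = denom A x * denom B (A^-1.x)
  wherever A^-1.x is defined. The points where a denominator vanishes form a null set.\<close>

lemma F_rep_mult:
  assumes A: "A \<in> SL2" and B: "B \<in> SL2"
  shows "F_rep (A ** B) u = F_rep A (F_rep B u)"
proof -
  note AB = SL2_mult[OF A B]
  have "F_rep A (F_rep B u) = L2_class (F_fun A (F_fun B (L2_fun u)))"
    unfolding F_rep_eq[of B] by (intro F_rep_L2_class A square_integrable_F_fun B square_integrable_L2_fun_line)
  moreover have "AE x in lborel. F_fun (A ** B) (L2_fun u) x = F_fun A (F_fun B (L2_fun u)) x"
    using AE_denom_nonzero[OF A] AE_moebius_inv[OF A AE_denom_nonzero[OF B]]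
  proof eventually_elim
    case (elim x)
    define y where "y = moebius (matrix_inv A) x"
    have y: "y * denom A x = A $ 2 $ 2 * x - A $ 1 $ 2"
      using elim by (simp add: y_def SL2_moebius_inv[OF A])
    have "denom (A ** B) x = B $ 1 $ 1 * denom A x - B $ 2 $ 1 * (A $ 2 $ 2 * x - A $ 1 $ 2)"
      by (simp add: matrix_mult_2 algebra_simps)
    also have "\<dots> = denom A x * denom B y"
      unfolding y[symmetric] by (simp add: algebra_simps)
    finally have den: "denom (A ** B) x = denom A x * denom B y" .
    have "(A ** B) $ 2 $ 2 * x - (A ** B) $ 1 $ 2 =
        B $ 2 $ 2 * (A $ 2 $ 2 * x - A $ 1 $ 2) - B $ 1 $ 2 * denom A x"
      by (simp add: matrix_mult_2 algebra_simps)
    also have "\<dots> = denom A x * (B $ 2 $ 2 * y - B $ 1 $ 2)"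
      unfolding y[symmetric] by (simp add: algebra_simps)
    finally have "moebius (matrix_inv (A ** B)) x = moebius (matrix_inv B) y"
      unfolding SL2_moebius_inv[OF AB] SL2_moebius_inv[OF B] den using elim
      by (simp only: mult_divide_mult_cancel_left_if if_False)
    then show ?case
      unfolding F_fun_def den y_def[symmetric] by (simp only: mult.assoc flip: of_real_mult) simp
  qed
  ultimately show ?thesis
    unfolding F_rep_eq[of "A ** B"]
    by (simp add: L2_class_eq_iff_line square_integrable_F_fun A B AB square_integrable_L2_fun_line)
qed

lemma F_rep_inverse:
  assumes A: "A \<in> SL2"
  shows "F_rep A (F_rep (matrix_inv A) u) = u" "F_rep (matrix_inv A) (F_rep A u) = u"
  using F_rep_mult[OF A SL2_matrix_inv[OF A]] F_rep_mult[OF SL2_matrix_inv[OF A] A]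
  by (simp_all add: SL2_inverse[OF A] F_rep_one flip: F_rep_mult)

lemma unitary_F_rep: "A \<in> SL2 \<Longrightarrow> unitary_op (F_rep A)"
  unfolding unitary_op_def
  by (auto simp: F_rep_add F_rep_scaleC cinner_F_rep F_rep_inverse
      intro!: o_bij[of "F_rep (matrix_inv A)"])

section \<open>Restriction to the half line\<close>

lemma line_measure_half_line [simp]: "line_measure TYPE(half_line) = restrict_space lborel {0<..}"
  by (simp add: line_measure_half_line_def)

text \<open>On representatives this is extension by zero from the half line and also the projection
  of L2(R) onto the functions living there. It translates statements on
  \<open>restrict_space\<close> into statements on \<open>lborel\<close>.\<close>

definition cutoff :: "(real \<Rightarrow> complex) \<Rightarrow> real \<Rightarrow> complex" where
  "cutoff f x = (if 0 < x then f x else 0)"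

lemma cutoff_eq_indicator: "cutoff f = (\<lambda>x. indicator {0<..} x *\<^sub>R f x)"
  by (auto simp: cutoff_def fun_eq_iff indicator_def)

lemma square_integrable_restrict_iff:
  "square_integrable (restrict_space lborel {0<..}) f \<longleftrightarrow> square_integrable lborel (cutoff f)"
proof -
  have "(\<lambda>x. indicator {0<..} x *\<^sub>R (norm (f x))\<^sup>2) = (\<lambda>x. (norm (cutoff f x))\<^sup>2)"
    by (auto simp: cutoff_def fun_eq_iff indicator_def)
  then show ?thesis
    unfolding square_integrable_def
    by (subst integrable_restrict_space, simp, subst borel_measurable_restrict_space_iff)
      (simp_all add: cutoff_eq_indicator)
qed

lemma square_integrable_cutoff:
  assumes "square_integrable lborel f" shows "square_integrable lborel (cutoff f)"
proof -
  have [measurable]: "f \<in> borel_measurable borel" using assms by (simp add: square_integrable_def)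
  show ?thesis
    by (rule square_integrable_bound[OF assms]) (auto simp: cutoff_def[abs_def])
qed

lemma square_integrable_L2_fun_half_line:
  "square_integrable lborel (cutoff (L2_fun (v :: half_line L2)))"
  using square_integrable_L2_fun[of v] by (simp add: square_integrable_restrict_iff)

lemma AE_half_line_iff: "(AE x in restrict_space lborel {0<..}. P x) \<longleftrightarrow> (AE x in lborel. (0::real) < x \<longrightarrow> P x)"
  by (subst AE_restrict_space_iff) auto

lemma P_plus_adj_eq: "P_plus_adj v = L2_class (cutoff (L2_fun v))"
  unfolding P_plus_adj_def cutoff_def ..

lemma P_plus_adj_L2_class:
  assumes "square_integrable lborel (cutoff f)"
  shows "P_plus_adj (L2_class f) = L2_class (cutoff f)"
proof -
  have sq: "square_integrable (line_measure TYPE(half_line)) f"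
    using assms by (simp add: square_integrable_restrict_iff)
  have "AE x in lborel. 0 < x \<longrightarrow> L2_fun (L2_class f :: half_line L2) x = f x"
    using L2_fun_L2_class[OF sq] unfolding line_measure_half_line AE_half_line_iff .
  then have "AE x in lborel. cutoff (L2_fun (L2_class f :: half_line L2)) x = cutoff f x"
    by eventually_elim (simp add: cutoff_def)
  then show ?thesis
    unfolding P_plus_adj_eq by (simp add: L2_class_eq_iff_line assms square_integrable_L2_fun_half_line)
qed

lemma P_plus_adj_P_plus: "P_plus_adj (P_plus u) = L2_class (cutoff (L2_fun u))"
  unfolding P_plus_def
  by (intro P_plus_adj_L2_class square_integrable_cutoff square_integrable_L2_fun_line)

lemma P_plus_L2_class:
  assumes "square_integrable lborel f"
  shows "P_plus (L2_class f) = L2_class f"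
  unfolding P_plus_def
proof (rule L2_class_cong)
  show "square_integrable (line_measure TYPE(half_line)) (L2_fun (L2_class f :: line L2))"
    "square_integrable (line_measure TYPE(half_line)) f"
    using assms by (simp_all add: square_integrable_restrict_iff square_integrable_cutoff square_integrable_L2_fun_line)
  show "AE x in line_measure TYPE(half_line). L2_fun (L2_class f :: line L2) x = f x"
    unfolding line_measure_half_line AE_half_line_iff
    using L2_fun_L2_class_line[OF assms] by eventually_elim simp
qed

lemma P_plus_P_plus_adj: "P_plus (P_plus_adj v) = v"
proof -
  have "P_plus (P_plus_adj v) = L2_class (cutoff (L2_fun v))"
    unfolding P_plus_adj_eq by (intro P_plus_L2_class square_integrable_L2_fun_half_line)
  also have "\<dots> = L2_class (L2_fun v)"
  proof (rule L2_class_cong)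
    show "square_integrable (line_measure TYPE(half_line)) (cutoff (L2_fun v))"
      by (simp add: square_integrable_restrict_iff square_integrable_cutoff square_integrable_L2_fun_half_line)
    show "AE x in line_measure TYPE(half_line). cutoff (L2_fun v) x = L2_fun v x"
      unfolding line_measure_half_line AE_half_line_iff by (simp add: cutoff_def)
  qed (rule square_integrable_L2_fun)
  finally show ?thesis by (simp add: L2_class_L2_fun)
qed

text \<open>\<open>P_plus_adj\<close> has the left inverse \<open>P_plus\<close>, so identities in
  L2 of the half line can be tested in L2 of the line.\<close>

lemma P_plus_adj_eq_iff: "P_plus_adj u = P_plus_adj v \<longleftrightarrow> u = v"
  by (metis P_plus_P_plus_adj)

lemma cutoff_add: "cutoff (\<lambda>x. f x + g x) = (\<lambda>x. cutoff f x + cutoff g x)"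
  by (auto simp: cutoff_def)

lemma cutoff_cmult: "cutoff (\<lambda>x. c * f x) = (\<lambda>x. c * cutoff f x)"
  by (auto simp: cutoff_def)

lemma P_plus_adj_add: "P_plus_adj (u + v) = P_plus_adj u + P_plus_adj v"
proof -
  have "P_plus_adj (L2_class (\<lambda>x. L2_fun u x + L2_fun v x)) =
      L2_class (\<lambda>x. cutoff (L2_fun u) x + cutoff (L2_fun v) x)"
    by (subst P_plus_adj_L2_class)
      (simp_all add: cutoff_add square_integrable_add square_integrable_L2_fun_half_line)
  also have "\<dots> = P_plus_adj u + P_plus_adj v"
    unfolding P_plus_adj_eq by (intro L2_class_add) (simp_all add: square_integrable_L2_fun_half_line)
  finally show ?thesis by (simp add: plus_L2_def)
qed

lemma P_plus_adj_scaleC: "P_plus_adj (scaleC c u) = scaleC c (P_plus_adj u)"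
proof -
  have "P_plus_adj (L2_class (\<lambda>x. c * L2_fun u x)) = L2_class (\<lambda>x. c * cutoff (L2_fun u) x)"
    by (subst P_plus_adj_L2_class)
      (simp_all add: cutoff_cmult square_integrable_cmult square_integrable_L2_fun_half_line)
  also have "\<dots> = scaleC c (P_plus_adj u)"
    unfolding P_plus_adj_eq by (intro scaleC_L2_class[symmetric]) (simp add: square_integrable_L2_fun_half_line)
  finally show ?thesis by (simp add: scaleC_def)
qed

lemma cinner_P_plus_adj: "cinner (P_plus_adj u) (P_plus_adj v) = cinner u v"
proof -
  have "cinner (P_plus_adj u) (P_plus_adj v) =
      (LINT x|lborel. cutoff (L2_fun u) x * cnj (cutoff (L2_fun v) x))"
    unfolding P_plus_adj_eq by (subst cinner_L2_class) (simp_all add: square_integrable_L2_fun_half_line)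
  also have "\<dots> = (LINT x|lborel. indicator {0<..} x *\<^sub>R (L2_fun u x * cnj (L2_fun v x)))"
    by (intro Bochner_Integration.integral_cong) (auto simp: cutoff_def indicator_def)
  also have "\<dots> = (LINT x|restrict_space lborel {0<..}. L2_fun u x * cnj (L2_fun v x))"
    by (intro integral_restrict_space[symmetric]) simp
  finally show ?thesis by (simp add: cinner_def)
qed

lemma P_plus_add: "P_plus (u + v) = P_plus u + P_plus v"
proof -
  have "P_plus_adj (P_plus (u + v)) = P_plus_adj (P_plus u) + P_plus_adj (P_plus v)"
  proof -
    have "P_plus (u + v) = L2_class (\<lambda>x. L2_fun u x + L2_fun v x)"
      unfolding plus_L2_def by (intro P_plus_L2_class square_integrable_add square_integrable_L2_fun_line)
    then have "P_plus_adj (P_plus (u + v)) = L2_class (\<lambda>x. cutoff (L2_fun u) x + cutoff (L2_fun v) x)"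
      by (simp add: P_plus_adj_L2_class cutoff_add square_integrable_add square_integrable_cutoff square_integrable_L2_fun_line)
    then show ?thesis
      by (simp add: P_plus_adj_P_plus L2_class_add square_integrable_cutoff square_integrable_L2_fun_line)
  qed
  then show ?thesis by (simp add: P_plus_adj_eq_iff flip: P_plus_adj_add)
qed

lemma P_plus_scaleC: "P_plus (scaleC c u) = scaleC c (P_plus u)"
proof -
  have "P_plus (scaleC c u) = L2_class (\<lambda>x. c * L2_fun u x)"
    unfolding scaleC_def by (intro P_plus_L2_class square_integrable_cmult square_integrable_L2_fun_line)
  then have "P_plus_adj (P_plus (scaleC c u)) = L2_class (\<lambda>x. c * cutoff (L2_fun u) x)"
    by (simp add: P_plus_adj_L2_class cutoff_cmult square_integrable_cmult square_integrable_cutoff square_integrable_L2_fun_line)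
  then have "P_plus_adj (P_plus (scaleC c u)) = P_plus_adj (scaleC c (P_plus u))"
    by (simp add: P_plus_adj_scaleC P_plus_adj_P_plus scaleC_L2_class square_integrable_cutoff square_integrable_L2_fun_line)
  then show ?thesis by (simp add: P_plus_adj_eq_iff)
qed

lemma norm_P_plus_le: "norm (P_plus u) \<le> norm u"
proof -
  have "norm (P_plus u) = norm (P_plus_adj (P_plus u))"
    by (simp add: norm_L2_eq_cinner cinner_P_plus_adj)
  also have "\<dots> \<le> norm (L2_class (L2_fun u) :: line L2)"
    unfolding P_plus_adj_P_plus
    by (intro norm_L2_class_le) (simp_all add: square_integrable_cutoff square_integrable_L2_fun_line cutoff_def)
  finally show ?thesis by (simp add: L2_class_L2_fun)
qed

lemma bounded_linear_P_plus: "bounded_linear P_plus"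
  by (rule bounded_linear_intro[where K = 1])
    (simp_all add: P_plus_add P_plus_scaleC scaleR_L2_def norm_P_plus_le)

lemma bounded_linear_P_plus_adj: "bounded_linear P_plus_adj"
  by (rule bounded_linear_intro[where K = 1])
    (simp_all add: P_plus_adj_add P_plus_adj_scaleC scaleR_L2_def norm_L2_eq_cinner cinner_P_plus_adj)


section \<open>Cauchy kernels and the Hardy projection\<close>

definition cauchy_kernel :: "complex \<Rightarrow> real \<Rightarrow> complex" where
  "cauchy_kernel w y = 1 / (of_real y - w)"

lemma of_real_diff_nonzero: "Im w \<noteq> 0 \<Longrightarrow> complex_of_real y - w \<noteq> 0"
  by (auto simp: complex_eq_iff)

lemma cauchy_kernel_measurable [measurable]: "cauchy_kernel w \<in> borel_measurable borel"
  unfolding cauchy_kernel_def[abs_def] by measurable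

lemma square_integrable_cauchy_kernel:
  assumes "Im w \<noteq> 0" shows "square_integrable lborel (cauchy_kernel w)"
proof -
  let ?f = "\<lambda>x. (norm (1 / (complex_of_real (Im w) + \<i> * of_real x)))\<^sup>2"
  have "integrable lborel ?f"
    using square_integrable_resolvent[OF assms] by (simp add: square_integrable_def)
  then have "integrable lborel (\<lambda>x. ?f (- Re w + 1 * x))"
    by (rule lborel_integrable_real_affine) simp
  also have "(\<lambda>x. ?f (- Re w + 1 * x)) = (\<lambda>x. (norm (cauchy_kernel w x))\<^sup>2)"
    by (rule ext) (simp add: cauchy_kernel_def norm_divide power_divide cmod_power2 add.commute)
  finally show ?thesis by (simp add: square_integrable_def)
qed

text \<open>By \<open>inv_fourier\<close> this is the conjugate of an explicit Fourier integral. The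
  pole -i s z has imaginary part - s Re z: positive frequencies put it below the real axis.\<close>

lemma inv_fourier_half_exp:
  assumes s: "\<bar>s\<bar> = 1" and z: "0 < Re z"
  shows "inv fourier (L2_class (half_exp s z)) =
    scaleC (\<i> * of_real (s / sqrt (2 * pi))) (L2_class (cauchy_kernel (- (\<i> * of_real s * z))))"
proof -
  have z': "0 < Re (cnj z)" using z by simp
  note sq = square_integrable_half_exp[OF s z] square_integrable_half_exp[OF s z']
  note int = integrable_L2_class[OF sq(2) half_exp_integral(1)[OF s z']]
  let ?v = "L2_class (half_exp s (cnj z)) :: line L2"
  let ?g = "\<lambda>x. \<i> * of_real (s / sqrt (2 * pi)) * cauchy_kernel (- (\<i> * of_real s * z)) x"
  have Im: "Im (- (\<i> * of_real s * z)) \<noteq> 0" using s z by auto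
  have AE: "AE x in lborel. L2_fun (fourier ?v) x = fourier_integral (half_exp s (cnj z)) x"
    using fourier_L1[OF int(1)] by (simp add: int(2))
  have g: "cnj (fourier_integral (half_exp s (cnj z)) x) = ?g x" for x
  proof -
    have st: "s = 1 \<or> s = - 1" using s by (auto simp: abs_if split: if_splits)
    have "cnj (fourier_integral (half_exp s (cnj z)) x) = of_real (1 / sqrt (2 * pi)) / (z - \<i> * of_real (s * x))"
      by (simp add: fourier_integral_half_exp[OF s z'])
    also have "z - \<i> * of_real (s * x) = - (\<i> * of_real s) * (of_real x - (- (\<i> * of_real s * z)))"
      using st by (auto simp: algebra_simps)
    also have "of_real (1 / sqrt (2 * pi)) / (- (\<i> * of_real s) * (of_real x - (- (\<i> * of_real s * z)))) = ?g x"
    proof -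
      have "P / (- (\<i> * of_real s) * Q) = \<i> * of_real s * P * (1 / Q)" for P Q :: complex
        using st by (auto simp: divide_simps mult_ac)
      from this[of "of_real (1 / sqrt (2 * pi))"] show ?thesis
        by (simp only: cauchy_kernel_def) simp
    qed
    finally show ?thesis .
  qed
  have "inv fourier (L2_class (half_exp s z)) = L2_cnj (fourier ?v)"
    using sq by (simp add: inv_fourier L2_cnj_L2_class cnj_half_exp)
  also have "\<dots> = L2_class ?g"
    unfolding L2_cnj_def
  proof (rule L2_class_cong)
    show "AE x in line_measure TYPE(line). cnj (L2_fun (fourier ?v) x) = ?g x"
      unfolding line_measure_line using AE by eventually_elim (simp only: g)
    show "square_integrable (line_measure TYPE(line)) ?g"
      unfolding line_measure_line by (intro square_integrable_cmult square_integrable_cauchy_kernel Im)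
  qed (intro square_integrable_cnj square_integrable_L2_fun)
  also have "\<dots> = scaleC (\<i> * of_real (s / sqrt (2 * pi))) (L2_class (cauchy_kernel (- (\<i> * of_real s * z))))"
    by (rule scaleC_L2_class[symmetric]) (simp add: square_integrable_cauchy_kernel[OF Im])
  finally show ?thesis .
qed

lemma fourier_inv_fourier [simp]: "fourier (inv fourier u) = u" "inv fourier (fourier u) = u"
  using unitary_opD(3)[OF unitary_fourier] by (simp_all add: bij_is_surj bij_is_inj surj_f_inv_f)

lemma unitary_inv_fourier: "unitary_op (inv fourier)"
  by (rule unitary_op_inv[OF unitary_fourier])

text \<open>Inverts \<open>inv_fourier_half_exp\<close>: each non-real w is the pole of an
  exponential, because with s = - sgn (Im w) the rate z = i s w satisfies -i s z = w and Re z = |Im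
  w| > 0.\<close>

lemma fourier_cauchy_kernel:
  assumes w: "Im w \<noteq> 0"
  defines "s \<equiv> - sgn (Im w)"
  shows "fourier (L2_class (cauchy_kernel w)) =
    scaleC (- (\<i> * of_real (s * sqrt (2 * pi)))) (L2_class (half_exp s (\<i> * of_real s * w)))"
proof -
  have s: "\<bar>s\<bar> = 1" using w by (simp add: s_def abs_sgn_eq)
  have ss: "s * s = 1" using s by (auto simp: abs_if split: if_splits)
  have z: "0 < Re (\<i> * of_real s * w)" using w by (auto simp: s_def sgn_if)
  have "- (\<i> * of_real s * (\<i> * of_real s * w)) = w"
    using ss by (simp add: algebra_simps flip: of_real_mult)
  then have "inv fourier (L2_class (half_exp s (\<i> * of_real s * w))) =
      scaleC (\<i> * of_real (s / sqrt (2 * pi))) (L2_class (cauchy_kernel w))"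
    using inv_fourier_half_exp[OF s z] by simp
  then have "scaleC (- (\<i> * of_real (s * sqrt (2 * pi)))) (inv fourier (L2_class (half_exp s (\<i> * of_real s * w)))) =
      scaleC (- (\<i> * of_real (s * sqrt (2 * pi))) * (\<i> * of_real (s / sqrt (2 * pi)))) (L2_class (cauchy_kernel w))"
    by simp
  also have "- (\<i> * of_real (s * sqrt (2 * pi))) * (\<i> * of_real (s / sqrt (2 * pi))) = (1 :: complex)"
  proof -
    have "- (\<i> * of_real (s * sqrt (2 * pi))) * (\<i> * of_real (s / sqrt (2 * pi))) =
        complex_of_real ((s * sqrt (2 * pi)) * (s / sqrt (2 * pi)))"
      by (simp add: complex_eq_iff)
    also have "(s * sqrt (2 * pi)) * (s / sqrt (2 * pi)) = 1" using ss by simp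
    finally show ?thesis by simp
  qed
  finally have "L2_class (cauchy_kernel w) =
      scaleC (- (\<i> * of_real (s * sqrt (2 * pi)))) (inv fourier (L2_class (half_exp s (\<i> * of_real s * w))))"
    by simp
  then show ?thesis
    by (simp only: unitary_opD(2)[OF unitary_fourier] fourier_inv_fourier)
qed

text \<open>\<open>exp_family_induct\<close> transported by the unitary map
  \<open>inv fourier\<close>, which turns the generators into multiples of kernels with poles -i s
  n.\<close>

lemma cauchy_kernel_induct [case_names closed add scaleR kernel]:
  fixes u :: "line L2"
  assumes closed: "closed {u. P u}" and add: "\<And>u v. P u \<Longrightarrow> P v \<Longrightarrow> P (u + v)"
    and scaleR: "\<And>r u. P u \<Longrightarrow> P (r *\<^sub>R u)"
    and kernel: "\<And>c w. Im w \<noteq> 0 \<Longrightarrow> P (scaleC c (L2_class (cauchy_kernel w)))"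
  shows "P u"
proof -
  note inv = unitary_opD[OF unitary_inv_fourier]
  have "P (inv fourier v)" for v
  proof (induction v rule: exp_family_induct)
    case closed
    have "continuous_on UNIV (inv fourier)"
      by (intro continuous_on_unitary_op[OF unitary_inv_fourier] continuous_on_id)
    from closed_vimage[OF assms(1) this] show ?case by (simp add: vimage_def)
  next
    case (add u v) then show ?case by (simp add: inv assms)
  next
    case (scaleR r u) then show ?case
      using assms(3) by (simp add: linear_simps(5)[OF inv(7)])
  next
    case (basis c s n)
    then show ?case
      by (subst inv(2), subst inv_fourier_half_exp) (auto intro!: kernel)
  qed
  from this[of "fourier u"] show ?thesis by simp
qed

text \<open>The projection onto the Hardy space of the upper half plane, described by its spectrum
  in \<xi> > 0.\<close>

definition hardy_projection :: "line L2 \<Rightarrow> line L2" where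
  "hardy_projection u = inv fourier (P_plus_adj (P_plus (fourier u)))"

lemma bounded_linear_hardy_projection: "bounded_linear hardy_projection"
proof -
  have "bounded_linear (\<lambda>u. inv fourier (P_plus_adj (P_plus (fourier u))))"
    by (intro bounded_linear_compose[OF unitary_opD(7)[OF unitary_inv_fourier]]
        bounded_linear_compose[OF bounded_linear_P_plus_adj]
        bounded_linear_compose[OF bounded_linear_P_plus] unitary_opD(7)[OF unitary_fourier])
  then show ?thesis by (simp add: hardy_projection_def[abs_def])
qed

lemma hardy_projection_scaleC: "hardy_projection (scaleC c u) = scaleC c (hardy_projection u)"
  by (simp add: hardy_projection_def unitary_opD(2)[OF unitary_fourier]
      unitary_opD(2)[OF unitary_inv_fourier] P_plus_scaleC P_plus_adj_scaleC)

text \<open>The transform of a kernel lives on the half line of sign - sgn (Im w), so the cutoff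
  keeps it whole or annihilates it.\<close>

lemma hardy_projection_cauchy_kernel:
  assumes w: "Im w \<noteq> 0"
  shows "hardy_projection (L2_class (cauchy_kernel w)) =
    (if Im w < 0 then L2_class (cauchy_kernel w) else 0)"
proof -
  define s where "s = - sgn (Im w)"
  let ?e = "L2_class (half_exp s (\<i> * of_real s * w)) :: line L2"
  have s: "\<bar>s\<bar> = 1" using w by (simp add: s_def abs_sgn_eq)
  have z: "0 < Re (\<i> * of_real s * w)" using w by (auto simp: s_def sgn_if)
  have sq: "square_integrable lborel (half_exp s (\<i> * of_real s * w))"
    by (rule square_integrable_half_exp[OF s z])
  have "cutoff (half_exp s (\<i> * of_real s * w)) = (if Im w < 0 then half_exp s (\<i> * of_real s * w) else (\<lambda>x. 0))"
    using w by (auto simp: cutoff_def half_exp_def s_def fun_eq_iff)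
  moreover have "P_plus_adj (P_plus ?e) = L2_class (cutoff (half_exp s (\<i> * of_real s * w)))"
    by (simp only: P_plus_L2_class[OF sq] P_plus_adj_L2_class[OF square_integrable_cutoff[OF sq]])
  ultimately have E: "P_plus_adj (P_plus ?e) = (if Im w < 0 then ?e else 0)"
    by (simp add: zero_L2_def)
  have F: "fourier (L2_class (cauchy_kernel w)) = scaleC (- (\<i> * of_real (s * sqrt (2 * pi)))) ?e"
    using fourier_cauchy_kernel[OF w] by (simp add: s_def)
  have "P_plus_adj (P_plus (fourier (L2_class (cauchy_kernel w)))) =
      (if Im w < 0 then fourier (L2_class (cauchy_kernel w)) else 0)"
    unfolding F by (simp add: P_plus_scaleC P_plus_adj_scaleC E)
  then show ?thesis
    using linear_simps(3)[OF unitary_opD(7)[OF unitary_inv_fourier]]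
    by (simp add: hardy_projection_def)
qed

section \<open>The action on Cauchy kernels\<close>

definition moebius_complex :: "real^2^2 \<Rightarrow> complex \<Rightarrow> complex" where
  "moebius_complex A w = (of_real (A $ 1 $ 1) * w + of_real (A $ 1 $ 2)) / (of_real (A $ 2 $ 1) * w + of_real (A $ 2 $ 2))"

lemma SL2_denominator_nonzero:
  assumes A: "A \<in> SL2" and w: "Im w \<noteq> 0"
  shows "of_real (A $ 2 $ 1) * w + of_real (A $ 2 $ 2) \<noteq> 0"
  using SL2_det[OF A] w by (auto simp: complex_eq_iff)

text \<open>Determinant 1 gives Im (A.w) = Im w / |cw + d|^2. Only the sign matters, as it decides
  the fate of the kernel under \<open>hardy_projection\<close>.\<close>

lemma Im_moebius_complex:
  assumes A: "A \<in> SL2" and w: "Im w \<noteq> 0"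
  shows "sgn (Im (moebius_complex A w)) = sgn (Im w)"
proof -
  let ?q = "of_real (A $ 2 $ 1) * w + of_real (A $ 2 $ 2)"
  have q: "0 < (Re ?q)\<^sup>2 + (Im ?q)\<^sup>2"
    using SL2_denominator_nonzero[OF A w] by (simp add: complex_neq_0 del: of_real_mult)
  have "Im (moebius_complex A w) = (A $ 1 $ 1 * A $ 2 $ 2 - A $ 1 $ 2 * A $ 2 $ 1) * Im w / ((Re ?q)\<^sup>2 + (Im ?q)\<^sup>2)"
    unfolding moebius_complex_def Im_divide by (simp add: algebra_simps)
  also have "\<dots> = Im w / ((Re ?q)\<^sup>2 + (Im ?q)\<^sup>2)" using SL2_det[OF A] by simp
  finally show ?thesis using q by (simp add: sgn_divide del: plus_complex.sel)
qed

text \<open>The computation is (a - cx)(A^-1.x - w) = (dx - b) - (a - cx) w = (cw + d)(x - A.w), off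
  the zero of \<open>denom A\<close>.\<close>

lemma F_rep_cauchy_kernel:
  assumes A: "A \<in> SL2" and w: "Im w \<noteq> 0"
  shows "F_rep A (L2_class (cauchy_kernel w)) =
    scaleC (1 / (of_real (A $ 2 $ 1) * w + of_real (A $ 2 $ 2))) (L2_class (cauchy_kernel (moebius_complex A w)))"
proof -
  let ?q = "of_real (A $ 2 $ 1) * w + of_real (A $ 2 $ 2)"
  have q: "?q \<noteq> 0" by (rule SL2_denominator_nonzero[OF A w])
  have w': "Im (moebius_complex A w) \<noteq> 0" using Im_moebius_complex[OF A w] w by (metis sgn_0_0)
  have "AE x in lborel. F_fun A (cauchy_kernel w) x = 1 / ?q * cauchy_kernel (moebius_complex A w) x"
    using AE_denom_nonzero[OF A]
  proof eventually_elim
    case (elim x)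
    have "F_fun A (cauchy_kernel w) x = 1 / (of_real (denom A x) * (of_real (moebius (matrix_inv A) x) - w))"
      by (simp add: F_fun_def cauchy_kernel_def)
    also have "of_real (denom A x) * (of_real (moebius (matrix_inv A) x) - w) =
        of_real (denom A x * moebius (matrix_inv A) x) - of_real (denom A x) * w"
      by (simp only: right_diff_distrib of_real_mult)
    also have "denom A x * moebius (matrix_inv A) x = A $ 2 $ 2 * x - A $ 1 $ 2"
      using elim by (simp add: SL2_moebius_inv[OF A])
    also have "of_real (A $ 2 $ 2 * x - A $ 1 $ 2) - of_real (denom A x) * w =
        ?q * of_real x - (of_real (A $ 1 $ 1) * w + of_real (A $ 1 $ 2))"
      by (simp add: algebra_simps)
    also have "\<dots> = ?q * (of_real x - moebius_complex A w)"
      using q by (simp add: moebius_complex_def right_diff_distrib)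
    finally show ?case
      by (simp only: cauchy_kernel_def[of "moebius_complex A w"] times_divide_times_eq mult_1_left)
  qed
  then have "L2_class (F_fun A (cauchy_kernel w)) = (L2_class (\<lambda>x. 1 / ?q * cauchy_kernel (moebius_complex A w) x) :: line L2)"
    by (intro L2_class_eq_iff_line[THEN iffD2] square_integrable_cmult square_integrable_F_fun A
        square_integrable_cauchy_kernel w w')
  moreover have "F_rep A (L2_class (cauchy_kernel w)) = L2_class (F_fun A (cauchy_kernel w))"
    by (intro F_rep_L2_class A square_integrable_cauchy_kernel w)
  ultimately show ?thesis
    using scaleC_L2_class[where 'd = line, unfolded line_measure_line, OF square_integrable_cauchy_kernel[OF w']]
    by simp
qed

lemma hardy_projection_F_rep:
  assumes A: "A \<in> SL2"
  shows "hardy_projection (F_rep A u) = F_rep A (hardy_projection u)"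
proof (induction u rule: cauchy_kernel_induct)
  case closed
  have "continuous_on UNIV (\<lambda>u. hardy_projection (F_rep A u))"
    "continuous_on UNIV (\<lambda>u. F_rep A (hardy_projection u))"
    by (intro continuous_on_unitary_op[OF unitary_F_rep[OF A]] continuous_on_id
        bounded_linear.continuous_on[OF bounded_linear_hardy_projection])+
  then show ?case by (rule closed_Collect_eq)
next
  case (add u v)
  then show ?case
    by (simp add: F_rep_add[OF A] linear_simps(1)[OF bounded_linear_hardy_projection])
next
  case (scaleR r u)
  then show ?case
    by (simp add: scaleR_L2_def F_rep_scaleC[OF A] hardy_projection_scaleC)
next
  case (kernel c w)
  have sgn: "sgn (Im (moebius_complex A w)) = sgn (Im w)" by (rule Im_moebius_complex[OF A kernel])
  then have neg: "Im (moebius_complex A w) < 0 \<longleftrightarrow> Im w < 0" "Im (moebius_complex A w) \<noteq> 0"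
    using kernel by (metis sgn_less, metis sgn_0_0)
  have "F_rep A 0 = 0" using linear_simps(3)[OF unitary_opD(7)[OF unitary_F_rep[OF A]]] .
  then show ?case
    using kernel neg
    by (simp add: F_rep_scaleC[OF A] hardy_projection_scaleC F_rep_cauchy_kernel[OF A]
        hardy_projection_cauchy_kernel)
qed

section \<open>Strong continuity\<close>

lemma bounded_bilinear_scaleC: "bounded_bilinear (scaleC :: complex \<Rightarrow> 'd::line_measure L2 \<Rightarrow> 'd L2)"
proof
  fix a b :: complex and u v :: "'d L2" and r :: real
  show "scaleC (a + b) u = scaleC a u + scaleC b u" by (rule scaleC_add_left)
  show "scaleC a (u + v) = scaleC a u + scaleC a v" by (rule scaleC_add_right)
  show "scaleC (r *\<^sub>R a) u = r *\<^sub>R scaleC a u" by (simp add: scaleR_L2_def scaleR_conv_of_real)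
  show "scaleC a (r *\<^sub>R u) = r *\<^sub>R scaleC a u" by (simp add: scaleR_L2_def mult.commute)
  show "\<exists>K. \<forall>a (u :: 'd L2). norm (scaleC a u) \<le> norm a * norm u * K"
    by (intro exI[of _ 1]) simp
qed

lemmas continuous_on_scaleC = bounded_bilinear.continuous_on[OF bounded_bilinear_scaleC]

text \<open>Resolvent identity k_v - k_w = (v - w) k_v k_w together with |k_v| \<le> 1/|Im v| on the
  real line.\<close>

lemma norm_cauchy_kernel_diff_le:
  assumes v: "Im v \<noteq> 0" and w: "Im w \<noteq> 0"
  shows "norm (L2_class (cauchy_kernel v) - L2_class (cauchy_kernel w) :: line L2) \<le>
    norm (v - w) / \<bar>Im v\<bar> * norm (L2_class (cauchy_kernel w) :: line L2)"
proof -
  note sq = square_integrable_cauchy_kernel[OF v] square_integrable_cauchy_kernel[OF w]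
  let ?c = "of_real (norm (v - w) / \<bar>Im v\<bar>) :: complex"
  have le: "norm (cauchy_kernel v y - cauchy_kernel w y) \<le> norm (?c * cauchy_kernel w y)" for y
  proof -
    have nz: "complex_of_real y - v \<noteq> 0" "complex_of_real y - w \<noteq> 0"
      by (rule of_real_diff_nonzero[OF v], rule of_real_diff_nonzero[OF w])
    have "cauchy_kernel v y - cauchy_kernel w y = (v - w) / (of_real y - v) * cauchy_kernel w y"
      unfolding cauchy_kernel_def using nz by (simp add: field_simps)
    moreover have "norm ((v - w) / (of_real y - v)) \<le> norm (v - w) / \<bar>Im v\<bar>"
    proof -
      have "\<bar>Im v\<bar> \<le> norm (of_real y - v)" using abs_Im_le_cmod[of "of_real y - v"] by simp
      then show ?thesis using v by (simp add: norm_divide frac_le)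
    qed
    ultimately show ?thesis
      by (simp only: norm_mult norm_of_real) (intro mult_right_mono, auto)
  qed
  have "norm (L2_class (\<lambda>y. cauchy_kernel v y - cauchy_kernel w y) :: line L2) \<le>
      norm (L2_class (\<lambda>y. ?c * cauchy_kernel w y) :: line L2)"
    by (rule norm_L2_class_le[where 'd = line, unfolded line_measure_line,
          OF square_integrable_diff[OF sq] square_integrable_cmult[OF sq(2)]]) (use le in auto)
  also have "\<dots> = norm (v - w) / \<bar>Im v\<bar> * norm (L2_class (cauchy_kernel w) :: line L2)"
    using scaleC_L2_class[where 'd = line, unfolded line_measure_line, OF sq(2), of ?c, symmetric]
    by (simp only: norm_scaleC norm_of_real) simp
  finally show ?thesis
    using L2_class_diff[where 'd = line, unfolded line_measure_line, OF sq] by simp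
qed

lemma continuous_on_cauchy_kernel:
  "continuous_on {w. Im w \<noteq> 0} (\<lambda>w. L2_class (cauchy_kernel w) :: line L2)"
  unfolding continuous_on_def
proof
  let ?S = "{w. Im w \<noteq> 0}" and ?K = "\<lambda>w. L2_class (cauchy_kernel w) :: line L2"
  fix w assume "w \<in> ?S"
  then have w: "Im w \<noteq> 0" by simp
  have bound: "\<forall>\<^sub>F v in at w within ?S. norm (?K v - ?K w) \<le> norm (v - w) / \<bar>Im v\<bar> * norm (?K w)"
    unfolding eventually_at_filter using norm_cauchy_kernel_diff_le[OF _ w] by (intro always_eventually) simp
  have "((\<lambda>v. norm (v - w) / \<bar>Im v\<bar> * norm (?K w)) \<longlongrightarrow> norm (w - w) / \<bar>Im w\<bar> * norm (?K w)) (at w within ?S)"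
    using w by (intro tendsto_intros) auto
  then have "((\<lambda>v. norm (v - w) / \<bar>Im v\<bar> * norm (?K w)) \<longlongrightarrow> 0) (at w within ?S)" by simp
  with bound have "((\<lambda>v. ?K v - ?K w) \<longlongrightarrow> 0) (at w within ?S)"
    by (rule Lim_null_comparison)
  then show "(?K \<longlongrightarrow> ?K w) (at w within ?S)" by (rule LIM_zero_cancel)
qed

text \<open>For isometries, convergence of \<open>x n\<close> to \<open>l\<close> makes the orbit
  maps converge uniformly in \<open>A\<close>. Strong continuity therefore only has to be checked on
  kernels, both for \<open>F_rep\<close> and for translations.\<close>

lemma closed_strongly_continuous:
  fixes T :: "'a::topological_space \<Rightarrow> 'd::line_measure L2 \<Rightarrow> 'd L2"
  assumes isometric: "\<And>A u v. A \<in> S \<Longrightarrow> dist (T A u) (T A v) = dist u v"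
  shows "closed {u. continuous_on S (\<lambda>A. T A u)}"
proof -
  have "continuous_on S (\<lambda>A. T A l)"
    if x: "\<And>n. continuous_on S (\<lambda>A. T A (x n))" and l: "x \<longlonglongrightarrow> l" for x l
  proof (rule uniform_limit_theorem)
    show "\<forall>\<^sub>F n in sequentially. continuous_on S (\<lambda>A. T A (x n))" using x by simp
    show "uniform_limit S (\<lambda>n A. T A (x n)) (\<lambda>A. T A l) sequentially"
    proof (rule uniform_limitI)
      fix e :: real assume "0 < e"
      with l have "\<forall>\<^sub>F n in sequentially. dist (x n) l < e" by (rule tendstoD)
      then show "\<forall>\<^sub>F n in sequentially. \<forall>A\<in>S. dist (T A (x n)) (T A l) < e"
        by eventually_elim (simp add: isometric)
    qed
  qed simp
  then show ?thesis unfolding closed_sequential_limits by blast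
qed

lemma continuous_on_F_rep: "continuous_on SL2 (\<lambda>A. F_rep A u)"
proof (induction u rule: cauchy_kernel_induct)
  case closed
  show ?case
    by (rule closed_strongly_continuous)
      (simp add: dist_norm unitary_opD(5)[OF unitary_F_rep] flip: unitary_opD(6)[OF unitary_F_rep])
next
  case (add u v)
  then have "continuous_on SL2 (\<lambda>A. F_rep A u + F_rep A v)" by (intro continuous_intros)
  then show ?case by (rule continuous_on_eq) (simp add: F_rep_add)
next
  case (scaleR r u)
  then have "continuous_on SL2 (\<lambda>A. r *\<^sub>R F_rep A u)" by (intro continuous_intros)
  then show ?case by (rule continuous_on_eq) (simp add: F_rep_scaleC scaleR_L2_def)
next
  case (kernel c w)
  have entry: "continuous_on SL2 (\<lambda>A :: real^2^2. complex_of_real (A $ i $ j))" for i j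
    by (intro continuous_intros)
  note nz = SL2_denominator_nonzero[OF _ kernel]
  have "continuous_on SL2 (\<lambda>A. moebius_complex A w)"
    unfolding moebius_complex_def by (intro continuous_intros entry ballI) (rule nz)
  moreover have "Im (moebius_complex A w) \<noteq> 0" if "A \<in> SL2" for A
    using Im_moebius_complex[OF that kernel] kernel by (metis sgn_0_0)
  ultimately have "continuous_on SL2 (\<lambda>A. L2_class (cauchy_kernel (moebius_complex A w)) :: line L2)"
    by (intro continuous_on_compose2[OF continuous_on_cauchy_kernel]) auto
  then have "continuous_on SL2 (\<lambda>A. scaleC c (scaleC (1 / (of_real (A $ 2 $ 1) * w + of_real (A $ 2 $ 2)))
      (L2_class (cauchy_kernel (moebius_complex A w)) :: line L2)))"
    by (intro continuous_on_scaleC continuous_intros entry ballI) (rule nz)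
  then show ?case
    by (rule continuous_on_eq) (simp add: F_rep_scaleC F_rep_cauchy_kernel[OF _ kernel])
qed

lemma unitary_rep_F_rep: "unitary_rep_SL2 F_rep"
  unfolding unitary_rep_SL2_def
  by (auto simp: unitary_F_rep F_rep_one F_rep_mult continuous_on_F_rep fun_eq_iff)


section \<open>The representation on the half line and Wiener--Hopf operators\<close>

text \<open>\<open>hardy_projection_F_rep\<close> seen on the Fourier side, where the projection is
  \<open>P_plus_adj\<close> after \<open>P_plus\<close>.\<close>

lemma P_plus_adj_P_plus_fourier_F_rep:
  assumes A: "A \<in> SL2"
  shows "P_plus_adj (P_plus (fourier_F_rep A v)) = fourier_F_rep A (P_plus_adj (P_plus v))"
proof -
  have "fourier (hardy_projection (F_rep A (inv fourier v))) = fourier (F_rep A (hardy_projection (inv fourier v)))"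
    by (simp add: hardy_projection_F_rep[OF A])
  then show ?thesis by (simp add: hardy_projection_def fourier_F_rep_def)
qed

lemma F'_rep_eq: "F'_rep A v = P_plus (fourier_F_rep A (P_plus_adj v))"
  by (simp add: F'_rep_def fourier_F_rep_def)

text \<open>\<open>P_plus_adj\<close> intertwines F' with the conjugated representation. Being
  isometric and injective, it pulls back invariance, multiplicativity and preservation of inner
  products.\<close>

lemma P_plus_adj_F'_rep: "A \<in> SL2 \<Longrightarrow> P_plus_adj (F'_rep A v) = fourier_F_rep A (P_plus_adj v)"
  by (simp add: F'_rep_eq P_plus_adj_P_plus_fourier_F_rep P_plus_P_plus_adj)

lemma fourier_F_rep_invariant:
  "A \<in> SL2 \<Longrightarrow> fourier_F_rep A ` range P_plus_adj \<subseteq> range P_plus_adj"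
  by (auto simp flip: P_plus_adj_F'_rep)

lemma unitary_fourier_F_rep: "A \<in> SL2 \<Longrightarrow> unitary_op (fourier_F_rep A)"
  unfolding fourier_F_rep_def
  by (intro unitary_op_comp unitary_fourier unitary_F_rep unitary_inv_fourier)

lemma fourier_F_rep_mult:
  "A \<in> SL2 \<Longrightarrow> B \<in> SL2 \<Longrightarrow> fourier_F_rep (A ** B) v = fourier_F_rep A (fourier_F_rep B v)"
  by (simp add: fourier_F_rep_def F_rep_mult)

lemma F'_rep_mult:
  assumes "A \<in> SL2" "B \<in> SL2" shows "F'_rep (A ** B) v = F'_rep A (F'_rep B v)"
proof -
  have "P_plus_adj (F'_rep (A ** B) v) = P_plus_adj (F'_rep A (F'_rep B v))"
    using assms by (simp add: P_plus_adj_F'_rep fourier_F_rep_mult SL2_mult)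
  then show ?thesis by (simp add: P_plus_adj_eq_iff)
qed

lemma F'_rep_one: "F'_rep (mat 1) v = v"
proof -
  have "fourier_F_rep (mat 1) (P_plus_adj v) = P_plus_adj v"
    by (simp add: fourier_F_rep_def F_rep_one)
  then show ?thesis by (simp add: F'_rep_eq P_plus_P_plus_adj)
qed

lemma F'_rep_inverse:
  assumes A: "A \<in> SL2"
  shows "F'_rep A (F'_rep (matrix_inv A) v) = v" "F'_rep (matrix_inv A) (F'_rep A v) = v"
  using F'_rep_mult[OF A SL2_matrix_inv[OF A], of v] F'_rep_mult[OF SL2_matrix_inv[OF A] A, of v]
  by (simp_all add: SL2_inverse[OF A] F'_rep_one)

lemma bij_F'_rep: "A \<in> SL2 \<Longrightarrow> bij (F'_rep A)"
  by (rule o_bij[of "F'_rep (matrix_inv A)"]) (auto simp: F'_rep_inverse)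

lemma inv_F'_rep: "A \<in> SL2 \<Longrightarrow> inv (F'_rep A) = F'_rep (matrix_inv A)"
  by (rule inv_equality) (simp_all add: F'_rep_inverse)

lemma unitary_F'_rep:
  assumes A: "A \<in> SL2" shows "unitary_op (F'_rep A)"
proof -
  note G = unitary_opD[OF unitary_fourier_F_rep[OF A]]
  have "cinner (F'_rep A u) (F'_rep A v) = cinner u v" for u v
  proof -
    have "cinner (F'_rep A u) (F'_rep A v) = cinner (P_plus_adj (F'_rep A u)) (P_plus_adj (F'_rep A v))"
      by (rule cinner_P_plus_adj[symmetric])
    then show ?thesis by (simp add: P_plus_adj_F'_rep A G(4) cinner_P_plus_adj)
  qed
  then show ?thesis
    unfolding unitary_op_def
    by (simp add: bij_F'_rep A F'_rep_eq G(1,2) P_plus_adj_add P_plus_adj_scaleC P_plus_add P_plus_scaleC)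
qed

lemma unitary_rep_F'_rep: "unitary_rep_SL2 F'_rep"
proof -
  have "continuous_on SL2 (\<lambda>A. F'_rep A v)" for v
    unfolding F'_rep_eq fourier_F_rep_def comp_def
    by (intro bounded_linear.continuous_on[OF bounded_linear_P_plus]
        continuous_on_unitary_op[OF unitary_fourier] continuous_on_F_rep)
  then show ?thesis
    unfolding unitary_rep_SL2_def
    by (auto simp: unitary_F'_rep F'_rep_one F'_rep_mult fun_eq_iff)
qed

section \<open>Multiplication operators and covariance\<close>

lemma square_integrable_Linf_mult:
  assumes \<kappa>: "\<kappa> \<in> Linf" and f: "square_integrable lborel f"
  shows "square_integrable lborel (\<lambda>x. \<kappa> x * f x)"
proof -
  obtain C where C: "AE x in lborel. norm (\<kappa> x) \<le> C" using \<kappa> by (auto simp: Linf_def)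
  have [measurable]: "\<kappa> \<in> borel_measurable borel" "f \<in> borel_measurable borel"
    using \<kappa> f by (auto simp: Linf_def square_integrable_def)
  show ?thesis
  proof (rule square_integrable_bound[OF square_integrable_cmult[OF f, of "of_real C"]])
    show "AE x in lborel. norm (\<kappa> x * f x) \<le> norm (of_real C * f x)"
      using C
    proof eventually_elim
      case (elim x)
      then have "norm (\<kappa> x) \<le> \<bar>C\<bar>" by simp
      then show ?case by (simp only: norm_mult norm_of_real) (intro mult_right_mono, auto)
    qed
  qed measurable
qed

lemma symbol_act_Linf:
  assumes A: "A \<in> SL2" and \<kappa>: "\<kappa> \<in> Linf"
  shows "symbol_act A \<kappa> \<in> Linf"
proof -
  have [measurable]: "\<kappa> \<in> borel_measurable borel" using \<kappa> by (simp add: Linf_def)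
  obtain C where C: "AE x in lborel. norm (\<kappa> x) \<le> C" using \<kappa> by (auto simp: Linf_def)
  have "AE x in lborel. norm (symbol_act A \<kappa> x) \<le> C"
    unfolding symbol_act_def by (rule AE_moebius_inv[OF A C])
  moreover have "symbol_act A \<kappa> \<in> borel_measurable borel"
    unfolding symbol_act_def by measurable
  ultimately show ?thesis by (auto simp: Linf_def)
qed

text \<open>Substitution respects products, and the weight may stay with the second factor.
  Membership in \<open>Linf\<close> keeps both products in L2, so \<open>L2_class\<close> does not
  fall back on 0.\<close>

lemma F_rep_mult_op:
  assumes A: "A \<in> SL2" and \<kappa>: "\<kappa> \<in> Linf"
  shows "F_rep A (mult_op \<kappa> u) = mult_op (symbol_act A \<kappa>) (F_rep A u)"
proof -
  have "F_rep A (mult_op \<kappa> u) = L2_class (F_fun A (\<lambda>x. \<kappa> x * L2_fun u x))"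
    unfolding mult_op_def
    by (intro F_rep_L2_class A square_integrable_Linf_mult \<kappa> square_integrable_L2_fun_line)
  also have "F_fun A (\<lambda>x. \<kappa> x * L2_fun u x) = (\<lambda>x. symbol_act A \<kappa> x * F_fun A (L2_fun u) x)"
    by (simp only: F_fun_def[abs_def] symbol_act_def mult.left_commute)
  also have "L2_class (\<lambda>x. symbol_act A \<kappa> x * F_fun A (L2_fun u) x) = mult_op (symbol_act A \<kappa>) (F_rep A u)"
    unfolding mult_op_def
  proof (intro L2_class_eq_iff_line[THEN iffD2] square_integrable_Linf_mult symbol_act_Linf A \<kappa>
      square_integrable_F_fun square_integrable_L2_fun_line)
    show "AE x in lborel. symbol_act A \<kappa> x * F_fun A (L2_fun u) x = symbol_act A \<kappa> x * L2_fun (F_rep A u) x"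
      unfolding F_rep_eq
      using L2_fun_L2_class_line[OF square_integrable_F_fun[OF A square_integrable_L2_fun_line[of u]]]
      by eventually_elim simp
  qed
  finally show ?thesis .
qed

lemma wiener_hopf_eq: "wiener_hopf \<kappa> v = P_plus (fourier (mult_op \<kappa> (inv fourier (P_plus_adj v))))"
  by (simp add: wiener_hopf_def)

text \<open>Writing v = F'_A w removes the inverse. What remains is to push F_A through the
  projection, the transform and the multiplication in turn; the symbol changes only at the last of
  these.\<close>

lemma wiener_hopf_covariance:
  assumes A: "A \<in> SL2" and \<kappa>: "\<kappa> \<in> Linf"
  shows "wiener_hopf (symbol_act A \<kappa>) = F'_rep A \<circ> wiener_hopf \<kappa> \<circ> inv (F'_rep A)"
proof
  fix v
  define w where "w = F'_rep (matrix_inv A) v"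
  have v: "v = F'_rep A w" by (simp add: w_def F'_rep_inverse A)
  have "F'_rep A (wiener_hopf \<kappa> w) =
      P_plus (fourier_F_rep A (P_plus_adj (P_plus (fourier (mult_op \<kappa> (inv fourier (P_plus_adj w)))))))"
    by (simp add: F'_rep_eq wiener_hopf_eq)
  \<comment> \<open>The inner projection commutes past \<open>fourier_F_rep A\<close> and is then
    absorbed by the outer \<open>P_plus\<close>.\<close>
  also have "\<dots> = P_plus (fourier_F_rep A (fourier (mult_op \<kappa> (inv fourier (P_plus_adj w)))))"
    by (simp add: P_plus_P_plus_adj flip: P_plus_adj_P_plus_fourier_F_rep[OF A])
  also have "\<dots> = P_plus (fourier (mult_op (symbol_act A \<kappa>) (F_rep A (inv fourier (P_plus_adj w)))))"
    by (simp add: fourier_F_rep_def F_rep_mult_op[OF A \<kappa>])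
  also have "F_rep A (inv fourier (P_plus_adj w)) = inv fourier (fourier_F_rep A (P_plus_adj w))"
    by (simp add: fourier_F_rep_def)
  also have "\<dots> = inv fourier (P_plus_adj v)"
    by (simp add: v P_plus_adj_F'_rep A)
  finally show "wiener_hopf (symbol_act A \<kappa>) v = (F'_rep A \<circ> wiener_hopf \<kappa> \<circ> inv (F'_rep A)) v"
    by (simp add: inv_F'_rep A w_def[symmetric] wiener_hopf_eq)
qed

section \<open>The Hilbert transformation\<close>

definition translate :: "real \<Rightarrow> line L2 \<Rightarrow> line L2" where
  "translate h u = L2_class (\<lambda>x. L2_fun u (x + h))"

lemma AE_translate:
  assumes "AE x in lborel. P (x :: real)"
  shows "AE x in lborel. P (x + h)"
proof -
  have "AE x in lborel. P (h + x)"
    by (rule AE_distrD[where M' = borel and f = "(+) h" and P = P])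
      (simp, simp only: lborel_distr_plus assms)
  then show ?thesis by (simp add: add.commute)
qed

lemma integral_translate:
  fixes f :: "real \<Rightarrow> 'a::{banach, second_countable_topology}"
  shows "integrable lborel (\<lambda>x. f (x + h)) \<longleftrightarrow> integrable lborel f"
    and "(LINT x|lborel. f (x + h)) = (LINT x|lborel. f x)"
  using lborel_integrable_real_affine_iff[of 1 f h] lborel_integral_real_affine[of 1 f h]
  by (simp_all add: add.commute)

lemma square_integrable_translate:
  assumes "square_integrable lborel f" shows "square_integrable lborel (\<lambda>x. f (x + h))"
proof -
  have [measurable]: "f \<in> borel_measurable borel" using assms by (simp add: square_integrable_def)
  show ?thesis
    using assms integral_translate(1)[of "\<lambda>x. (norm (f x))\<^sup>2" h] by (simp add: square_integrable_def)
qed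

lemma translate_L2_class:
  assumes "square_integrable lborel f"
  shows "translate h (L2_class f) = L2_class (\<lambda>x. f (x + h))"
  unfolding translate_def
  by (intro L2_class_eq_iff_line[THEN iffD2] square_integrable_translate square_integrable_L2_fun_line
      assms AE_translate L2_fun_L2_class_line)

lemma translate_add: "translate h (u + v) = translate h u + translate h v"
proof -
  have "translate h (u + v) = L2_class (\<lambda>x. L2_fun u (x + h) + L2_fun v (x + h))"
    unfolding plus_L2_def
    by (intro translate_L2_class square_integrable_add square_integrable_L2_fun_line)
  then show ?thesis
    unfolding translate_def
    by (simp add: L2_class_add square_integrable_translate square_integrable_L2_fun_line)
qed

lemma translate_scaleC: "translate h (scaleC c u) = scaleC c (translate h u)"
proof -
  have "translate h (scaleC c u) = L2_class (\<lambda>x. c * L2_fun u (x + h))"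
    unfolding scaleC_def
    by (intro translate_L2_class square_integrable_cmult square_integrable_L2_fun_line)
  then show ?thesis
    unfolding translate_def
    by (simp add: scaleC_L2_class square_integrable_translate square_integrable_L2_fun_line)
qed

lemma norm_translate: "norm (translate h u) = norm u"
proof -
  have "(norm (translate h u))\<^sup>2 = (LINT x|lborel. (norm (L2_fun u (x + h)))\<^sup>2)"
    unfolding translate_def
    by (subst norm_L2_class_sq) (simp_all add: square_integrable_translate square_integrable_L2_fun_line)
  also have "\<dots> = (norm u)\<^sup>2"
    by (simp add: integral_translate(2)[of "\<lambda>x. (norm (L2_fun u x))\<^sup>2"] norm_L2_sq)
  finally show ?thesis by simp
qed

lemma translate_diff: "translate h (u - v) = translate h u - translate h v"
  using translate_add[of h "u - v" v] by simp

text \<open>Translating a kernel by h moves its pole from w to w - h within the same half plane, so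
  continuity in h is continuity of the kernels in w.\<close>

lemma continuous_on_translate: "continuous_on UNIV (\<lambda>h. translate h u)"
proof (induction u rule: cauchy_kernel_induct)
  case closed
  show ?case
    by (rule closed_strongly_continuous) (simp add: dist_norm norm_translate flip: translate_diff)
next
  case (add u v)
  then show ?case by (simp add: translate_add continuous_on_add)
next
  case (scaleR r u)
  then show ?case
    by (simp add: scaleR_L2_def translate_scaleC continuous_on_scaleC')
next
  case (kernel c w)
  have "translate h (L2_class (cauchy_kernel w)) = L2_class (cauchy_kernel (w - of_real h))" for h
  proof -
    have "(\<lambda>x. cauchy_kernel w (x + h)) = cauchy_kernel (w - of_real h)"
      by (auto simp: cauchy_kernel_def fun_eq_iff algebra_simps)
    then show ?thesis by (simp add: translate_L2_class square_integrable_cauchy_kernel kernel)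
  qed
  moreover have "continuous_on UNIV (\<lambda>h. L2_class (cauchy_kernel (w - of_real h)) :: line L2)"
    by (rule continuous_on_compose2[OF continuous_on_cauchy_kernel])
      (use kernel in \<open>auto intro!: continuous_intros\<close>)
  ultimately show ?case
    by (simp add: translate_scaleC continuous_on_scaleC')
qed

text \<open>The truncated kernel \<open>1/t\<close>, \<open>\<bar>t\<bar> > 1\<close>, minus the conjugate Poisson kernel.\<close>

definition truncation_error :: "real \<Rightarrow> real" where
  "truncation_error t = (if 1 < \<bar>t\<bar> then 1 / t else 0) - t / (t\<^sup>2 + 1)"

section \<open>Estimates for the truncation error\<close>

lemma truncation_error_measurable [measurable]: "truncation_error \<in> borel_measurable borel"
  unfolding truncation_error_def[abs_def] by measurable

text \<open>For |t| > 1 the two terms combine to 1/(t(t^2 + 1)): subtracting the conjugate Poisson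
  kernel cancels the tail 1/t, which is not integrable.\<close>

lemma abs_truncation_error_le: "\<bar>truncation_error t\<bar> \<le> inverse (1 + t\<^sup>2)"
proof (cases "1 < \<bar>t\<bar>")
  case True
  then have t: "t \<noteq> 0" by auto
  have pos: "0 < t\<^sup>2 + 1" by (intro add_nonneg_pos) auto
  have "truncation_error t = 1 / (t * (t\<^sup>2 + 1))"
    using True t pos by (simp add: truncation_error_def divide_simps) (simp add: power2_eq_square)
  then have "\<bar>truncation_error t\<bar> = 1 / \<bar>t\<bar> * inverse (1 + t\<^sup>2)"
    using pos by (simp add: abs_mult divide_inverse add.commute)
  also have "\<dots> \<le> 1 * inverse (1 + t\<^sup>2)"
    using True pos by (intro mult_right_mono) (auto simp: add.commute)
  finally show ?thesis by simp
next
  case False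
  have pos: "0 < 1 + t\<^sup>2" by (intro add_pos_nonneg) auto
  have "\<bar>truncation_error t\<bar> = \<bar>t\<bar> / (1 + t\<^sup>2)"
    using False pos by (simp add: truncation_error_def add.commute)
  also have "\<dots> \<le> 1 / (1 + t\<^sup>2)" using False pos by (intro divide_right_mono) auto
  finally show ?thesis by (simp add: inverse_eq_divide)
qed

lemma integrable_truncation_error: "integrable lborel truncation_error"
proof (rule Bochner_Integration.integrable_bound)
  show "integrable lborel (\<lambda>t :: real. inverse (1 + t\<^sup>2))"
    using integrable_inverse_1_plus_square by (simp add: set_integrable_def)
  show "AE t in lborel. norm (truncation_error t) \<le> norm (inverse (1 + t\<^sup>2))"
    using abs_truncation_error_le by (auto intro: order_trans)
qed measurable

lemma square_integrable_truncation_error: "square_integrable lborel (\<lambda>t. complex_of_real (truncation_error t))"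
  unfolding square_integrable_def
proof
  have le1: "\<bar>truncation_error t\<bar> \<le> 1" for t
    using abs_truncation_error_le[of t] inverse_le_1_iff[of "1 + t\<^sup>2"] by simp
  have "\<bar>truncation_error t\<bar>\<^sup>2 \<le> \<bar>truncation_error t\<bar>" for t
    unfolding power2_eq_square by (rule mult_left_le[OF le1 abs_ge_zero])
  then show "integrable lborel (\<lambda>t. (norm (complex_of_real (truncation_error t)))\<^sup>2)"
    by (intro Bochner_Integration.integrable_bound[OF integrable_truncation_error]) auto
qed measurable

lemma integral_truncation_error: "(LINT t|lborel. truncation_error t) = 0"
proof -
  have "truncation_error (0 + (- 1) * t) = - truncation_error t" for t
    by (simp add: truncation_error_def)
  then have "(LINT t|lborel. truncation_error t) = - (LINT t|lborel. truncation_error t)"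
    using lborel_integral_real_affine[of "- 1" truncation_error 0] by simp
  then show ?thesis by simp
qed

text \<open>Convolution with the dilated error, after substituting y = x + \<epsilon> t. The
  dilation then acts on the argument of \<open>u\<close>, where continuity of translations can be
  used.\<close>

definition truncation_remainder :: "real \<Rightarrow> line L2 \<Rightarrow> real \<Rightarrow> complex" where
  "truncation_remainder \<epsilon> u x = (LINT t|lborel. of_real (truncation_error t) * L2_fun u (x + \<epsilon> * t))"

lemma integrable_truncation_remainder:
  fixes u :: "line L2"
  assumes "\<epsilon> \<noteq> 0"
  shows "integrable lborel (\<lambda>t. of_real (truncation_error t) * L2_fun u (x + \<epsilon> * t))"
proof -
  have "integrable lborel (\<lambda>t. (norm (L2_fun u t))\<^sup>2)"
    using square_integrable_L2_fun_line[of u] by (simp add: square_integrable_def)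
  then have "integrable lborel (\<lambda>t. (norm (L2_fun u (x + \<epsilon> * t)))\<^sup>2)"
    by (rule lborel_integrable_real_affine[OF _ assms])
  then have "square_integrable lborel (\<lambda>t. cnj (L2_fun u (x + \<epsilon> * t)))"
    by (simp add: square_integrable_def)
  from integrable_square_integrable_mult[OF square_integrable_truncation_error this]
  show ?thesis by simp
qed

lemma truncation_remainder_measurable [measurable]: "truncation_remainder \<epsilon> u \<in> borel_measurable borel"
  unfolding truncation_remainder_def[abs_def] by measurable

lemma norm_translate_diff_sq_le: "(norm (translate h u - u))\<^sup>2 \<le> (2 * norm u)\<^sup>2"
  using norm_triangle_ineq4[of "translate h u" u] by (intro power_mono) (simp_all add: norm_translate)

lemma norm_translate_diff_sq:
  "(\<integral>\<^sup>+x. ennreal ((norm (L2_fun u (x + h) - L2_fun u x))\<^sup>2) \<partial>lborel) = ennreal ((norm (translate h u - u))\<^sup>2)"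
proof -
  note sq = square_integrable_translate[OF square_integrable_L2_fun_line[of u], of h] square_integrable_L2_fun_line[of u]
  have "translate h u - u = L2_class (\<lambda>x. L2_fun u (x + h) - L2_fun u x)"
    using L2_class_diff[where 'd = line, unfolded line_measure_line, OF sq]
    by (simp add: translate_def L2_class_L2_fun)
  then have "(norm (translate h u - u))\<^sup>2 = (LINT x|lborel. (norm (L2_fun u (x + h) - L2_fun u x))\<^sup>2)"
    using norm_L2_class_sq[where 'd = line, unfolded line_measure_line, OF square_integrable_diff[OF sq]] by simp
  then show ?thesis
    using square_integrable_diff[OF sq]
    by (simp add: square_integrable_def nn_integral_eq_integral)
qed

text \<open>Young's inequality \<open>\<parallel>R * g\<parallel>\<^sub>2\<^sup>2 \<le> \<parallel>R\<parallel>\<^sub>1 \<integral> \<bar>R\<bar> \<bar>g\<bar>\<^sup>2\<close>, after using \<open>\<integral> R = 0\<close> to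
  replace \<open>u (x + \<epsilon> t)\<close> by \<open>u (x + \<epsilon> t) - u x\<close>.\<close>

lemma truncation_remainder_bound:
  fixes u :: "line L2"
  assumes \<epsilon>: "\<epsilon> \<noteq> 0"
  defines "I \<equiv> LINT t|lborel. \<bar>truncation_error t\<bar>"
    and "J \<equiv> LINT t|lborel. \<bar>truncation_error t\<bar> * (norm (translate (\<epsilon> * t) u - u))\<^sup>2"
  shows "square_integrable lborel (truncation_remainder \<epsilon> u)"
    "(norm (L2_class (truncation_remainder \<epsilon> u) :: line L2))\<^sup>2 \<le> I * J"
proof -
  let ?R = truncation_error and ?g = "\<lambda>x t. norm (L2_fun u (x + \<epsilon> * t) - L2_fun u x)"
  have intR: "integrable lborel (\<lambda>t. \<bar>?R t\<bar>)" using integrable_truncation_error by simp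
  have cont: "continuous_on UNIV (\<lambda>t. (norm (translate (\<epsilon> * t) u - u))\<^sup>2)"
    by (intro continuous_intros continuous_on_compose2[OF continuous_on_translate]) auto
  have [measurable]: "(\<lambda>t. (norm (translate (\<epsilon> * t) u - u))\<^sup>2) \<in> borel_measurable borel"
    by (rule borel_measurable_continuous_onI[OF cont])
  have intJ: "integrable lborel (\<lambda>t. \<bar>?R t\<bar> * (norm (translate (\<epsilon> * t) u - u))\<^sup>2)"
  proof (rule Bochner_Integration.integrable_bound)
    show "integrable lborel (\<lambda>t. \<bar>?R t\<bar> * (2 * norm u)\<^sup>2)" using intR by simp
    show "AE t in lborel. norm (\<bar>?R t\<bar> * (norm (translate (\<epsilon> * t) u - u))\<^sup>2) \<le> norm (\<bar>?R t\<bar> * (2 * norm u)\<^sup>2)"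
      using norm_translate_diff_sq_le by (intro AE_I2) (simp add: abs_mult mult_left_mono)
  qed measurable
  have pointwise: "ennreal ((norm (truncation_remainder \<epsilon> u x))\<^sup>2) \<le>
      ennreal I * (\<integral>\<^sup>+t. ennreal (\<bar>?R t\<bar> * (?g x t)\<^sup>2) \<partial>lborel)" for x
  proof -
    have int: "integrable lborel (\<lambda>t. of_real (?R t) * (L2_fun u (x + \<epsilon> * t) - L2_fun u x))"
      unfolding right_diff_distrib
      by (intro Bochner_Integration.integrable_diff integrable_truncation_remainder \<epsilon> integrable_mult_left)
        (use integrable_truncation_error in simp)
    have "truncation_remainder \<epsilon> u x = (LINT t|lborel. of_real (?R t) * (L2_fun u (x + \<epsilon> * t) - L2_fun u x))"
      unfolding right_diff_distrib truncation_remainder_def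
      using integrable_truncation_error integral_truncation_error integrable_truncation_remainder[OF \<epsilon>]
      by (subst Bochner_Integration.integral_diff) simp_all
    then have "ennreal (norm (truncation_remainder \<epsilon> u x)) \<le> (\<integral>\<^sup>+t. ennreal (\<bar>?R t\<bar> * ?g x t) \<partial>lborel)"
      using integral_norm_bound_ennreal[OF int] by (simp add: norm_mult)
    \<comment> \<open>Splitting |R| as a product of two square roots prepares Cauchy-Schwarz.
      Working in \<open>ennreal\<close> postpones all finiteness questions to
      \<open>bound\<close>.\<close>
    also have "\<dots> = (\<integral>\<^sup>+t. ennreal (sqrt \<bar>?R t\<bar>) * ennreal (sqrt \<bar>?R t\<bar> * ?g x t) \<partial>lborel)"
      by (intro nn_integral_cong) (simp flip: ennreal_mult mult.assoc)
    finally have "(ennreal (norm (truncation_remainder \<epsilon> u x)))\<^sup>2 \<le>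
        (\<integral>\<^sup>+t. ennreal (sqrt \<bar>?R t\<bar>) * ennreal (sqrt \<bar>?R t\<bar> * ?g x t) \<partial>lborel)\<^sup>2"
      by (intro power_mono) auto
    also have "\<dots> \<le> (\<integral>\<^sup>+t. (ennreal (sqrt \<bar>?R t\<bar>))\<^sup>2 \<partial>lborel) * (\<integral>\<^sup>+t. (ennreal (sqrt \<bar>?R t\<bar> * ?g x t))\<^sup>2 \<partial>lborel)"
      by (rule Cauchy_Schwarz_nn_integral) measurable
    also have "(\<integral>\<^sup>+t. (ennreal (sqrt \<bar>?R t\<bar>))\<^sup>2 \<partial>lborel) = ennreal I"
      unfolding I_def using intR by (simp add: ennreal_power nn_integral_eq_integral)
    also have "(\<lambda>t. (ennreal (sqrt \<bar>?R t\<bar> * ?g x t))\<^sup>2) = (\<lambda>t. ennreal (\<bar>?R t\<bar> * (?g x t)\<^sup>2))"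
      by (simp add: ennreal_power power_mult_distrib)
    finally show ?thesis by (simp add: ennreal_power)
  qed
  have J: "(\<integral>\<^sup>+x. \<integral>\<^sup>+t. ennreal (\<bar>?R t\<bar> * (?g x t)\<^sup>2) \<partial>lborel \<partial>lborel) = ennreal J"
  proof -
    have "(\<integral>\<^sup>+x. \<integral>\<^sup>+t. ennreal (\<bar>?R t\<bar> * (?g x t)\<^sup>2) \<partial>lborel \<partial>lborel) =
        (\<integral>\<^sup>+t. \<integral>\<^sup>+x. ennreal (\<bar>?R t\<bar> * (?g x t)\<^sup>2) \<partial>lborel \<partial>lborel)"
      by (rule lborel_pair.Fubini'[symmetric]) measurable
    also have "\<dots> = (\<integral>\<^sup>+t. ennreal (\<bar>?R t\<bar> * (norm (translate (\<epsilon> * t) u - u))\<^sup>2) \<partial>lborel)"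
      by (intro nn_integral_cong) (simp add: ennreal_mult nn_integral_cmult norm_translate_diff_sq)
    also have "\<dots> = ennreal J"
      unfolding J_def by (rule nn_integral_eq_integral[OF intJ]) auto
    finally show ?thesis .
  qed
  have "(\<integral>\<^sup>+x. ennreal ((norm (truncation_remainder \<epsilon> u x))\<^sup>2) \<partial>lborel) \<le>
      (\<integral>\<^sup>+x. ennreal I * (\<integral>\<^sup>+t. ennreal (\<bar>?R t\<bar> * (?g x t)\<^sup>2) \<partial>lborel) \<partial>lborel)"
    by (intro nn_integral_mono pointwise)
  also have "\<dots> = ennreal I * ennreal J"
    by (subst nn_integral_cmult) (simp_all add: J)
  finally have bound: "(\<integral>\<^sup>+x. ennreal ((norm (truncation_remainder \<epsilon> u x))\<^sup>2) \<partial>lborel) \<le> ennreal I * ennreal J" .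
  have IJ: "0 \<le> I" "0 \<le> J" by (simp_all add: I_def J_def)
  show sq: "square_integrable lborel (truncation_remainder \<epsilon> u)"
    unfolding square_integrable_def
  proof
    have "(\<integral>\<^sup>+x. ennreal ((norm (truncation_remainder \<epsilon> u x))\<^sup>2) \<partial>lborel) < \<infinity>"
      using bound by (rule le_less_trans) (simp add: ennreal_mult_less_top)
    then show "integrable lborel (\<lambda>x. (norm (truncation_remainder \<epsilon> u x))\<^sup>2)"
      by (intro integrableI_bounded) auto
  qed measurable
  have "(\<integral>\<^sup>+x. ennreal ((norm (truncation_remainder \<epsilon> u x))\<^sup>2) \<partial>lborel) =
      ennreal ((norm (L2_class (truncation_remainder \<epsilon> u) :: line L2))\<^sup>2)"
    using sq norm_L2_class_sq[where 'd = line, unfolded line_measure_line, OF sq]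
    by (simp add: square_integrable_def nn_integral_eq_integral)
  with bound show "(norm (L2_class (truncation_remainder \<epsilon> u) :: line L2))\<^sup>2 \<le> I * J"
    using IJ by (simp flip: ennreal_mult)
qed

text \<open>For fixed t, translation by \<epsilon> t moves \<open>u\<close> arbitrarily little, and
  never by more than 2 norm u. Dominated convergence in t sends the bound of
  \<open>truncation_remainder_bound\<close> to 0.\<close>

lemma truncation_remainder_tendsto_0:
  assumes \<epsilon>: "\<And>n. \<epsilon> n \<noteq> 0" "\<epsilon> \<longlonglongrightarrow> 0"
  shows "(\<lambda>n. L2_class (truncation_remainder (\<epsilon> n) u) :: line L2) \<longlonglongrightarrow> 0"
proof -
  let ?R = truncation_error
  let ?J = "\<lambda>n. LINT t|lborel. \<bar>?R t\<bar> * (norm (translate (\<epsilon> n * t) u - u))\<^sup>2"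
  let ?I = "LINT t|lborel. \<bar>?R t\<bar>"
  have t0: "translate 0 u = u" by (simp add: translate_def L2_class_L2_fun)
  have intR: "integrable lborel (\<lambda>t. \<bar>?R t\<bar>)" using integrable_truncation_error by simp
  have [measurable]: "(\<lambda>t. (norm (translate (\<epsilon> n * t) u - u))\<^sup>2) \<in> borel_measurable borel" for n
    by (intro borel_measurable_continuous_onI continuous_intros continuous_on_compose2[OF continuous_on_translate]) auto
  have "?J \<longlonglongrightarrow> (LINT t|(lborel :: real measure). 0)"
  proof (rule integral_dominated_convergence[where w = "\<lambda>t. \<bar>?R t\<bar> * (2 * norm u)\<^sup>2"])
    show "integrable lborel (\<lambda>t. \<bar>?R t\<bar> * (2 * norm u)\<^sup>2)" using intR by simp
    show "AE t in lborel. norm (\<bar>?R t\<bar> * (norm (translate (\<epsilon> n * t) u - u))\<^sup>2) \<le> \<bar>?R t\<bar> * (2 * norm u)\<^sup>2" for n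
      using norm_translate_diff_sq_le by (intro AE_I2) (simp add: abs_mult mult_left_mono)
    show "AE t in lborel. (\<lambda>n. \<bar>?R t\<bar> * (norm (translate (\<epsilon> n * t) u - u))\<^sup>2) \<longlonglongrightarrow> 0"
    proof (intro AE_I2)
      fix t
      have "(\<lambda>n. \<epsilon> n * t) \<longlonglongrightarrow> 0 * t" by (intro tendsto_intros \<epsilon>)
      then have "(\<lambda>n. translate (\<epsilon> n * t) u) \<longlonglongrightarrow> translate (0 * t) u"
        by (intro continuous_on_tendsto_compose[OF continuous_on_translate]) auto
      then have "(\<lambda>n. \<bar>?R t\<bar> * (norm (translate (\<epsilon> n * t) u - u))\<^sup>2) \<longlonglongrightarrow> \<bar>?R t\<bar> * (norm (translate (0 * t) u - u))\<^sup>2"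
        by (intro tendsto_intros)
      then show "(\<lambda>n. \<bar>?R t\<bar> * (norm (translate (\<epsilon> n * t) u - u))\<^sup>2) \<longlonglongrightarrow> 0" by (simp add: t0)
    qed
  qed measurable
  then have "(\<lambda>n. sqrt (?I * ?J n)) \<longlonglongrightarrow> sqrt (?I * 0)"
    by (intro tendsto_intros) simp
  then have "(\<lambda>n. sqrt (?I * ?J n)) \<longlonglongrightarrow> 0" by simp
  moreover have "norm (L2_class (truncation_remainder (\<epsilon> n) u) :: line L2) \<le> sqrt (?I * ?J n)" for n
    using truncation_remainder_bound(2)[OF \<epsilon>(1)] by (rule real_le_rsqrt)
  ultimately show ?thesis
    by (rule Lim_null_comparison[OF always_eventually[OF allI], rotated])
qed

text \<open>The part on the half line of sign s of exp(-\<epsilon>|\<xi>|) times the transform of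
  \<open>u\<close>. The parts for s = 1 and s = -1 come from the Cauchy integrals above and below
  the real axis.\<close>

definition poisson_multiplier :: "real \<Rightarrow> real \<Rightarrow> line L2 \<Rightarrow> real \<Rightarrow> complex" where
  "poisson_multiplier s \<epsilon> u \<xi> = half_exp s (of_real \<epsilon>) \<xi> * L2_fun (fourier u) \<xi>"

lemma poisson_multiplier_measurable [measurable]: "poisson_multiplier s \<epsilon> u \<in> borel_measurable borel"
  unfolding poisson_multiplier_def[abs_def] by measurable

lemma norm_poisson_multiplier_le:
  "0 \<le> \<epsilon> \<Longrightarrow> norm (poisson_multiplier s \<epsilon> u \<xi>) \<le> norm (L2_fun (fourier u) \<xi>)"
  unfolding poisson_multiplier_def norm_mult
  using norm_half_exp_le_1[of "of_real \<epsilon>" s \<xi>] by (simp add: mult_left_le_one_le)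

lemma square_integrable_poisson_multiplier:
  "0 \<le> \<epsilon> \<Longrightarrow> square_integrable lborel (poisson_multiplier s \<epsilon> u)"
  by (rule square_integrable_bound[OF square_integrable_L2_fun_line[of "fourier u"]])
    (auto intro: norm_poisson_multiplier_le)

section \<open>Cauchy integrals and conjugate Poisson integrals\<close>

lemma inv_fourier_L1:
  assumes sq: "square_integrable lborel g" and int: "integrable lborel g"
  shows "AE x in lborel. L2_fun (inv fourier (L2_class g)) x =
    of_real (1 / sqrt (2 * pi)) * (LINT \<xi>|lborel. exp (\<i> * of_real (x * \<xi>)) * g \<xi>)"
proof -
  have sqc: "square_integrable lborel (\<lambda>\<xi>. cnj (g \<xi>))" by (rule square_integrable_cnj[OF sq])
  have intc: "integrable lborel (\<lambda>\<xi>. cnj (g \<xi>))" using int by simp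
  let ?v = "L2_class (\<lambda>\<xi>. cnj (g \<xi>)) :: line L2"
  have eq: "inv fourier (L2_class g) = L2_class (\<lambda>x. cnj (L2_fun (fourier ?v) x))"
    unfolding inv_fourier using sq by (simp add: L2_cnj_L2_class L2_cnj_def[of "fourier _"])
  have "AE x in lborel. L2_fun (inv fourier (L2_class g)) x = cnj (L2_fun (fourier ?v) x)"
    unfolding eq by (intro L2_fun_L2_class_line square_integrable_cnj square_integrable_L2_fun_line)
  moreover have "AE x in lborel. L2_fun (fourier ?v) x = fourier_integral (\<lambda>\<xi>. cnj (g \<xi>)) x"
    using fourier_L1[OF integrable_L2_class(1)[OF sqc intc]]
    by (simp only: integrable_L2_class(2)[OF sqc intc])
  ultimately show ?thesis
  proof eventually_elim
    case (elim x)
    have "cnj (LINT \<xi>|lborel. exp (- \<i> * of_real (x * \<xi>)) * cnj (g \<xi>)) =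
        (LINT \<xi>|lborel. cnj (exp (- \<i> * of_real (x * \<xi>)) * cnj (g \<xi>)))"
      by (rule Bochner_Integration.integral_cnj[symmetric])
    also have "\<dots> = (LINT \<xi>|lborel. exp (\<i> * of_real (x * \<xi>)) * g \<xi>)"
      by (simp add: exp_cnj)
    finally show ?case
      unfolding elim fourier_integral_def complex_cnj_mult complex_cnj_complex_of_real by (simp only:)
  qed
qed

lemma integrable_mult_cauchy_kernel:
  assumes "Im w \<noteq> 0"
  shows "integrable lborel (\<lambda>y. L2_fun (u :: line L2) y * cauchy_kernel w y)"
proof -
  have "Im (cnj w) \<noteq> 0" using assms by simp
  from integrable_square_integrable_mult[OF square_integrable_L2_fun_line[of u] square_integrable_cauchy_kernel[OF this]]
  show ?thesis by (simp add: cauchy_kernel_def)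
qed

text \<open>The left-hand side is an inner product with a Cauchy kernel; take it on the Fourier side.\<close>

lemma cauchy_integral_eq:
  assumes s: "\<bar>s\<bar> = 1" and \<epsilon>: "0 < \<epsilon>"
  shows "AE x in lborel. (LINT y|lborel. L2_fun u y * cauchy_kernel (of_real x + \<i> * of_real (s * \<epsilon>)) y) =
    2 * of_real pi * \<i> * of_real s * L2_fun (inv fourier (L2_class (poisson_multiplier s \<epsilon> u))) x"
proof -
  have st: "s = 1 \<or> s = - 1" using s by (auto simp: abs_if split: if_splits)
  have int: "integrable lborel (poisson_multiplier s \<epsilon> u)"
  proof -
    have "integrable lborel (\<lambda>\<xi>. half_exp s (of_real \<epsilon>) \<xi> * cnj (cnj (L2_fun (fourier u) \<xi>)))"
      by (intro integrable_square_integrable_mult square_integrable_cnj square_integrable_half_exp s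
          square_integrable_L2_fun_line) (use \<epsilon> in simp)
    then show ?thesis by (simp add: poisson_multiplier_def[abs_def])
  qed
  have sq: "square_integrable lborel (poisson_multiplier s \<epsilon> u)"
    using \<epsilon> by (intro square_integrable_poisson_multiplier) simp
  show ?thesis
    using inv_fourier_L1[OF sq int]
  proof eventually_elim
    case (elim x)
    \<comment> \<open>The conjugate of the point x + i s \<epsilon>, because \<open>cinner\<close>
      conjugates its second argument.\<close>
    define w where "w = of_real x - \<i> * of_real (s * \<epsilon>)"
    have w: "Im w \<noteq> 0" using st \<epsilon> by (auto simp: w_def)
    have sw: "- sgn (Im w) = s" using st \<epsilon> by (auto simp: w_def)
    have zw: "\<i> * of_real s * w = of_real \<epsilon> + \<i> * of_real (s * x)"
      using st by (auto simp: w_def algebra_simps)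
    have sqh: "square_integrable lborel (half_exp s (\<i> * of_real s * w))"
      unfolding zw using \<epsilon> by (intro square_integrable_half_exp s) simp
    have "(LINT y|lborel. L2_fun u y * cauchy_kernel (of_real x + \<i> * of_real (s * \<epsilon>)) y) =
        (LINT y|lborel. L2_fun u y * cnj (cauchy_kernel w y))"
      by (simp add: cauchy_kernel_def w_def)
    also have "\<dots> = cinner (L2_class (L2_fun u)) (L2_class (cauchy_kernel w) :: line L2)"
      by (subst cinner_L2_class) (simp_all add: square_integrable_L2_fun_line square_integrable_cauchy_kernel w)
    also have "\<dots> = cinner (fourier u) (fourier (L2_class (cauchy_kernel w)))"
      by (simp add: L2_class_L2_fun unitary_opD(4)[OF unitary_fourier])
    also have "\<dots> = \<i> * of_real (s * sqrt (2 * pi)) * cinner (L2_class (L2_fun (fourier u))) (L2_class (half_exp s (\<i> * of_real s * w)) :: line L2)"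
      by (simp add: fourier_cauchy_kernel[OF w, unfolded sw] cinner_scaleC_right L2_class_L2_fun)
    also have "cinner (L2_class (L2_fun (fourier u))) (L2_class (half_exp s (\<i> * of_real s * w)) :: line L2) =
        (LINT \<xi>|lborel. L2_fun (fourier u) \<xi> * cnj (half_exp s (\<i> * of_real s * w) \<xi>))"
      by (subst cinner_L2_class) (simp_all add: square_integrable_L2_fun_line sqh)
    also have "\<dots> = (LINT \<xi>|lborel. exp (\<i> * of_real (x * \<xi>)) * poisson_multiplier s \<epsilon> u \<xi>)"
    proof (rule Bochner_Integration.integral_cong[OF refl])
      fix \<xi> :: real
      have "cnj (half_exp s (\<i> * of_real s * w) \<xi>) = exp (\<i> * of_real (x * \<xi>)) * half_exp s (of_real \<epsilon>) \<xi>"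
        unfolding zw cnj_half_exp using st by (auto simp: half_exp_def algebra_simps simp flip: exp_add)
      then show "L2_fun (fourier u) \<xi> * cnj (half_exp s (\<i> * of_real s * w) \<xi>) =
          exp (\<i> * of_real (x * \<xi>)) * poisson_multiplier s \<epsilon> u \<xi>"
        by (simp add: poisson_multiplier_def)
    qed
    also have "\<dots> = of_real (sqrt (2 * pi)) * L2_fun (inv fourier (L2_class (poisson_multiplier s \<epsilon> u))) x"
      unfolding elim by simp
    also have "\<i> * of_real (s * sqrt (2 * pi)) * (of_real (sqrt (2 * pi)) * L2_fun (inv fourier (L2_class (poisson_multiplier s \<epsilon> u))) x) =
        2 * of_real pi * \<i> * of_real s * L2_fun (inv fourier (L2_class (poisson_multiplier s \<epsilon> u))) x"
    proof -
      have root: "complex_of_real (sqrt (2 * pi)) * of_real (sqrt (2 * pi)) = 2 * of_real pi"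
        unfolding of_real_mult[symmetric] by simp
      have reorder: "\<i> * (S * r) * (r * X) = r * r * (\<i> * S * X)" for S r X :: complex
        by (simp only: mult_ac)
      show ?thesis unfolding of_real_mult[of s] reorder root by (simp only: mult.assoc)
    qed
    finally show ?case .
  qed
qed

text \<open>With t = y - x, the mean of 1/(t - i\<epsilon>) and 1/(t + i\<epsilon>) is t/(t^2 +
  \<epsilon>^2), the conjugate Poisson kernel; the dilated error is what is left. The factors 1 and
  -1 in front of \<open>\<epsilon>\<close> match the parameter s of
  \<open>cauchy_integral_eq\<close>.\<close>

lemma truncated_kernel_decomposition:
  assumes \<epsilon>: "0 < \<epsilon>"
  shows "indicator {y. \<epsilon> < \<bar>y - x\<bar>} y *\<^sub>R (a / complex_of_real (y - x)) =
    (a * cauchy_kernel (of_real x + \<i> * of_real (1 * \<epsilon>)) y + a * cauchy_kernel (of_real x + \<i> * of_real ((- 1) * \<epsilon>)) y) / 2 +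
    of_real (truncation_error ((y - x) / \<epsilon>) / \<epsilon>) * a"
proof -
  define t where "t = y - x"
  have pos: "0 < t\<^sup>2 + \<epsilon>\<^sup>2" using \<epsilon> by (intro add_nonneg_pos) auto
  have nz: "complex_of_real t - \<i> * of_real \<epsilon> \<noteq> 0" "complex_of_real t + \<i> * of_real \<epsilon> \<noteq> 0"
    using \<epsilon> by (auto simp: complex_eq_iff)
  have prod: "(complex_of_real t - \<i> * of_real \<epsilon>) * (of_real t + \<i> * of_real \<epsilon>) = of_real (t\<^sup>2 + \<epsilon>\<^sup>2)"
    by (simp add: algebra_simps power2_eq_square)
  have "1 / (complex_of_real t - \<i> * of_real \<epsilon>) + 1 / (of_real t + \<i> * of_real \<epsilon>) =
      (of_real t + \<i> * of_real \<epsilon> + (of_real t - \<i> * of_real \<epsilon>)) / of_real (t\<^sup>2 + \<epsilon>\<^sup>2)"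
    unfolding prod[symmetric] using nz by (simp add: add_frac_eq mult.commute add.commute)
  also have "\<dots> = of_real (2 * (t / (t\<^sup>2 + \<epsilon>\<^sup>2)))" by simp
  finally have sum: "1 / (complex_of_real t - \<i> * of_real \<epsilon>) + 1 / (of_real t + \<i> * of_real \<epsilon>) =
    of_real (2 * (t / (t\<^sup>2 + \<epsilon>\<^sup>2)))" .
  have "truncation_error (t / \<epsilon>) / \<epsilon> = (if \<epsilon> < \<bar>t\<bar> then 1 / t else 0) - t / (t\<^sup>2 + \<epsilon>\<^sup>2)"
  proof -
    have "(t / \<epsilon>) / ((t / \<epsilon>)\<^sup>2 + 1) / \<epsilon> = t / (t\<^sup>2 + \<epsilon>\<^sup>2)"
    proof -
      have "((t / \<epsilon>)\<^sup>2 + 1) * (\<epsilon> * \<epsilon>) = t\<^sup>2 + \<epsilon>\<^sup>2"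
        using \<epsilon> by (simp add: power_divide distrib_right power2_eq_square)
      then show ?thesis by (simp add: divide_divide_eq_left mult.commute mult.left_commute)
    qed
    then show ?thesis
      using \<epsilon> by (simp add: truncation_error_def diff_divide_distrib)
  qed
  then have error: "of_real (truncation_error (t / \<epsilon>) / \<epsilon>) =
      complex_of_real (if \<epsilon> < \<bar>t\<bar> then 1 / t else 0) - of_real (t / (t\<^sup>2 + \<epsilon>\<^sup>2))"
    by simp
  have "a * cauchy_kernel (of_real x + \<i> * of_real (1 * \<epsilon>)) y + a * cauchy_kernel (of_real x + \<i> * of_real ((- 1) * \<epsilon>)) y =
      a * (1 / (complex_of_real t - \<i> * of_real \<epsilon>) + 1 / (of_real t + \<i> * of_real \<epsilon>))"
    by (simp add: cauchy_kernel_def t_def distrib_left diff_diff_eq add.commute diff_add_eq)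
  also have "\<dots> = 2 * (of_real (t / (t\<^sup>2 + \<epsilon>\<^sup>2)) * a)"
    unfolding sum by simp
  finally have kernels: "a * cauchy_kernel (of_real x + \<i> * of_real (1 * \<epsilon>)) y + a * cauchy_kernel (of_real x + \<i> * of_real ((- 1) * \<epsilon>)) y =
    2 * (of_real (t / (t\<^sup>2 + \<epsilon>\<^sup>2)) * a)" .
  have "indicator {y. \<epsilon> < \<bar>y - x\<bar>} y *\<^sub>R (a / complex_of_real (y - x)) =
      complex_of_real (if \<epsilon> < \<bar>t\<bar> then 1 / t else 0) * a"
    by (simp add: t_def indicator_def)
  also have "\<dots> = 2 * (of_real (t / (t\<^sup>2 + \<epsilon>\<^sup>2)) * a) / 2 + of_real (truncation_error (t / \<epsilon>) / \<epsilon>) * a"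
  proof -
    have "c * a = 2 * (p * a) / 2 + (c - p) * a" for c p :: complex
      by (simp add: left_diff_distrib)
    then show ?thesis unfolding error .
  qed
  finally show ?thesis unfolding kernels t_def[symmetric] by simp
qed

lemma truncated_integral_eq:
  assumes \<epsilon>: "0 < \<epsilon>"
  shows "(LINT y:{y. \<epsilon> < \<bar>y - x\<bar>}|lborel. L2_fun u y / complex_of_real (y - x)) =
    ((LINT y|lborel. L2_fun u y * cauchy_kernel (of_real x + \<i> * of_real (1 * \<epsilon>)) y) +
     (LINT y|lborel. L2_fun u y * cauchy_kernel (of_real x + \<i> * of_real ((- 1) * \<epsilon>)) y)) / 2 +
    truncation_remainder \<epsilon> u x"
proof -
  let ?k = "\<lambda>s y. L2_fun u y * cauchy_kernel (of_real x + \<i> * of_real (s * \<epsilon>)) y"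
  let ?r = "\<lambda>y. of_real (truncation_error ((y - x) / \<epsilon>) / \<epsilon>) * L2_fun u y"
  have int_k: "integrable lborel (?k s)" if "s \<noteq> 0" for s
    using that \<epsilon> by (intro integrable_mult_cauchy_kernel) simp
  have r: "?r (x + \<epsilon> * t) = of_real (1 / \<epsilon>) * (of_real (truncation_error t) * L2_fun u (x + \<epsilon> * t))" for t
    using \<epsilon> by simp
  have int_r: "integrable lborel ?r"
  proof -
    have "integrable lborel (\<lambda>t. ?r (x + \<epsilon> * t))"
      unfolding r using \<epsilon> by (intro integrable_mult_right integrable_truncation_remainder) simp
    then show ?thesis using lborel_integrable_real_affine_iff[of \<epsilon> ?r x] \<epsilon> by simp
  qed
  have "(LINT y|lborel. ?r y) = \<bar>\<epsilon>\<bar> *\<^sub>R (LINT t|lborel. ?r (x + \<epsilon> * t))"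
    using \<epsilon> by (intro lborel_integral_real_affine) simp
  also have "\<dots> = truncation_remainder \<epsilon> u x"
    unfolding r integral_mult_right_zero truncation_remainder_def using \<epsilon> by (simp add: scaleR_conv_of_real)
  finally have int_r_eq: "(LINT y|lborel. ?r y) = truncation_remainder \<epsilon> u x" .
  have "(LINT y:{y. \<epsilon> < \<bar>y - x\<bar>}|lborel. L2_fun u y / complex_of_real (y - x)) =
      (LINT y|lborel. (?k 1 y + ?k (- 1) y) / 2 + ?r y)"
    unfolding set_lebesgue_integral_def truncated_kernel_decomposition[OF \<epsilon>] ..
  also have "\<dots> = (LINT y|lborel. (?k 1 y + ?k (- 1) y) / 2) + (LINT y|lborel. ?r y)"
    by (intro Bochner_Integration.integral_add int_r integrable_divide_zero Bochner_Integration.integrable_add int_k) auto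
  also have "(LINT y|lborel. (?k 1 y + ?k (- 1) y) / 2) = ((LINT y|lborel. ?k 1 y) + (LINT y|lborel. ?k (- 1) y)) / 2"
    by (simp only: integral_divide_zero Bochner_Integration.integral_add[OF int_k int_k] zero_neq_one neg_equal_0_iff_equal
        not_False_eq_True one_neq_zero)
  finally show ?thesis unfolding int_r_eq .
qed

text \<open>The Cauchy integrals contribute 2\<pi>i and -2\<pi>i times the two multiplier terms.
  Halving and dividing by i\<pi> leaves their plain difference.\<close>

lemma hilbert_truncated_eq:
  assumes \<epsilon>: "0 < \<epsilon>"
  shows "hilbert_truncated \<epsilon> u =
    inv fourier (L2_class (\<lambda>\<xi>. poisson_multiplier 1 \<epsilon> u \<xi> - poisson_multiplier (- 1) \<epsilon> u \<xi>)) +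
    scaleC (1 / (\<i> * of_real pi)) (L2_class (truncation_remainder \<epsilon> u))"
proof -
  let ?m = "\<lambda>s. L2_class (poisson_multiplier s \<epsilon> u) :: line L2"
  let ?c = "1 / (\<i> * complex_of_real pi)"
  have sqm: "square_integrable lborel (poisson_multiplier s \<epsilon> u)" for s
    using \<epsilon> by (intro square_integrable_poisson_multiplier) simp
  have sqr: "square_integrable lborel (truncation_remainder \<epsilon> u)"
    using \<epsilon> by (intro truncation_remainder_bound) simp
  let ?v = "inv fourier (?m 1) - inv fourier (?m (- 1)) + scaleC ?c (L2_class (truncation_remainder \<epsilon> u))"
  have "AE x in lborel. ?c * (LINT y:{y. \<epsilon> < \<bar>y - x\<bar>}|lborel. L2_fun u y / complex_of_real (y - x)) = L2_fun ?v x"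
    using cauchy_integral_eq[of 1 \<epsilon> u, simplified abs_one, OF refl \<epsilon>]
      cauchy_integral_eq[of "- 1" \<epsilon> u, simplified abs_minus_cancel abs_one, OF refl \<epsilon>]
      L2_fun_plus_line[of "inv fourier (?m 1) - inv fourier (?m (- 1))" "scaleC ?c (L2_class (truncation_remainder \<epsilon> u))"]
      L2_fun_diff[where 'd = line, unfolded line_measure_line, of "inv fourier (?m 1)" "inv fourier (?m (- 1))"]
      L2_fun_scaleC_line[of ?c "L2_class (truncation_remainder \<epsilon> u)"]
      L2_fun_L2_class_line[OF sqr]
  proof eventually_elim
    case (elim x)
    show ?case
      unfolding truncated_integral_eq[OF \<epsilon>] elim by (simp add: field_simps)
  qed
  \<comment> \<open>Measurability together with almost everywhere equality to an L2 function gives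
    square integrability. Without it \<open>hilbert_truncated\<close> would be the default
    0.\<close>
  moreover have "(\<lambda>x. ?c * (LINT y:{y. \<epsilon> < \<bar>y - x\<bar>}|lborel. L2_fun u y / complex_of_real (y - x))) \<in> borel_measurable lborel"
    unfolding set_lebesgue_integral_def by measurable
  ultimately have sqh: "square_integrable lborel (\<lambda>x. ?c * (LINT y:{y. \<epsilon> < \<bar>y - x\<bar>}|lborel. L2_fun u y / complex_of_real (y - x)))"
    and "AE x in lborel. ?c * (LINT y:{y. \<epsilon> < \<bar>y - x\<bar>}|lborel. L2_fun u y / complex_of_real (y - x)) = L2_fun ?v x"
    by (auto intro: square_integrable_bound[OF square_integrable_L2_fun_line[of ?v]] elim: eventually_mono)
  then have "hilbert_truncated \<epsilon> u = L2_class (L2_fun ?v)"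
    unfolding hilbert_truncated_def by (intro L2_class_eq_iff_line[THEN iffD2] square_integrable_L2_fun_line)
  moreover have "L2_class (\<lambda>\<xi>. poisson_multiplier 1 \<epsilon> u \<xi> - poisson_multiplier (- 1) \<epsilon> u \<xi>) = ?m 1 - ?m (- 1)"
    by (intro L2_class_diff) (simp_all add: sqm)
  ultimately show ?thesis by (simp add: L2_class_L2_fun unitary_opD(6)[OF unitary_inv_fourier])
qed

text \<open>Off \<xi> = 0 the multiplier tends to the sign, written as twice the cutoff minus 1 so
  that the limit is expressed by \<open>hardy_projection\<close>. The limit is taken along sequences
  because dominated convergence is a statement about sequences.\<close>

lemma hilbert_truncated_tendsto:
  "((\<lambda>\<epsilon>. hilbert_truncated \<epsilon> u) \<longlongrightarrow> 2 *\<^sub>R hardy_projection u - u) (at_right 0)"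
  unfolding tendsto_at_iff_sequentially
proof (intro allI impI)
  fix \<epsilon> :: "nat \<Rightarrow> real"
  assume pos: "\<forall>n. \<epsilon> n \<in> {0<..} - {0}" and \<epsilon>: "\<epsilon> \<longlonglongrightarrow> 0"
  then have pos: "0 < \<epsilon> n" for n by auto
  let ?v = "L2_fun (fourier u)"
  note sqv = square_integrable_L2_fun_line[of "fourier u"]
  have "(\<lambda>n. L2_class (\<lambda>\<xi>. poisson_multiplier 1 (\<epsilon> n) u \<xi> - poisson_multiplier (- 1) (\<epsilon> n) u \<xi>) :: line L2)
      \<longlonglongrightarrow> L2_class (\<lambda>\<xi>. 2 * cutoff ?v \<xi> - ?v \<xi>)"
  proof (rule tendsto_L2_class_dominated[where 'd = line and w = "\<lambda>\<xi>. 2 * ?v \<xi>", unfolded line_measure_line])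
    show "square_integrable lborel (\<lambda>\<xi>. 2 * ?v \<xi>)" by (intro square_integrable_cmult sqv)
    have [measurable]: "cutoff ?v \<in> borel_measurable borel"
      using square_integrable_cutoff[OF sqv] by (simp add: square_integrable_def)
    show "(\<lambda>\<xi>. 2 * cutoff ?v \<xi> - ?v \<xi>) \<in> borel_measurable lborel" by measurable
    show "(\<lambda>\<xi>. poisson_multiplier 1 (\<epsilon> n) u \<xi> - poisson_multiplier (- 1) (\<epsilon> n) u \<xi>) \<in> borel_measurable lborel" for n
      by measurable
    show "AE \<xi> in lborel. norm (poisson_multiplier 1 (\<epsilon> n) u \<xi> - poisson_multiplier (- 1) (\<epsilon> n) u \<xi>) \<le> norm (2 * ?v \<xi>)" for n
    proof (intro AE_I2)
      fix \<xi>
      have "norm (poisson_multiplier s (\<epsilon> n) u \<xi>) \<le> norm (?v \<xi>)" for s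
        using pos[of n] by (intro norm_poisson_multiplier_le) simp
      from this[of 1] this[of "- 1"]
      show "norm (poisson_multiplier 1 (\<epsilon> n) u \<xi> - poisson_multiplier (- 1) (\<epsilon> n) u \<xi>) \<le> norm (2 * ?v \<xi>)"
        using norm_triangle_ineq4[of "poisson_multiplier 1 (\<epsilon> n) u \<xi>" "poisson_multiplier (- 1) (\<epsilon> n) u \<xi>"]
        by (simp add: norm_mult)
    qed
    have "AE \<xi> in lborel. \<xi> \<noteq> (0 :: real)" by (rule AE_lborel_singleton)
    then show "AE \<xi> in lborel. (\<lambda>n. poisson_multiplier 1 (\<epsilon> n) u \<xi> - poisson_multiplier (- 1) (\<epsilon> n) u \<xi>)
        \<longlonglongrightarrow> 2 * cutoff ?v \<xi> - ?v \<xi>"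
    proof eventually_elim
      case (elim \<xi>)
      have "(\<lambda>n. poisson_multiplier s (\<epsilon> n) u \<xi>) \<longlonglongrightarrow> (if 0 < s * \<xi> then 1 else 0) * ?v \<xi>" for s
      proof (cases "0 < s * \<xi>")
        case True
        have "(\<lambda>n. exp (- (complex_of_real (\<epsilon> n) * of_real (s * \<xi>))) * ?v \<xi>) \<longlonglongrightarrow>
            exp (- (of_real 0 * of_real (s * \<xi>))) * ?v \<xi>"
          by (intro tendsto_intros \<epsilon>)
        then show ?thesis using True by (simp add: poisson_multiplier_def half_exp_def)
      qed (simp add: poisson_multiplier_def half_exp_def)
      then have "(\<lambda>n. poisson_multiplier 1 (\<epsilon> n) u \<xi> - poisson_multiplier (- 1) (\<epsilon> n) u \<xi>) \<longlonglongrightarrow>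
          (if 0 < 1 * \<xi> then 1 else 0) * ?v \<xi> - (if 0 < - 1 * \<xi> then 1 else 0) * ?v \<xi>"
        by (intro tendsto_diff)
      moreover have "(if 0 < 1 * \<xi> then 1 else 0) * ?v \<xi> - (if 0 < - 1 * \<xi> then 1 else 0) * ?v \<xi> = 2 * cutoff ?v \<xi> - ?v \<xi>"
        using elim by (auto simp: cutoff_def)
      ultimately show ?case by simp
    qed
  qed
  moreover have "L2_class (\<lambda>\<xi>. 2 * cutoff ?v \<xi> - ?v \<xi>) = scaleC 2 (P_plus_adj (P_plus (fourier u))) - fourier u"
    using L2_class_diff[where 'd = line, unfolded line_measure_line, OF square_integrable_cmult[OF square_integrable_cutoff[OF sqv], of 2] sqv]
    by (simp add: P_plus_adj_P_plus scaleC_L2_class square_integrable_cutoff sqv L2_class_L2_fun)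
  ultimately have "(\<lambda>n. inv fourier (L2_class (\<lambda>\<xi>. poisson_multiplier 1 (\<epsilon> n) u \<xi> - poisson_multiplier (- 1) (\<epsilon> n) u \<xi>)))
      \<longlonglongrightarrow> inv fourier (scaleC 2 (P_plus_adj (P_plus (fourier u))) - fourier u)"
    by (intro bounded_linear.tendsto[OF unitary_opD(7)[OF unitary_inv_fourier]]) simp
  moreover have "(\<lambda>n. scaleC (1 / (\<i> * of_real pi)) (L2_class (truncation_remainder (\<epsilon> n) u) :: line L2)) \<longlonglongrightarrow>
      scaleC (1 / (\<i> * of_real pi)) 0"
    using pos by (intro tendsto_scaleC truncation_remainder_tendsto_0 \<epsilon>) (simp add: less_imp_neq[symmetric])
  ultimately have "(\<lambda>n. hilbert_truncated (\<epsilon> n) u) \<longlonglongrightarrow>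
      inv fourier (scaleC 2 (P_plus_adj (P_plus (fourier u))) - fourier u) + scaleC (1 / (\<i> * of_real pi)) 0"
    unfolding hilbert_truncated_eq[OF pos] by (rule tendsto_add)
  then show "((\<lambda>\<epsilon>. hilbert_truncated \<epsilon> u) \<circ> \<epsilon>) \<longlonglongrightarrow> 2 *\<^sub>R hardy_projection u - u"
    by (simp add: comp_def unitary_opD(2,6)[OF unitary_inv_fourier] hardy_projection_def scaleR_L2_def)
qed

lemma hilbert_eq: "hilbert u = 2 *\<^sub>R hardy_projection u - u"
  unfolding hilbert_def by (intro tendsto_Lim hilbert_truncated_tendsto trivial_limit_at_right_real)

lemma F_rep_hilbert:
  assumes A: "A \<in> SL2" shows "F_rep A \<circ> hilbert = hilbert \<circ> F_rep A"
  using unitary_opD(2,6)[OF unitary_F_rep[OF A]]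
  by (simp add: fun_eq_iff hilbert_eq scaleR_L2_def hardy_projection_F_rep[OF A])

text \<open>The range of \<open>P_plus_adj\<close> is the copy of L2 of the half line inside L2 of
  the line. Its invariance is what makes F' a subrepresentation and not merely a
  compression.\<close>

theorem mainTheorem9:
  shows "unitary_rep_SL2 F_rep \<and>
    (\<forall>A\<in>SL2. F_rep A \<circ> hilbert = hilbert \<circ> F_rep A) \<and>
    (\<forall>A\<in>SL2. fourier_F_rep A ` range P_plus_adj \<subseteq> range P_plus_adj) \<and>
    unitary_rep_SL2 F'_rep \<and>
    (\<forall>A\<in>SL2. \<forall>\<kappa>\<in>Linf.
      wiener_hopf (symbol_act A \<kappa>) = F'_rep A \<circ> wiener_hopf \<kappa> \<circ> inv (F'_rep A))"
  using unitary_rep_F_rep F_rep_hilbert fourier_F_rep_invariant unitary_rep_F'_rep wiener_hopf_covariance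
  by blast

end
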